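(* Let $f:\mathbb{R}\times\mathbb{R}^n\times\mathbb{R}^m\to\mathbb{R}^n$ be continuously differentiable, let $\Omega\subseteq\mathbb{R}^m$ be compact, let $K\subset\mathbb{R}^n$ be compact, and suppose there exists $Q>0$ such that for all $t\in\mathbb{R}$, $x\in\mathbb{R}^n$, $u\in\Omega$ $$\Big\|\frac{\partial f}{\partial x}(t,x,u)\,x\Big\|\le Q\|x\|\quad\text{and}\quad \Big\|\frac{\partial f}{\partial u}(t,0,u)\,u\Big\|\le Q\|u\|.$$ If the system $\dot x=f(t,x,u)$ is stabilizable over $K$ by a feedback $u=u(t,x)$ with values in $\Omega$, then for every $\delta>0$, every $t_0\in\mathbb{R}$ and every $x_0\in K$ there exist $\nu_0\in\mathbb{R}^n$ and $T>0$ with $T>t_0$ such that for the solution $(x(t),\nu(t))$ of the system $$\dot x=\frac{\partial}{\partial\nu}S(\nu,t,x,u),\qquad \dot\nu=-\frac{\partial}{\partial x}S(\nu,t,x,u),$$ where $S(\nu,t,x,u)=\langle\nu,f(t,x,u)\rangle$ and the control $u=u(t,x,\nu)\in\Omega$ is a solution of the minimization problem $$S(\nu,t,x,u)\to\inf_{u\in\Omega},$$ with the initial conditions $x(t_0)=x_0$, $\nu(t_0)=\nu_0$, we have $$\|x(T)\|\le\delta\quad\text{and}\quad \nu(T)=x(T).$$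
   Context: $\mathbb{R}^n$ carries a scalar product $\langle\cdot,\cdot\rangle$ and $\|x\|=\sqrt{\langle x,x\rangle}$. The system is $\dot x=f(t,x,u)$ with state $x\in\mathbb{R}^n$ and control input $u$. Feedbacks $u=u(t,x)$ (possibly discontinuous, possibly time dependent) take values in the compact set $\Omega\subseteq\mathbb{R}^m$. For a feedback $u(t,x)$, $x(t,t_0,x_0)$ denotes the solution, in Filippov's sense, of the closed loop initial value problem $\dot x=f(t,x,u(t,x))$, $x(t_0)=x_0$. The origin is called an equilibrium if $x=0$ is a Filippov solution of the closed loop system. Definition (stabilizability). The system is stabilizable over a compact set $K\subset\mathbb{R}^n$ by the feedback $u(t,x)$ if the solutions of the closed loop system satisfy $\lim_{t\to\infty}x(t,t_0,x_0)=0$ for all $x_0\in K$ and all $t_0\in\mathbb{R}$, and the equilibrium $x=0$ is stable (in the sense of Lyapunov). *)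

theory Defs
  imports "HOL-Analysis.Analysis"
begin

text \<open>
  Throughout, \<open>\<real>\<^sup>n\<close> with an arbitrary scalar product is rendered by a type \<open>'a :: euclidean_space\<close>.
\<close>

definition continuously_differentiable :: "('a::real_normed_vector \<Rightarrow> 'b::real_normed_vector) \<Rightarrow> bool" where
  "continuously_differentiable F \<longleftrightarrow>
     (\<exists>F' :: 'a \<Rightarrow> 'a \<Rightarrow>\<^sub>L 'b.
        (\<forall>p. (F has_derivative blinfun_apply (F' p)) (at p)) \<and> continuous_on UNIV F')"

text \<open>
  The usual \<open>\<epsilon>\<close>-\<open>\<delta>\<close> notion; the finite families of non-overlapping closed intervals are the
  library's divisions, and \<open>k = {Inf k..Sup k}\<close> for each member \<open>k\<close>.
\<close>

definition abs_continuous_on :: "real set \<Rightarrow> (real \<Rightarrow> 'a::real_normed_vector) \<Rightarrow> bool" where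
  "abs_continuous_on I x \<longleftrightarrow>
     (\<forall>\<epsilon>>0. \<exists>\<delta>>0. \<forall>D. D division_of \<Union>D \<and> \<Union>D \<subseteq> I \<and> (\<Sum>k\<in>D. Sup k - Inf k) < \<delta> \<longrightarrow>
        (\<Sum>k\<in>D. norm (x (Sup k) - x (Inf k))) < \<epsilon>)"

text \<open>
  Filippov's set-valued regularization of a possibly discontinuous right-hand side \<open>g\<close>:
  \<open>t\<close> is frozen, and \<open>N\<close> ranges over the Lebesgue null sets of the state space.
\<close>

definition filippov_set :: "(real \<Rightarrow> 'a::euclidean_space \<Rightarrow> 'a) \<Rightarrow> real \<Rightarrow> 'a \<Rightarrow> 'a set" where
  "filippov_set g t x =
     (\<Inter>r\<in>{0<..}. \<Inter>N\<in>{N. negligible N}. closure (convex hull (g t ` (ball x r - N))))"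

definition filippov_solution_on ::
    "real set \<Rightarrow> (real \<Rightarrow> 'a::euclidean_space \<Rightarrow> 'a) \<Rightarrow> (real \<Rightarrow> 'a) \<Rightarrow> bool" where
  "filippov_solution_on I g x \<longleftrightarrow>
     (\<forall>a b. {a..b} \<subseteq> I \<longrightarrow> abs_continuous_on {a..b} x) \<and>
     (AE t in lebesgue. t \<in> I \<longrightarrow>
        (\<exists>v\<in>filippov_set g t (x t). (x has_vector_derivative v) (at t within I)))"

definition origin_equilibrium :: "(real \<Rightarrow> 'a::euclidean_space \<Rightarrow> 'a) \<Rightarrow> bool" where
  "origin_equilibrium g \<longleftrightarrow> filippov_solution_on UNIV g (\<lambda>t. 0)"

text \<open>
  Filippov solutions need not be unique, so stability constrains every solution starting near
  the origin. Solutions on bounded intervals \<open>{t0..<b}\<close> are included, so that a solution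
  escaping in finite time violates stability.
\<close>

definition lyapunov_stable :: "(real \<Rightarrow> 'a::euclidean_space \<Rightarrow> 'a) \<Rightarrow> bool" where
  "lyapunov_stable g \<longleftrightarrow>
     (\<forall>t0. \<forall>\<epsilon>>0. \<exists>\<delta>>0. \<forall>b>t0. \<forall>x. filippov_solution_on {t0..<b} g x \<and> norm (x t0) < \<delta> \<longrightarrow>
        (\<forall>t\<in>{t0..<b}. norm (x t) < \<epsilon>))"

text \<open>
  Existence of a solution on \<open>{t0..}\<close> for each initial state in \<open>K\<close> is part of the definition:
  the convergence requirement would otherwise hold vacuously for feedbacks, e.g. not measurable
  in time, whose closed loop has no solution at all.
\<close>

definition stabilizable_by ::
    "(real \<Rightarrow> 'a::euclidean_space \<Rightarrow> 'b \<Rightarrow> 'a) \<Rightarrow> 'a set \<Rightarrow> (real \<Rightarrow> 'a \<Rightarrow> 'b) \<Rightarrow> bool" where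
  "stabilizable_by f K u \<longleftrightarrow>
     (let g = (\<lambda>t x. f t x (u t x)) in
        (\<forall>t0. \<forall>x0\<in>K.
           (\<exists>x. filippov_solution_on {t0..} g x \<and> x t0 = x0) \<and>
           (\<forall>x. filippov_solution_on {t0..} g x \<and> x t0 = x0 \<longrightarrow> (x \<longlongrightarrow> 0) at_top)) \<and>
        origin_equilibrium g \<and> lyapunov_stable g)"

definition gradient :: "('a::real_inner \<Rightarrow> real) \<Rightarrow> 'a \<Rightarrow> 'a" where
  "gradient \<phi> y = (THE D. GDERIV \<phi> y :> D)"

definition S_fun ::
    "(real \<Rightarrow> 'a::real_inner \<Rightarrow> 'b \<Rightarrow> 'a) \<Rightarrow> 'a \<Rightarrow> real \<Rightarrow> 'a \<Rightarrow> 'b \<Rightarrow> real" where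
  "S_fun f \<nu> t x u = inner \<nu> (f t x u)"

definition minimizing_control ::
    "(real \<Rightarrow> 'a::real_inner \<Rightarrow> 'b \<Rightarrow> 'a) \<Rightarrow> 'b set \<Rightarrow> (real \<Rightarrow> 'a \<Rightarrow> 'a \<Rightarrow> 'b) \<Rightarrow> bool" where
  "minimizing_control f \<Omega> w \<longleftrightarrow>
     (\<forall>t x \<nu>. is_arg_min (S_fun f \<nu> t x) (\<lambda>u. u \<in> \<Omega>) (w t x \<nu>))"

text \<open>
  The partial gradients of \<open>S\<close> are taken with the control value held fixed; the feedback
  \<open>w t x \<nu>\<close> is substituted afterwards.
\<close>

definition hamiltonian_field ::
    "(real \<Rightarrow> 'a::real_inner \<Rightarrow> 'b \<Rightarrow> 'a) \<Rightarrow> (real \<Rightarrow> 'a \<Rightarrow> 'a \<Rightarrow> 'b) \<Rightarrow> real \<Rightarrow> 'a \<times> 'a \<Rightarrow> 'a \<times> 'a" where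
  "hamiltonian_field f w t z =
     (case z of (x, \<nu>) \<Rightarrow>
        (gradient (\<lambda>\<eta>. S_fun f \<eta> t x (w t x \<nu>)) \<nu>,
         - gradient (\<lambda>y. S_fun f \<nu> t y (w t x \<nu>)) x))"

end

theory Submission
  imports Defs "HOL-Complex_Analysis.Great_Picard"
begin

text \<open>
  The pair \<open>(x, \<nu>)\<close> is an extremal of the problem of minimizing \<open>\<parallel>x(T)\<parallel>\<close> over the relaxed
  trajectories (velocities in the convex hull of \<open>f t x \<Omega>\<close>), whose transversality condition is
  \<open>\<nu>(T) = x(T)\<close>. A Filippov solution of the stabilized closed loop is such a trajectory and is small at
  a late time \<open>T\<close>, so the minimum is small. The extremal is obtained from Euler schemes: in discrete
  time the reachable sets are compact, a minimizer exists and the adjoint recursion is a backward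
  induction; the linear interpolations converge by Arzela-Ascoli to a Lipschitz, hence almost everywhere
  differentiable, curve whose velocity lies in the closed convex hull of the vectors
  \<open>(f, - (\<partial>f/\<partial>x)\<^sup>T \<nu>)\<close> taken over all minimizing controls. Finally, whatever selection \<open>w\<close> of minimizers
  is made, Filippov's regularization of its Hamiltonian field contains all these vectors, because
  they are generalized gradients of the lower envelope \<open>min\<^sub>u \<langle>\<nu>, f t x u\<rangle>\<close>, and these can be
  recovered from points off any null set.
\<close>

section \<open>Almost everywhere differentiability of Lipschitz curves\<close>

text \<open>The order of quantifiers shapes the proof: \<open>\<nu>0\<close> and \<open>T\<close>
  are fixed before the selection \<open>w\<close>, about which nothing is known, not even
  measurability. One curve must therefore serve all selections, and its velocity is described
  through the full sets of minimizers. The discrete problem uses convexified velocities because the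
  minimum condition comes from moving along the segment between two admissible velocities; without
  convexity an Euler scheme need not satisfy it. The terminal cost is half the squared norm, whose
  gradient at \<open>x\<close> is \<open>x\<close>. The radial bound with \<open>Q\<close>,
  integrated along rays, gives linear growth of \<open>f\<close> and hence bounds on Euler states
  that are independent of the number of steps. In the limit only the curves converge, not the
  velocities or controls; the velocity of the limit is recovered from difference quotients. The
  adjoint may vanish, and then every control is a minimizer; no separate treatment is required,
  since Filippov's regularization also perturbs \<nu>.\<close>

lemma emeasure_cball_UN_le:
  fixes M :: "real measure" and C :: "(real \<times> real) set"
  assumes C: "countable C" and disj: "disjoint_family_on (\<lambda>(a, r). cball a r) C"
    and M: "sets M = sets borel" and M': "sets M' = sets borel"
    and le: "\<And>a r. (a, r) \<in> C \<Longrightarrow> emeasure M (cball a r) \<le> c * emeasure M' (cball a r)"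
  shows "emeasure M (\<Union>(a, r)\<in>C. cball a r) \<le> c * emeasure M' (\<Union>(a, r)\<in>C. cball a r)"
proof -
  have "emeasure M (\<Union>(a, r)\<in>C. cball a r) = (\<integral>\<^sup>+i. emeasure M (case i of (a, r) \<Rightarrow> cball a r) \<partial>count_space C)"
    using C disj M by (intro emeasure_UN_countable) (simp_all add: case_prod_beta')
  also have "\<dots> \<le> (\<integral>\<^sup>+i. c * emeasure M' (case i of (a, r) \<Rightarrow> cball a r) \<partial>count_space C)"
    using le by (intro nn_integral_mono) auto
  also have "\<dots> = c * (\<integral>\<^sup>+i. emeasure M' (case i of (a, r) \<Rightarrow> cball a r) \<partial>count_space C)"
    by (rule nn_integral_cmult) auto
  also have "(\<integral>\<^sup>+i. emeasure M' (case i of (a, r) \<Rightarrow> cball a r) \<partial>count_space C)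
      = emeasure M' (\<Union>(a, r)\<in>C. cball a r)"
    using C disj M' by (intro emeasure_UN_countable[symmetric]) (simp_all add: case_prod_beta')
  finally show ?thesis .
qed

text \<open>Only the balls inside \<open>U\<close> enter the covering theorem; openness of
  \<open>U\<close> keeps this subfamily fine at every point of \<open>S\<close>. A point must lie in
  its ball but need not be the centre, so the intervals used later may straddle it unevenly.\<close>

lemma Vitali_cballs_within_open:
  fixes S U :: "real set"
  assumes "open U" "S \<subseteq> U"
    and fine: "\<And>t d. t \<in> S \<Longrightarrow> d > 0 \<Longrightarrow> \<exists>a r. 0 < r \<and> r < d \<and> t \<in> cball a r \<and> P a r"
  shows "\<exists>C. countable C \<and> disjoint_family_on (\<lambda>(a, r). cball a r) C \<and>
    (\<forall>a r. (a, r) \<in> C \<longrightarrow> 0 < r \<and> P a r \<and> cball a r \<subseteq> U) \<and>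
    negligible (S - (\<Union>(a, r)\<in>C. cball a r))"
proof -
  define K where "K = {(a, r). 0 < r \<and> P a r \<and> cball a r \<subseteq> U}"
  have 1: "0 < snd i" if "i \<in> K" for i
    using that by (auto simp: K_def)
  have 2: "\<exists>i. i \<in> K \<and> x \<in> cball (fst i) (snd i) \<and> snd i < d" if x: "x \<in> S" and d: "0 < d" for x d
  proof -
    obtain e where e: "e > 0" "ball x e \<subseteq> U"
      using assms x by (meson openE subsetD)
    \<comment> \<open>A ball of radius below \<open>e/2\<close> that contains \<open>x\<close> has
      all its points within \<open>e\<close> of \<open>x\<close>.\<close>
    obtain a r where ar: "0 < r" "r < min d (e/2)" "x \<in> cball a r" "P a r"
      using fine[OF x, of "min d (e/2)"] d e by auto
    have "cball a r \<subseteq> ball x e"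
    proof
      fix y assume y: "y \<in> cball a r"
      have "dist x y \<le> dist a x + dist a y"
        by (metis dist_commute dist_triangle)
      also have "\<dots> < e" using y ar by auto
      finally show "y \<in> ball x e" by simp
    qed
    then have "(a, r) \<in> K" using ar e by (auto simp: K_def)
    then show ?thesis using ar by (intro exI[of _ "(a, r)"]) auto
  qed
  have "\<exists>C. countable C \<and> C \<subseteq> K \<and>
     pairwise (\<lambda>i j. disjnt (cball (fst i) (snd i)) (cball (fst j) (snd j))) C \<and>
     negligible(S - (\<Union>i \<in> C. cball (fst i) (snd i)))"
    by (rule Vitali_covering_theorem_cballs[of K snd S fst, OF 1 2]) blast+
  then obtain C where C: "countable C" "C \<subseteq> K"
     "pairwise (\<lambda>i j. disjnt (cball (fst i) (snd i)) (cball (fst j) (snd j))) C"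
     "negligible(S - (\<Union>i \<in> C. cball (fst i) (snd i)))"
    by blast
  have "disjoint_family_on (\<lambda>(a, r). cball a r) C"
    using C(3) by (simp add: disjoint_family_on_def pairwise_def disjnt_def case_prod_beta)
  moreover have "\<forall>a r. (a, r) \<in> C \<longrightarrow> 0 < r \<and> P a r \<and> cball a r \<subseteq> U"
    using C(2) by (auto simp: K_def)
  moreover have "negligible (S - (\<Union>(a, r)\<in>C. cball a r))"
    using C(4) by (simp add: case_prod_beta)
  ultimately show ?thesis
    using C(1) by blast
qed

text \<open>The Lebesgue-Stieltjes measure of a continuous \<phi> has no atoms, so the endpoints of
  a closed interval contribute nothing beyond the increment.\<close>

lemma emeasure_interval_measure_cball:
  fixes \<phi> :: "real \<Rightarrow> real"
  assumes "mono \<phi>" "continuous_on UNIV \<phi>" "0 \<le> r"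
  shows "emeasure (interval_measure \<phi>) (cball a r) = ennreal (\<phi> (a + r) - \<phi> (a - r))"
  using assms emeasure_interval_measure_Icc[of "a - r" "a + r" \<phi>]
  by (auto simp: cball_eq_atLeastAtMost monoD)

text \<open>
  Lebesgue's argument: Vitali's theorem covers almost all of \<open>E\<close> by disjoint intervals of slope at
  most \<open>p\<close>, and then again, inside those, by disjoint intervals of slope at least \<open>q\<close>. Comparing the
  increments of \<open>\<phi>\<close> over the two families yields \<open>q |E| \<le> p |E|\<close>.
\<close>

lemma negligible_oscillating_slopes:
  fixes \<phi> :: "real \<Rightarrow> real"
  assumes \<phi>: "mono \<phi>" "continuous_on UNIV \<phi>"
    and E: "E \<in> lmeasurable" and pq: "0 \<le> p" "p < q"
    and low: "\<And>t d. t \<in> E \<Longrightarrow> d > 0 \<Longrightarrow>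
        \<exists>a r. 0 < r \<and> r < d \<and> t \<in> cball a r \<and> \<phi> (a + r) - \<phi> (a - r) \<le> p * (2 * r)"
    and high: "\<And>t d. t \<in> E \<Longrightarrow> d > 0 \<Longrightarrow>
        \<exists>a r. 0 < r \<and> r < d \<and> t \<in> cball a r \<and> \<phi> (a + r) - \<phi> (a - r) \<ge> q * (2 * r)"
  shows "negligible E"
proof -
  let ?M = "interval_measure \<phi>"
  have leb: "emeasure lborel (cball a r) = ennreal (2 * r)" if "0 \<le> r" for a r :: real
    using that by (simp add: cball_eq_atLeastAtMost)
  \<comment> \<open>\<epsilon> bounds the measure by which an open superset \<open>U\<close> exceeds
    \<open>E\<close>. The intervals of slope at most \<open>p\<close> are kept inside
    \<open>U\<close>, so their total length is at most that of \<open>E\<close> plus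
    \<epsilon>.\<close>
  have main: "q * measure lebesgue E \<le> p * (measure lebesgue E + \<epsilon>)" if \<epsilon>: "\<epsilon> > 0" for \<epsilon>
  proof -
    obtain U where U: "open U" "E \<subseteq> U" "U - E \<in> lmeasurable" "emeasure lebesgue (U - E) < ennreal \<epsilon>"
      using sets_lebesgue_outer_open[OF fmeasurableD[OF E] \<epsilon>] by metis
    have UE: "U = E \<union> (U - E)" using U(2) by auto
    have Um: "U \<in> lmeasurable"
      using UE fmeasurable.Un[OF E U(3)] by simp
    have "measure lebesgue (U - E) \<le> \<epsilon>"
      using U(3,4) \<epsilon> by (simp add: emeasure_eq_measure2 ennreal_less_iff)
    then have Ue: "measure lebesgue U \<le> measure lebesgue E + \<epsilon>"
      using UE measure_Un_le[of E lebesgue "U - E"] E U(3) by (simp add: fmeasurableD)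
    obtain C where C: "countable C" "disjoint_family_on (\<lambda>(a, r). cball a r) C"
       "\<And>a r. (a, r) \<in> C \<Longrightarrow> 0 < r \<and> \<phi> (a + r) - \<phi> (a - r) \<le> p * (2 * r) \<and> cball a r \<subseteq> U"
       "negligible (E - (\<Union>(a, r)\<in>C. cball a r))"
      using Vitali_cballs_within_open[OF U(1,2) low] by blast
    \<comment> \<open>The second covering takes place inside an open set, so the closed intervals
      are replaced by their interiors. Only countably many endpoints are lost, a null set.\<close>
    define V where "V = (\<Union>(a, r)\<in>C. ball a r)"
    have V: "open V" by (auto simp: V_def)
    define E' where "E' = E \<inter> V"
    have E': "E' \<subseteq> V" and high': "\<And>t d. t \<in> E' \<Longrightarrow> d > 0 \<Longrightarrow>
        \<exists>a r. 0 < r \<and> r < d \<and> t \<in> cball a r \<and> \<phi> (a + r) - \<phi> (a - r) \<ge> q * (2 * r)"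
      using high by (auto simp: E'_def)
    obtain D where D: "countable D" "disjoint_family_on (\<lambda>(a, r). cball a r) D"
       "\<And>a r. (a, r) \<in> D \<Longrightarrow> 0 < r \<and> \<phi> (a + r) - \<phi> (a - r) \<ge> q * (2 * r) \<and> cball a r \<subseteq> V"
       "negligible (E' - (\<Union>(a, r)\<in>D. cball a r))"
      using Vitali_cballs_within_open[OF V E' high'] by blast
    let ?C = "\<Union>(a, r)\<in>C. cball a r" and ?D = "\<Union>(a, r)\<in>D. cball a r"
    have Cm: "?C \<in> sets borel" and Dm: "?D \<in> sets borel"
      using C(1) D(1) by (auto intro!: sets.countable_UN'')
    have negl: "negligible (E - ?D)"
    proof -
      have "negligible (\<Union>(a, r)\<in>C. sphere a r)"
        using C(1) by (auto intro!: negligible_countable_Union negligible_sphere simp: case_prod_beta)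
      moreover have "?C \<subseteq> V \<union> (\<Union>(a, r)\<in>C. sphere a r)"
      proof clarify
        fix t a r assume "(a, r) \<in> C" "t \<in> cball a r" "t \<notin> (\<Union>(a, r)\<in>C. sphere a r)"
        then show "t \<in> V" unfolding V_def by (force simp: order_le_less)
      qed
      then have "E - ?D \<subseteq> (E - ?C) \<union> (E' - ?D) \<union> (\<Union>(a, r)\<in>C. sphere a r)"
        unfolding E'_def by blast
      ultimately show ?thesis
        using C(4) D(4) by (meson negligible_Un negligible_subset)
    qed
    have "ennreal q * emeasure lebesgue E \<le> ennreal q * emeasure lebesgue (?D \<union> (E - ?D))"
      using E Dm negl by (intro mult_left_mono emeasure_mono) (auto simp: negligible_imp_sets)
    also have "emeasure lebesgue (?D \<union> (E - ?D)) = emeasure lebesgue ?D"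
      using negl Dm by (intro emeasure_Un_null_set) (auto simp: negligible_iff_null_sets)
    also have "ennreal q * emeasure lebesgue ?D = ennreal q * emeasure lborel ?D"
      using Dm by simp
    also have "\<dots> \<le> 1 * emeasure ?M ?D"
    proof -
      have "emeasure lborel ?D \<le> ennreal (1/q) * emeasure ?M ?D"
      proof (rule emeasure_cball_UN_le[OF D(1,2)])
        fix a r assume "(a, r) \<in> D"
        with D(3) have r: "0 < r" "q * (2 * r) \<le> \<phi> (a + r) - \<phi> (a - r)" by auto
        have "ennreal (2 * r) \<le> ennreal ((1/q) * (\<phi> (a + r) - \<phi> (a - r)))"
          using r pq by (intro ennreal_leI) (simp add: field_simps)
        then show "emeasure lborel (cball a r) \<le> ennreal (1/q) * emeasure ?M (cball a r)"
          using r pq leb[of r a] emeasure_interval_measure_cball[OF \<phi>, of r a]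
          by (simp flip: ennreal_mult')
      qed auto
      then have "ennreal q * emeasure lborel ?D \<le> ennreal q * (ennreal (1/q) * emeasure ?M ?D)"
        by (intro mult_left_mono) auto
      also have "\<dots> = 1 * emeasure ?M ?D"
        using pq by (simp flip: ennreal_mult' mult.assoc)
      finally show ?thesis .
    qed
    also have "\<dots> \<le> 1 * emeasure ?M ?C"
    proof -
      have "?D \<subseteq> V" by (intro UN_least) (use D(3) in blast)
      moreover have "V \<subseteq> ?C" unfolding V_def by (intro UN_mono) auto
      ultimately show ?thesis
        using Cm by (intro mult_left_mono emeasure_mono) auto
    qed
    also have "1 * emeasure ?M ?C \<le> ennreal p * emeasure lborel ?C"
    proof -
      have "emeasure ?M ?C \<le> ennreal p * emeasure lborel ?C"
      proof (rule emeasure_cball_UN_le[OF C(1,2)])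
        fix a r assume "(a, r) \<in> C"
        with C(3) have r: "0 < r" "\<phi> (a + r) - \<phi> (a - r) \<le> p * (2 * r)" by auto
        then have "ennreal (\<phi> (a + r) - \<phi> (a - r)) \<le> ennreal (p * (2 * r))"
          by (intro ennreal_leI)
        then show "emeasure ?M (cball a r) \<le> ennreal p * emeasure lborel (cball a r)"
          using r pq leb[of r a] emeasure_interval_measure_cball[OF \<phi>, of r a]
          by (simp add: ennreal_mult')
      qed auto
      then show ?thesis by simp
    qed
    also have "ennreal p * emeasure lborel ?C \<le> ennreal p * emeasure lebesgue U"
    proof -
      have "?C \<subseteq> U" by (intro UN_least) (use C(3) in blast)
      then have "emeasure lebesgue ?C \<le> emeasure lebesgue U"
        using U by (intro emeasure_mono) auto
      then show ?thesis using Cm by (intro mult_left_mono) auto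
    qed
    finally have "ennreal (q * measure lebesgue E) \<le> ennreal (p * measure lebesgue U)"
      using E Um pq by (simp add: emeasure_eq_measure2 ennreal_mult')
    then have "q * measure lebesgue E \<le> p * measure lebesgue U"
      using pq by (simp add: ennreal_le_iff)
    also have "\<dots> \<le> p * (measure lebesgue E + \<epsilon>)"
      using Ue pq by (intro mult_left_mono) auto
    finally show ?thesis .
  qed
  \<comment> \<open>The slack enters as \<open>p * \<epsilon>\<close>, so \<epsilon> is taken as
    \<open>e / p\<close>; for \<open>p = 0\<close> any value will do.\<close>
  have "q * measure lebesgue E \<le> p * measure lebesgue E + e" if "e > 0" for e
  proof (cases "p = 0")
    case True
    then show ?thesis using main[of 1] that by simp
  next
    case False
    then show ?thesis using main[of "e / p"] that pq by (simp add: distrib_left)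
  qed
  then have "q * measure lebesgue E \<le> p * measure lebesgue E"
    by (rule field_le_epsilon)
  then have "measure lebesgue E \<le> 0"
    using pq by (smt (verit) measure_nonneg mult_right_mono mult_less_cancel_right_disj)
  then show ?thesis
    using E by (metis measure_le_0_iff negligible_iff_measure)
qed

text \<open>If the slopes over short intervals straddling \<open>t\<close> do not converge, two
  rationals \<open>p < q\<close> separate them at arbitrarily small scales, and
  \<open>negligible_oscillating_slopes\<close> disposes of each of the countably many pairs.
  Elsewhere the slopes converge to their lower limit, which is the derivative; the Lipschitz bound
  makes it finite.\<close>

lemma mono_lipschitz_differentiable_ae:
  fixes \<phi> :: "real \<Rightarrow> real"
  assumes mono: "mono \<phi>" and lip: "L-lipschitz_on UNIV \<phi>"
  shows "\<exists>N. negligible N \<and> (\<forall>t. t \<notin> N \<longrightarrow> \<phi> differentiable (at t))"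
proof -
  define \<Delta> where "\<Delta> a r = \<phi> (a + r) - \<phi> (a - r)" for a r
  have cont: "continuous_on UNIV \<phi>"
    using lip by (rule lipschitz_on_continuous_on)
  \<comment> \<open>Unions of open balls make \<open>E p q n\<close> a countable intersection of
    open sets, hence Borel, and the factor \<open>ball 0 (real n)\<close> makes it bounded.\<close>
  define lower where "lower p \<delta> = (\<Union>(a, r)\<in>{(a, r). 0 < r \<and> r < \<delta> \<and> \<Delta> a r \<le> p * (2 * r)}. ball a r)" for p \<delta> :: real
  define upper where "upper q \<delta> = (\<Union>(a, r)\<in>{(a, r). 0 < r \<and> r < \<delta> \<and> \<Delta> a r \<ge> q * (2 * r)}. ball a r)" for q \<delta> :: real
  define E where "E p q n = ball 0 (real n) \<inter> (\<Inter>k. lower p (1 / Suc k)) \<inter> (\<Inter>k. upper q (1 / Suc k))"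
    for p q :: real and n :: nat
  have E_negl: "negligible (E p q n)" if pq: "0 \<le> p" "p < q" for p q n
  proof (rule negligible_oscillating_slopes[OF mono cont _ pq])
    have op: "open (lower p d)" "open (upper q d)" for d
      unfolding lower_def upper_def by (rule open_UN; clarsimp)+
    then have "E p q n \<in> sets borel"
      unfolding E_def by (intro sets.Int sets.countable_INT'') auto
    moreover have "bounded (E p q n)"
      unfolding E_def by (meson bounded_ball bounded_Int)
    ultimately show "E p q n \<in> lmeasurable"
      by (simp add: bounded_set_imp_lmeasurable)
    fix t d :: real assume t: "t \<in> E p q n" and d: "0 < d"
    obtain k where k: "1 / Suc k < d"
      using d nat_approx_posE by metis
    have "t \<in> lower p (1 / Suc k)" "t \<in> upper q (1 / Suc k)"
      using t by (auto simp: E_def)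
    then show "\<exists>a r. 0 < r \<and> r < d \<and> t \<in> cball a r \<and> \<phi> (a + r) - \<phi> (a - r) \<le> p * (2 * r)"
        "\<exists>a r. 0 < r \<and> r < d \<and> t \<in> cball a r \<and> q * (2 * r) \<le> \<phi> (a + r) - \<phi> (a - r)"
      unfolding lower_def upper_def \<Delta>_def using k
      by (auto simp del: divide_le_eq_1 less_divide_eq, (meson less_le_trans less_imp_le order.strict_trans)+)
  qed
  define I where "I = {(p, q). p \<in> \<rat> \<and> q \<in> \<rat> \<and> 0 \<le> p \<and> p < (q::real)} \<times> (UNIV :: nat set)"
  define N where "N = (\<Union>i\<in>I. E (fst (fst i)) (snd (fst i)) (snd i))"
  have "countable I"
  proof -
    have "{(p, q). p \<in> \<rat> \<and> q \<in> \<rat> \<and> 0 \<le> p \<and> p < (q::real)} \<subseteq> \<rat> \<times> \<rat>" by auto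
    then have "countable {(p, q). p \<in> \<rat> \<and> q \<in> \<rat> \<and> 0 \<le> p \<and> p < (q::real)}"
      using countable_rat by (meson countable_SIGMA countable_subset)
    then show ?thesis unfolding I_def by (intro countable_SIGMA) auto
  qed
  then have "negligible N"
    unfolding N_def by (intro negligible_countable_Union countable_image) (auto simp: I_def E_negl)
  moreover have "\<phi> differentiable (at t)" if t: "t \<notin> N" for t
  proof -
    \<comment> \<open>\<open>P\<close> collects the numbers that bound from below all slopes over
      sufficiently short intervals around \<open>t\<close>; its supremum is the lower limit of the
      slopes.\<close>
    define P where "P = {p. \<exists>\<delta>>0. \<forall>a r. 0 < r \<and> r < \<delta> \<and> t \<in> ball a r \<longrightarrow> \<Delta> a r \<ge> p * (2 * r)}"
    have dich: "p \<in> P \<or> (\<exists>\<delta>>0. \<forall>a r. 0 < r \<and> r < \<delta> \<and> t \<in> ball a r \<longrightarrow> \<Delta> a r \<le> q * (2 * r))"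
      if pq: "p \<in> \<rat>" "q \<in> \<rat>" "0 \<le> p" "p < q" for p q
    proof -
      obtain n where n: "norm t < real n" using reals_Archimedean2 by blast
      have "t \<notin> E p q n"
        using t pq unfolding N_def I_def by force
      then have "(\<exists>k. t \<notin> lower p (1 / Suc k)) \<or> (\<exists>k. t \<notin> upper q (1 / Suc k))"
        using n by (auto simp: E_def)
      then show ?thesis
      proof
        assume "\<exists>k. t \<notin> lower p (1 / Suc k)"
        then obtain k where "t \<notin> lower p (1 / Suc k)" by blast
        then have "\<forall>a r. 0 < r \<and> r < 1 / Suc k \<and> t \<in> ball a r \<longrightarrow> \<Delta> a r \<ge> p * (2 * r)"
          unfolding lower_def by (force simp: not_le)
        then show ?thesis unfolding P_def using zero_less_divide_1_iff of_nat_0_less_iff by blast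
      next
        assume "\<exists>k. t \<notin> upper q (1 / Suc k)"
        then obtain k where "t \<notin> upper q (1 / Suc k)" by blast
        then have "\<forall>a r. 0 < r \<and> r < 1 / Suc k \<and> t \<in> ball a r \<longrightarrow> \<Delta> a r \<le> q * (2 * r)"
          unfolding upper_def by (force simp: not_le)
        then show ?thesis using zero_less_divide_1_iff of_nat_0_less_iff by blast
      qed
    qed
    have P0: "0 \<in> P"
      unfolding P_def \<Delta>_def using monoD[OF mono] by (auto intro!: exI[of _ 1])
    have PL: "p \<le> L" if "p \<in> P" for p
    proof -
      obtain \<delta> where \<delta>: "\<delta> > 0" "\<forall>a r. 0 < r \<and> r < \<delta> \<and> t \<in> ball a r \<longrightarrow> \<Delta> a r \<ge> p * (2 * r)"
        using \<open>p \<in> P\<close> unfolding P_def by blast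
      have "p * (2 * (\<delta>/2)) \<le> \<Delta> t (\<delta>/2)"
        using \<delta> by (metis centre_in_ball field_sum_of_halves half_gt_zero less_add_same_cancel1)
      also have "\<dots> \<le> L * (2 * (\<delta>/2))"
        using lipschitz_onD[OF lip, of "t + \<delta>/2" "t - \<delta>/2"] \<delta>(1) by (auto simp: \<Delta>_def dist_real_def)
      finally show ?thesis using \<delta>(1) by simp
    qed
    define v where "v = Sup P"
    have bdd: "bdd_above P" using PL by (meson bdd_aboveI)
    have v0: "0 \<le> v" unfolding v_def using P0 bdd by (rule cSup_upper)
    have straddle: "\<exists>\<delta>>0. \<forall>a r. 0 < r \<and> r < \<delta> \<and> t \<in> ball a r \<longrightarrow> \<bar>\<Delta> a r - v * (2 * r)\<bar> \<le> \<epsilon> * (2 * r)"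
      if \<epsilon>: "\<epsilon> > 0" for \<epsilon>
    proof -
      obtain p where p: "p \<in> P" "v - \<epsilon> < p"
        using less_cSup_iff[of P "v - \<epsilon>"] P0 bdd \<epsilon> unfolding v_def by auto
      obtain \<delta>1 where \<delta>1: "\<delta>1 > 0" "\<And>a r. 0 < r \<Longrightarrow> r < \<delta>1 \<Longrightarrow> t \<in> ball a r \<Longrightarrow> \<Delta> a r \<ge> p * (2 * r)"
        using p unfolding P_def by blast
      \<comment> \<open>Two rationals are placed between \<open>v\<close> and
        \<open>v + \<epsilon>\<close> because \<open>dich\<close> compares rational pairs. As
        \<open>p'\<close> exceeds the supremum of \<open>P\<close>, the alternative with
        \<open>q\<close> must hold.\<close>
      obtain p' where p': "p' \<in> \<rat>" "v < p'" "p' < v + \<epsilon>"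
        using Rats_dense_in_real[of v "v + \<epsilon>"] \<epsilon> by auto
      obtain q where q: "q \<in> \<rat>" "p' < q" "q < v + \<epsilon>"
        using Rats_dense_in_real[of p' "v + \<epsilon>"] p' by auto
      have "p' \<notin> P" using p' cSup_upper[OF _ bdd, of p'] unfolding v_def by auto
      then obtain \<delta>2 where \<delta>2: "\<delta>2 > 0" "\<And>a r. 0 < r \<Longrightarrow> r < \<delta>2 \<Longrightarrow> t \<in> ball a r \<Longrightarrow> \<Delta> a r \<le> q * (2 * r)"
        using dich[of p' q] p' q v0 by auto
      show ?thesis
      proof (intro exI[of _ "min \<delta>1 \<delta>2"] conjI allI impI)
        fix a r assume ar: "0 < r \<and> r < min \<delta>1 \<delta>2 \<and> t \<in> ball a r"
        have "(v - \<epsilon>) * (2 * r) \<le> p * (2 * r)" "q * (2 * r) \<le> (v + \<epsilon>) * (2 * r)"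
          using ar p q by (auto intro!: mult_right_mono)
        then show "\<bar>\<Delta> a r - v * (2 * r)\<bar> \<le> \<epsilon> * (2 * r)"
          using \<delta>1(2)[of r a] \<delta>2(2)[of r a] ar by (simp add: abs_le_iff algebra_simps)
      qed (use \<delta>1 \<delta>2 in auto)
    qed
    have "(\<phi> has_derivative (\<lambda>x. v * x)) (at t within UNIV)"
      unfolding has_derivative_within_alt
    proof (intro conjI allI impI)
      show "bounded_linear ((*) v)" by (rule bounded_linear_mult_right)
      fix \<epsilon> :: real assume "\<epsilon> > 0"
      then obtain \<delta> where \<delta>: "\<delta> > 0"
        "\<And>a r. 0 < r \<Longrightarrow> r < \<delta> \<Longrightarrow> t \<in> ball a r \<Longrightarrow> \<bar>\<Delta> a r - v * (2 * r)\<bar> \<le> \<epsilon> * (2 * r)"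
        using straddle by metis
      show "\<exists>d>0. \<forall>y\<in>UNIV. norm (y - t) < d \<longrightarrow> norm (\<phi> y - \<phi> t - v * (y - t)) \<le> \<epsilon> * norm (y - t)"
      proof (intro exI[of _ \<delta>] conjI ballI impI)
        fix s assume s: "norm (s - t) < \<delta>"
        \<comment> \<open>The interval with endpoints \<open>s\<close> and \<open>t\<close> has
          \<open>t\<close> on its boundary, where \<open>straddle\<close> does not apply. It is
          widened by \<eta> on both sides, and continuity of \<phi> lets \<eta> tend to 0.\<close>
        define a where "a = (s + t) / 2"
        define r where "r = \<bar>s - t\<bar> / 2"
        have r: "0 \<le> r" "r < \<delta>" using s by (auto simp: r_def)
        define h where "h \<eta> = \<epsilon> * (2 * (r + \<eta>)) - \<bar>\<phi> (a + (r + \<eta>)) - \<phi> (a - (r + \<eta>)) - v * (2 * (r + \<eta>))\<bar>" for \<eta>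
        have ch: "continuous_on UNIV h"
          unfolding h_def by (intro continuous_intros continuous_on_compose2[OF cont]) auto
        have ev: "\<forall>\<^sub>F \<eta> in at_right 0. 0 \<le> h \<eta>"
        proof -
          have "0 \<le> h \<eta>" if "0 < \<eta>" "\<eta> < \<delta> - r" for \<eta>
          proof -
            have "t \<in> ball a (r + \<eta>)"
              using that by (auto simp: dist_real_def a_def r_def abs_if field_simps)
            then show ?thesis
              using \<delta>(2)[of "r + \<eta>" a] that r by (auto simp: h_def \<Delta>_def)
          qed
          then show ?thesis using r unfolding eventually_at_right_field
            by (intro exI[of _ "\<delta> - r"]) auto
        qed
        have "(h \<longlongrightarrow> h 0) (at_right 0)"
          using ch by (meson UNIV_I continuous_on tendsto_within_subset subset_UNIV)
        then have "0 \<le> h 0"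
          using ev by (intro tendsto_lowerbound) auto
        moreover have "\<bar>\<phi> (a + r) - \<phi> (a - r) - v * (2 * r)\<bar> = norm (\<phi> s - \<phi> t - v * (s - t))"
        proof (cases "s \<le> t")
          case True
          then have "a + r = t" "a - r = s" "2 * r = t - s" by (auto simp: a_def r_def field_simps)
          then show ?thesis by (simp only: real_norm_def) (simp add: abs_if algebra_simps)
        next
          case False
          then have "a + r = s" "a - r = t" "2 * r = s - t" by (auto simp: a_def r_def field_simps)
          then show ?thesis by (simp only: real_norm_def)
        qed
        ultimately show "norm (\<phi> s - \<phi> t - v * (s - t)) \<le> \<epsilon> * norm (s - t)"
          by (simp add: h_def r_def)
      qed (use \<delta> in auto)
    qed
    then show ?thesis unfolding differentiable_def by auto
  qed
  ultimately show ?thesis by blast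
qed

lemma lipschitz_differentiable_ae:
  fixes z :: "real \<Rightarrow> 'e::euclidean_space"
  assumes lip: "L-lipschitz_on UNIV z"
  shows "\<exists>N. negligible N \<and> (\<forall>t. t \<notin> N \<longrightarrow> z differentiable (at t))"
proof -
  have L: "L \<ge> 0" using lip by (rule lipschitz_on_nonneg)
  have "\<exists>N. negligible N \<and> (\<forall>t. t \<notin> N \<longrightarrow> (\<lambda>s. z s \<bullet> b) differentiable (at t))" if b: "b \<in> Basis" for b
  proof -
    \<comment> \<open>Adding the slope \<open>L\<close> makes the component monotone without
      affecting differentiability; the Lipschitz constant becomes \<open>2 * L\<close>.\<close>
    define \<phi> where "\<phi> s = z s \<bullet> b + L * s" for s
    have le: "\<bar>z s \<bullet> b - z t \<bullet> b\<bar> \<le> L * \<bar>s - t\<bar>" for s t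
    proof -
      have "\<bar>z s \<bullet> b - z t \<bullet> b\<bar> \<le> norm (z s - z t)"
        using Basis_le_norm[OF b, of "z s - z t"] by (simp add: inner_diff_left)
      also have "\<dots> \<le> L * \<bar>s - t\<bar>"
        using lipschitz_onD[OF lip, of s t] by (simp add: dist_norm)
      finally show ?thesis .
    qed
    have "mono \<phi>"
    proof (rule monoI)
      fix s t :: real assume "s \<le> t"
      then show "\<phi> s \<le> \<phi> t" using le[of s t] by (simp add: \<phi>_def algebra_simps)
    qed
    moreover have "(2 * L)-lipschitz_on UNIV \<phi>"
    proof (rule lipschitz_onI)
      fix s t :: real
      have "\<bar>\<phi> s - \<phi> t\<bar> \<le> \<bar>z s \<bullet> b - z t \<bullet> b\<bar> + \<bar>L * (s - t)\<bar>"
        by (simp add: \<phi>_def algebra_simps)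
      also have "\<dots> \<le> 2 * L * \<bar>s - t\<bar>"
        using le[of s t] L by (simp add: abs_mult)
      finally show "dist (\<phi> s) (\<phi> t) \<le> 2 * L * dist s t" by (simp add: dist_real_def)
    qed (use L in auto)
    ultimately obtain N where N: "negligible N" "\<And>t. t \<notin> N \<Longrightarrow> \<phi> differentiable (at t)"
      using mono_lipschitz_differentiable_ae by blast
    have "(\<lambda>s. \<phi> s - L * s) differentiable (at t)" if "t \<notin> N" for t
      using N(2)[OF that] by (intro differentiable_diff) auto
    then show ?thesis using N(1) by (auto simp: \<phi>_def)
  qed
  then obtain N where N: "\<And>b. b \<in> Basis \<Longrightarrow> negligible (N b)"
      "\<And>b t. b \<in> Basis \<Longrightarrow> t \<notin> N b \<Longrightarrow> (\<lambda>s. z s \<bullet> b) differentiable (at t)"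
    by metis
  have "negligible (\<Union>b\<in>Basis. N b)"
    using N(1) by (intro negligible_Union) auto
  moreover have "z differentiable (at t)" if "t \<notin> (\<Union>b\<in>Basis. N b)" for t
    using N(2) that by (subst differentiable_componentwise_within) auto
  ultimately show ?thesis by blast
qed

section \<open>Absolutely continuous curves and convex hulls\<close>

text \<open>A Henstock argument with a tagged division fine for a suitable gauge. Tags off
  \<open>N\<close> give increments controlled by the derivative; intervals tagged in
  \<open>N\<close> lie in an open set of tiny measure, where absolute continuity makes the sum of
  the increments small.\<close>

lemma abs_continuous_derivative_le:
  fixes \<phi> :: "real \<Rightarrow> real"
  assumes ac: "abs_continuous_on {a..b} \<phi>" and ab: "a \<le> b" and N: "negligible N"
    and der: "\<And>t. t \<in> {a..b} - N \<Longrightarrow> \<exists>D\<le>c. (\<phi> has_real_derivative D) (at t within {a..b})"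
  shows "\<phi> b - \<phi> a \<le> c * (b - a)"
proof (rule field_le_epsilon)
  fix e :: real assume e: "e > 0"
  \<comment> \<open>The errors are \<open>\<epsilon> * (b - a)\<close> from the derivative,
    \<epsilon> from the increments over the intervals tagged in \<open>N\<close>, and \<epsilon>
    from the length that these take away from the others.\<close>
  define \<epsilon> where "\<epsilon> = e / (b - a + 2)"
  have \<epsilon>: "\<epsilon> > 0" using e ab by (simp add: \<epsilon>_def)
  obtain \<delta> where \<delta>: "\<delta> > 0" "\<And>D. D division_of \<Union>D \<Longrightarrow> \<Union>D \<subseteq> {a..b} \<Longrightarrow> (\<Sum>k\<in>D. Sup k - Inf k) < \<delta> \<Longrightarrow>
        (\<Sum>k\<in>D. norm (\<phi> (Sup k) - \<phi> (Inf k))) < \<epsilon>"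
    using ac \<epsilon> unfolding abs_continuous_on_def by meson
  \<comment> \<open>The second bound controls the length missing from the good intervals, which
    enters multiplied by \<open>c + \<epsilon>\<close>, a factor of unknown sign.\<close>
  define \<delta>' where "\<delta>' = min \<delta> (\<epsilon> / (\<bar>c\<bar> + \<epsilon> + 1))"
  have \<delta>': "\<delta>' > 0" using \<delta> \<epsilon> by (simp add: \<delta>'_def)
  obtain U where U: "open U" "N \<subseteq> U" "U - N \<in> lmeasurable" "emeasure lebesgue (U - N) < ennreal \<delta>'"
    using sets_lebesgue_outer_open[OF negligible_imp_sets[OF N] \<delta>'] by metis
  have UN: "U = N \<union> (U - N)" using U(2) by auto
  have Um: "U \<in> lmeasurable"
    using UN N U(3) by (metis fmeasurable.Un negligible_imp_measurable)
  have "measure lebesgue U \<le> measure lebesgue N + measure lebesgue (U - N)"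
    using UN measure_Un_le[of N lebesgue "U - N"] N U(3) by (simp add: fmeasurableD negligible_imp_sets)
  also have "\<dots> < \<delta>'"
    using U(3,4) \<delta>' N by (simp add: emeasure_eq_measure2 ennreal_less_iff negligible_imp_measure0)
  finally have U_small: "measure lebesgue U < \<delta>'" .
  have "\<exists>d>0. \<forall>r\<in>{a..b}. \<forall>s\<in>{a..b}. r \<le> t \<and> t \<le> s \<and> \<bar>r - t\<bar> < d \<and> \<bar>s - t\<bar> < d \<longrightarrow> \<phi> s - \<phi> r \<le> (c + \<epsilon>) * (s - r)"
    if t: "t \<in> {a..b} - N" for t
  proof -
    obtain D where D: "D \<le> c" "(\<phi> has_derivative (*) D) (at t within {a..b})"
      using der[OF t] by (auto simp: has_field_derivative_def)
    then obtain d where d: "d > 0" "\<And>s. s \<in> {a..b} \<Longrightarrow> \<bar>s - t\<bar> < d \<Longrightarrow> \<bar>\<phi> s - \<phi> t - D * (s - t)\<bar> \<le> \<epsilon> * \<bar>s - t\<bar>"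
      using \<epsilon> unfolding has_derivative_within_alt by (auto simp: real_norm_def)
    show ?thesis
    proof (intro exI[of _ d] conjI ballI impI)
      fix r s assume rs: "r \<in> {a..b}" "s \<in> {a..b}" "r \<le> t \<and> t \<le> s \<and> \<bar>r - t\<bar> < d \<and> \<bar>s - t\<bar> < d"
      have "\<bar>\<phi> r - \<phi> t - D * (r - t)\<bar> \<le> \<epsilon> * (t - r)" "\<bar>\<phi> s - \<phi> t - D * (s - t)\<bar> \<le> \<epsilon> * (s - t)"
        using d(2)[of r] d(2)[of s] rs by auto
      then have "\<phi> s - \<phi> r \<le> (D + \<epsilon>) * (s - r)"
        unfolding abs_le_iff by (simp add: algebra_simps)
      also have "\<dots> \<le> (c + \<epsilon>) * (s - r)"
        using D rs by (intro mult_right_mono) auto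
      finally show "\<phi> s - \<phi> r \<le> (c + \<epsilon>) * (s - r)" .
    qed (use d in auto)
  qed
  then obtain d where d: "\<And>t. t \<in> {a..b} - N \<Longrightarrow> d t > 0"
    "\<And>t r s. t \<in> {a..b} - N \<Longrightarrow> r \<in> {a..b} \<Longrightarrow> s \<in> {a..b} \<Longrightarrow> r \<le> t \<Longrightarrow> t \<le> s \<Longrightarrow> \<bar>r - t\<bar> < d t \<Longrightarrow> \<bar>s - t\<bar> < d t \<Longrightarrow>
      \<phi> s - \<phi> r \<le> (c + \<epsilon>) * (s - r)"
    by metis
  define \<gamma> where "\<gamma> t = (if t \<in> N then U else if t \<in> {a..b} then ball t (d t) else ball t 1)" for t
  have "gauge \<gamma>"
    unfolding gauge_def \<gamma>_def using U d(1) by auto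
  then obtain p where p: "p tagged_division_of {a..b}" "\<gamma> fine p"
    by (rule fine_division_exists_real)
  have fin: "finite p" using p(1) by (rule tagged_division_of_finite)
  have mem: "k = {Inf k..Sup k}" "Inf k \<le> Sup k" "x \<in> k" "k \<subseteq> {a..b}" "Sup k - Inf k = measure lborel k"
    if xk: "(x, k) \<in> p" for x k
  proof -
    obtain u v where "k = cbox u v" "x \<in> k" "k \<subseteq> {a..b}"
      using tagged_division_ofD(2-4)[OF p(1) xk] by metis
    then show "k = {Inf k..Sup k}" "Inf k \<le> Sup k" "x \<in> k" "k \<subseteq> {a..b}" "Sup k - Inf k = measure lborel k"
      by (auto simp: cbox_interval)
  qed
  define p1 where "p1 = {(x, k) \<in> p. x \<in> N}"
  define p2 where "p2 = p - p1"
  have split: "sum g p = sum g p1 + sum g p2" for g :: "real \<times> real set \<Rightarrow> real"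
    unfolding p2_def using sum.subset_diff[of p1 p g] fin by (simp add: p1_def Collect_case_prod_mono subset_iff add.commute)
  let ?len = "\<lambda>(x, k). Sup k - Inf (k :: real set)"
  let ?inc = "\<lambda>(x, k). \<phi> (Sup k) - \<phi> (Inf (k :: real set))"
  have total_len: "sum ?len p = b - a"
    using additive_tagged_division_1[OF ab p(1), of id] by simp
  have total_inc: "sum ?inc p = \<phi> b - \<phi> a"
    using additive_tagged_division_1[OF ab p(1), of \<phi>] by simp
  have p1_partial: "p1 tagged_partial_division_of {a..b}"
    using p(1) by (rule tagged_partial_division_subset[OF tagged_division_of_def[THEN iffD1, THEN conjunct1]])
      (auto simp: p1_def)
  define D where "D = snd ` p1"
  have D: "D division_of \<Union>D"
    unfolding D_def by (rule partial_division_of_tagged_division[OF p1_partial])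
  have D_mem: "\<exists>x. (x, k) \<in> p \<and> x \<in> N" if "k \<in> D" for k
    using that by (auto simp: D_def p1_def)
  \<comment> \<open>Two tags can share an interval only if its interior is empty, so passing from
    tagged intervals to intervals preserves sums whose terms vanish there.\<close>
  have over: "sum (\<lambda>(x, k). g k) p1 = sum g D" if "\<And>u. g (cbox u u) = 0" for g :: "real set \<Rightarrow> real"
  proof -
    \<comment> \<open>Intervals with empty interior include the empty one, whose \<open>Inf\<close>
      and \<open>Sup\<close> have no specified value; the summand is set to 0 there. No tagged
      interval is empty.\<close>
    let ?g = "\<lambda>k. if k = {} then 0 else g k"
    have "sum (\<lambda>(x, k). ?g k) p1 = sum ?g D"
      unfolding D_def
    proof (rule sum.over_tagged_division_lemma[OF tagged_partial_division_of_Union_self[OF p1_partial]])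
      fix u v :: real assume "box u v = {}"
      then have "cbox u v = {} \<or> u = v" by auto
      then show "?g (cbox u v) = 0" using that by auto
    qed
    moreover have "sum (\<lambda>(x, k). ?g k) p1 = sum (\<lambda>(x, k). g k) p1"
      by (rule sum.cong) (auto simp: p1_def dest!: mem(3))
    moreover have "sum ?g D = sum g D"
      by (rule sum.cong) (auto dest!: D_mem mem(3))
    ultimately show ?thesis by simp
  qed
  have len1: "sum ?len p1 = measure lebesgue (\<Union>D)"
  proof -
    have "sum ?len p1 = sum (\<lambda>(x, k). measure lborel k) p1"
      by (rule sum.cong) (use mem(5) in \<open>auto simp: p1_def\<close>)
    also have "\<dots> = sum (measure lborel) D" by (rule over) auto
    also have "\<dots> = measure lebesgue (\<Union>D)"
      unfolding content_division[OF D, symmetric]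
    proof (rule sum.cong)
      fix k assume "k \<in> D"
      then obtain x where x: "(x, k) \<in> p" using D_mem by blast
      have "k \<in> sets lborel" by (subst mem(1)[OF x]) simp
      then show "measure lborel k = measure lebesgue k" by simp
    qed simp
    finally show ?thesis .
  qed
  have len1_nonneg: "0 \<le> sum ?len p1" using len1 by simp
  have "\<Union>D \<subseteq> U"
  proof (rule Union_least)
    fix k assume "k \<in> D"
    then obtain x where "(x, k) \<in> p" "x \<in> N" using D_mem by blast
    then show "k \<subseteq> U" using fineD[OF p(2), of x k] by (simp add: \<gamma>_def)
  qed
  then have "measure lebesgue (\<Union>D) \<le> measure lebesgue U"
    using D Um by (intro measure_mono_fmeasurable) (auto simp: lmeasurable_division fmeasurableD)
  then have len1_small: "sum ?len p1 < \<delta>'" using len1 U_small by simp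
  have inc1: "sum ?inc p1 \<le> \<epsilon>"
  proof -
    have "(\<Sum>k\<in>D. Sup k - Inf k) = sum (measure lborel) D"
      using D_mem mem(5) by (intro sum.cong) auto
    also have "\<dots> = sum (\<lambda>(x, k). measure lborel k) p1" by (rule over[symmetric]) auto
    also have "\<dots> = sum ?len p1"
      by (rule sum.cong) (use mem(5) in \<open>auto simp: p1_def\<close>)
    finally have "(\<Sum>k\<in>D. Sup k - Inf k) < \<delta>" using len1_small by (simp add: \<delta>'_def)
    moreover have "\<Union>D \<subseteq> {a..b}" using D_mem mem(4) by blast
    ultimately have "(\<Sum>k\<in>D. norm (\<phi> (Sup k) - \<phi> (Inf k))) < \<epsilon>"
      using \<delta>(2) D by blast
    moreover have "sum (\<lambda>(x, k). norm (\<phi> (Sup k) - \<phi> (Inf k))) p1 = (\<Sum>k\<in>D. norm (\<phi> (Sup k) - \<phi> (Inf k)))"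
      by (rule over) auto
    moreover have "sum ?inc p1 \<le> sum (\<lambda>(x, k). norm (\<phi> (Sup k) - \<phi> (Inf k))) p1"
      by (intro sum_mono) auto
    ultimately show ?thesis by linarith
  qed
  have inc2: "sum ?inc p2 \<le> (c + \<epsilon>) * sum ?len p2"
    unfolding sum_distrib_left
  proof (rule sum_mono)
    fix i assume "i \<in> p2"
    then obtain x k where i: "i = (x, k)" "(x, k) \<in> p" "x \<notin> N"
      by (cases i) (auto simp: p2_def p1_def)
    note m = mem[OF i(2)]
    have x: "x \<in> {a..b}" "Inf k \<le> x" "x \<le> Sup k" using m by auto
    have "k \<subseteq> ball x (d x)"
      using fineD[OF p(2) i(2)] i(3) x by (simp add: \<gamma>_def)
    moreover have "Inf k \<in> k" "Sup k \<in> k"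
      using m(1,2) by (metis atLeastAtMost_iff order_refl)+
    moreover note \<open>k \<subseteq> {a..b}\<close>
    ultimately have "Inf k \<in> ball x (d x)" "Sup k \<in> ball x (d x)" "Inf k \<in> {a..b}" "Sup k \<in> {a..b}"
      by blast+
    then show "?inc i \<le> (c + \<epsilon>) * ?len i"
      using d(2)[of x "Inf k" "Sup k"] x i by (auto simp: dist_real_def)
  qed
  have "(c + \<epsilon>) * sum ?len p2 \<le> (c + \<epsilon>) * (b - a) + \<epsilon>"
  proof -
    have "- (c + \<epsilon>) * sum ?len p1 \<le> (\<bar>c\<bar> + \<epsilon> + 1) * sum ?len p1"
      using len1_nonneg \<epsilon> by (intro mult_right_mono) auto
    also have "\<dots> \<le> (\<bar>c\<bar> + \<epsilon> + 1) * (\<epsilon> / (\<bar>c\<bar> + \<epsilon> + 1))"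
      using len1_small \<epsilon> by (intro mult_left_mono) (auto simp: \<delta>'_def)
    also have "\<dots> = \<epsilon>" using \<epsilon> by simp
    finally have "- (c + \<epsilon>) * sum ?len p1 \<le> \<epsilon>" .
    moreover have "sum ?len p2 = (b - a) - sum ?len p1" using split[of ?len] total_len by simp
    then have "(c + \<epsilon>) * sum ?len p2 = (c + \<epsilon>) * (b - a) + - (c + \<epsilon>) * sum ?len p1"
      by (simp only: right_diff_distrib mult_minus_left)
    ultimately show ?thesis by linarith
  qed
  then have "\<phi> b - \<phi> a \<le> \<epsilon> + ((c + \<epsilon>) * (b - a) + \<epsilon>)"
    using split[of ?inc] total_inc inc1 inc2 by linarith
  also have "\<dots> = c * (b - a) + \<epsilon> * (b - a + 2)" by (simp add: algebra_simps)
  also have "\<dots> = c * (b - a) + e" using ab by (simp add: \<epsilon>_def)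
  finally show "\<phi> b - \<phi> a \<le> c * (b - a) + e" .
qed

lemma abs_continuous_on_inner:
  fixes y :: "real \<Rightarrow> 'e::real_inner"
  assumes "abs_continuous_on I y"
  shows "abs_continuous_on I (\<lambda>t. d \<bullet> y t)"
  unfolding abs_continuous_on_def
proof (intro allI impI)
  fix \<epsilon> :: real assume \<epsilon>: "\<epsilon> > 0"
  have "\<epsilon> / (norm d + 1) > 0" using \<epsilon> by (simp add: add_nonneg_pos)
  then obtain \<delta> where \<delta>: "\<delta> > 0" "\<And>D. D division_of \<Union>D \<and> \<Union>D \<subseteq> I \<and> (\<Sum>k\<in>D. Sup k - Inf k) < \<delta> \<Longrightarrow>
        (\<Sum>k\<in>D. norm (y (Sup k) - y (Inf k))) < \<epsilon> / (norm d + 1)"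
    using assms unfolding abs_continuous_on_def by meson
  show "\<exists>\<delta>>0. \<forall>D. D division_of \<Union>D \<and> \<Union>D \<subseteq> I \<and> (\<Sum>k\<in>D. Sup k - Inf k) < \<delta> \<longrightarrow>
        (\<Sum>k\<in>D. norm (d \<bullet> y (Sup k) - d \<bullet> y (Inf k))) < \<epsilon>"
  proof (intro exI[of _ \<delta>] conjI allI impI)
    fix D assume D: "D division_of \<Union>D \<and> \<Union>D \<subseteq> I \<and> (\<Sum>k\<in>D. Sup k - Inf k) < \<delta>"
    have "(\<Sum>k\<in>D. norm (d \<bullet> y (Sup k) - d \<bullet> y (Inf k))) \<le> (\<Sum>k\<in>D. (norm d + 1) * norm (y (Sup k) - y (Inf k)))"
    proof (rule sum_mono)
      fix k
      have "norm (d \<bullet> y (Sup k) - d \<bullet> y (Inf k)) \<le> norm d * norm (y (Sup k) - y (Inf k))"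
        by (metis Cauchy_Schwarz_ineq2 inner_diff_right real_norm_def)
      also have "\<dots> \<le> (norm d + 1) * norm (y (Sup k) - y (Inf k))"
        by (intro mult_right_mono) auto
      finally show "norm (d \<bullet> y (Sup k) - d \<bullet> y (Inf k)) \<le> (norm d + 1) * norm (y (Sup k) - y (Inf k))" .
    qed
    also have "\<dots> = (norm d + 1) * (\<Sum>k\<in>D. norm (y (Sup k) - y (Inf k)))"
      by (simp add: sum_distrib_left)
    also have "\<dots> < (norm d + 1) * (\<epsilon> / (norm d + 1))"
      using \<delta>(2)[OF D] by (intro mult_strict_left_mono) (auto simp: add_nonneg_pos)
    also have "\<dots> = \<epsilon>" by (simp add: add_nonneg_eq_0_iff)
    finally show "(\<Sum>k\<in>D. norm (d \<bullet> y (Sup k) - d \<bullet> y (Inf k))) < \<epsilon>" .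
  qed (use \<delta> in auto)
qed

text \<open>If the mean velocity lay outside \<open>C\<close>, a hyperplane would separate it
  strictly from all velocities, and the scalar function \<open>(- d) \<bullet> y t\<close> would
  grow more than \<open>abs_continuous_derivative_le\<close> permits.\<close>

lemma abs_continuous_mean_value_in:
  fixes y :: "real \<Rightarrow> 'e::euclidean_space"
  assumes ac: "abs_continuous_on {a..b} y" and ab: "a < b" and C: "closed C" "convex C"
    and N: "negligible N"
    and der: "\<And>t. t \<in> {a..b} - N \<Longrightarrow> \<exists>v\<in>C. (y has_vector_derivative v) (at t within {a..b})"
  shows "(1 / (b - a)) *\<^sub>R (y b - y a) \<in> C"
proof (rule ccontr)
  assume "(1 / (b - a)) *\<^sub>R (y b - y a) \<notin> C"
  then obtain d \<beta> where d: "d \<bullet> ((1 / (b - a)) *\<^sub>R (y b - y a)) < \<beta>" "\<And>v. v \<in> C \<Longrightarrow> d \<bullet> v > \<beta>"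
    using separating_hyperplane_closed_point[OF C(2,1)] by metis
  have "(- d) \<bullet> y b - (- d) \<bullet> y a \<le> (- \<beta>) * (b - a)"
  proof (rule abs_continuous_derivative_le[OF _ _ N])
    show "abs_continuous_on {a..b} (\<lambda>t. (- d) \<bullet> y t)"
      using ac by (rule abs_continuous_on_inner)
    fix t assume "t \<in> {a..b} - N"
    then obtain v where v: "v \<in> C" "(y has_vector_derivative v) (at t within {a..b})"
      using der by blast
    have "((\<lambda>t. (- d) \<bullet> y t) has_derivative (\<lambda>x. (- d) \<bullet> (x *\<^sub>R v))) (at t within {a..b})"
      using v(2) unfolding has_vector_derivative_def by (rule has_derivative_inner_right)
    then have "((\<lambda>t. (- d) \<bullet> y t) has_real_derivative (- d) \<bullet> v) (at t within {a..b})"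
      unfolding has_field_derivative_def by (rule has_derivative_eq_rhs) auto
    then show "\<exists>D\<le>- \<beta>. ((\<lambda>t. (- d) \<bullet> y t) has_real_derivative D) (at t within {a..b})"
      using d(2)[OF v(1)] by (intro exI[of _ "(- d) \<bullet> v"]) auto
  qed (use ab in auto)
  then have "\<beta> * (b - a) \<le> d \<bullet> (y b - y a)"
    by (simp add: inner_diff_right algebra_simps)
  then have "\<beta> \<le> d \<bullet> ((1 / (b - a)) *\<^sub>R (y b - y a))"
    unfolding inner_scaleR_right using ab by (simp only: pos_le_divide_eq times_divide_eq_left mult_1 diff_gt_0_iff_gt)
  then show False using d(1) by simp
qed

lemma abs_continuous_on_imp_continuous_on:
  assumes "abs_continuous_on {a..b} y"
  shows "continuous_on {a..b} y"
  unfolding continuous_on_iff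
proof (intro ballI allI impI)
  fix t \<epsilon> :: real assume t: "t \<in> {a..b}" and \<epsilon>: "\<epsilon> > 0"
  obtain \<delta> where \<delta>: "\<delta> > 0" "\<And>D. D division_of \<Union>D \<and> \<Union>D \<subseteq> {a..b} \<and> (\<Sum>k\<in>D. Sup k - Inf k) < \<delta> \<Longrightarrow>
        (\<Sum>k\<in>D. norm (y (Sup k) - y (Inf k))) < \<epsilon>"
    using assms \<epsilon> unfolding abs_continuous_on_def by meson
  have le: "dist (y s) (y r) < \<epsilon>" if "r \<in> {a..b}" "s \<in> {a..b}" "r \<le> s" "s - r < \<delta>" for r s
    using \<delta>(2)[of "{{r..s}}"] that division_of_self[of r s] by (auto simp: dist_norm)
  show "\<exists>d>0. \<forall>s\<in>{a..b}. dist s t < d \<longrightarrow> dist (y s) (y t) < \<epsilon>"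
  proof (intro exI[of _ \<delta>] conjI ballI impI)
    fix s assume s: "s \<in> {a..b}" "dist s t < \<delta>"
    show "dist (y s) (y t) < \<epsilon>"
      using le[OF t s(1)] le[OF s(1) t] s(2) by (cases "s \<le> t") (auto simp: dist_real_def dist_commute)
  qed (use \<delta> in auto)
qed

lemma lipschitz_imp_abs_continuous_on:
  assumes "L-lipschitz_on I y"
  shows "abs_continuous_on I y"
  unfolding abs_continuous_on_def
proof (intro allI impI)
  fix \<epsilon> :: real assume \<epsilon>: "\<epsilon> > 0"
  have L: "L \<ge> 0" using assms by (rule lipschitz_on_nonneg)
  show "\<exists>\<delta>>0. \<forall>D. D division_of \<Union>D \<and> \<Union>D \<subseteq> I \<and> (\<Sum>k\<in>D. Sup k - Inf k) < \<delta> \<longrightarrow>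
        (\<Sum>k\<in>D. norm (y (Sup k) - y (Inf k))) < \<epsilon>"
  proof (intro exI[of _ "\<epsilon> / (L + 1)"] conjI allI impI)
    fix D assume D: "D division_of \<Union>D \<and> \<Union>D \<subseteq> I \<and> (\<Sum>k\<in>D. Sup k - Inf k) < \<epsilon> / (L + 1)"
    have "(\<Sum>k\<in>D. norm (y (Sup k) - y (Inf k))) \<le> (\<Sum>k\<in>D. (L + 1) * (Sup k - Inf k))"
    proof (rule sum_mono)
      fix k assume k: "k \<in> D"
      then obtain u v where uv: "k = cbox u v" "k \<noteq> {}"
        using D division_ofD(3,4) by metis
      have "k \<subseteq> I" using D k by blast
      with uv have k': "Sup k = v" "Inf k = u" "u \<le> v" "u \<in> I" "v \<in> I"
        by (auto simp: cbox_interval)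
      then have "norm (y (Sup k) - y (Inf k)) \<le> L * (v - u)"
        using lipschitz_onD[OF assms, of v u] by (auto simp: dist_norm)
      also have "\<dots> \<le> (L + 1) * (v - u)"
        using k' by (intro mult_right_mono) auto
      finally show "norm (y (Sup k) - y (Inf k)) \<le> (L + 1) * (Sup k - Inf k)" using k' by simp
    qed
    also have "\<dots> = (L + 1) * (\<Sum>k\<in>D. Sup k - Inf k)"
      by (simp add: sum_distrib_left)
    also have "\<dots> < (L + 1) * (\<epsilon> / (L + 1))"
      using D L by (intro mult_strict_left_mono) auto
    also have "\<dots> = \<epsilon>" using L by simp
    finally show "(\<Sum>k\<in>D. norm (y (Sup k) - y (Inf k))) < \<epsilon>" .
  qed (use \<epsilon> L in auto)
qed

text \<open>The hull of the pairs \<open>(p u, q u)\<close> projects onto both hulls, so common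
  weights serve \<open>p\<close> and \<open>q\<close>; the differences then stay in the ball of
  radius \<open>e\<close> by convexity.\<close>

lemma convex_hull_image_near:
  fixes p q :: "'i \<Rightarrow> 'e::real_normed_vector"
  assumes near: "\<And>u. u \<in> S \<Longrightarrow> norm (p u - q u) \<le> e" and v: "v \<in> convex hull (p ` S)"
  shows "\<exists>w\<in>convex hull (q ` S). norm (v - w) \<le> e"
proof -
  let ?G = "(\<lambda>u. (p u, q u)) ` S"
  have fst_hull: "fst ` (convex hull ?G) = convex hull (p ` S)"
    and snd_hull: "snd ` (convex hull ?G) = convex hull (q ` S)"
    by (simp_all add: convex_hull_linear_image linear_fst linear_snd image_image)
  obtain w where w: "(v, w) \<in> convex hull ?G"
    using v unfolding fst_hull[symmetric] by auto
  have "convex ((\<lambda>(a, b). a - b) -` cball (0::'e) e)"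
    by (intro convex_linear_vimage) (auto simp: linear_iff algebra_simps)
  moreover have "?G \<subseteq> (\<lambda>(a, b). a - b) -` cball 0 e"
    using near by auto
  ultimately have "convex hull ?G \<subseteq> (\<lambda>(a, b). a - b) -` cball 0 e"
    by (rule hull_minimal[rotated])
  with w have "norm (v - w) \<le> e" by auto
  moreover have "w \<in> convex hull (q ` S)"
    using w unfolding snd_hull[symmetric] by force
  ultimately show ?thesis by blast
qed

section \<open>The discrete maximum principle\<close>

text \<open>The Euler scheme of the relaxed system. Taking the hull at each step makes the
  admissible velocities convex, which the variation in \<open>discrete_adjoint_step\<close> relies
  on.\<close>

primrec reach :: "real \<Rightarrow> (nat \<Rightarrow> 'a \<Rightarrow> 'b \<Rightarrow> 'a::euclidean_space) \<Rightarrow> 'b set \<Rightarrow> 'a \<Rightarrow> nat \<Rightarrow> 'a set" where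
  "reach h F \<Omega> x0 0 = {x0}"
| "reach h F \<Omega> x0 (Suc i) = (\<Union>x\<in>reach h F \<Omega> x0 i. (\<lambda>v. x + h *\<^sub>R v) ` (convex hull (F i x ` \<Omega>)))"

text \<open>Closedness is the point: when the states converge, the velocities converge uniformly
  over the controls, so elements of the approximating hulls come arbitrarily close to the hull at
  the limit state, which is compact.\<close>

lemma compact_graph_convex_hull:
  fixes F :: "'a::euclidean_space \<Rightarrow> 'b::euclidean_space \<Rightarrow> 'c::euclidean_space"
  assumes R: "compact R" and \<Omega>: "compact \<Omega>" and F: "continuous_on (UNIV \<times> \<Omega>) (\<lambda>(x, u). F x u)"
  shows "compact {(x, v). x \<in> R \<and> v \<in> convex hull (F x ` \<Omega>)}"
proof -
  let ?P = "{(x, v). x \<in> R \<and> v \<in> convex hull (F x ` \<Omega>)}"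
  have FR: "continuous_on (R \<times> \<Omega>) (\<lambda>(x, u). F x u)"
    using F by (rule continuous_on_subset) auto
  have cF: "compact (F x ` \<Omega>)" for x
  proof -
    have "continuous_on \<Omega> (\<lambda>u. (\<lambda>(x, u). F x u) (x, u))"
      by (rule continuous_on_compose2[OF F]) (auto intro!: continuous_intros)
    then show ?thesis using \<Omega> by (auto intro: compact_continuous_image)
  qed
  have uc: "uniformly_continuous_on (R \<times> \<Omega>) (\<lambda>(x, u). F x u)"
    using FR R \<Omega> by (intro compact_uniformly_continuous compact_Times)
  have bdd: "bounded ?P"
  proof -
    have "compact ((\<lambda>(x, u). F x u) ` (R \<times> \<Omega>))"
      using FR R \<Omega> by (intro compact_continuous_image compact_Times)
    then have "bounded (R \<times> (convex hull ((\<lambda>(x, u). F x u) ` (R \<times> \<Omega>))))"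
      using R by (intro bounded_Times bounded_convex_hull) (auto simp: compact_imp_bounded)
    moreover have "?P \<subseteq> R \<times> (convex hull ((\<lambda>(x, u). F x u) ` (R \<times> \<Omega>)))"
    proof
      fix p assume "p \<in> ?P"
      then obtain x v where p: "p = (x, v)" "x \<in> R" "v \<in> convex hull (F x ` \<Omega>)" by blast
      have "convex hull (F x ` \<Omega>) \<subseteq> convex hull ((\<lambda>(x, u). F x u) ` (R \<times> \<Omega>))"
        by (intro hull_mono) (use \<open>x \<in> R\<close> in force)
      then show "p \<in> R \<times> (convex hull ((\<lambda>(x, u). F x u) ` (R \<times> \<Omega>)))"
        using p by blast
    qed
    ultimately show ?thesis by (rule bounded_subset)
  qed
  have "closed ?P"
  proof (unfold closed_sequential_limits, intro allI impI, elim conjE)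
    fix s l assume s: "\<forall>n. s n \<in> ?P" "s \<longlonglongrightarrow> l"
    obtain x v where l: "l = (x, v)" by (cases l)
    have lim: "(\<lambda>n. fst (s n)) \<longlonglongrightarrow> x" "(\<lambda>n. snd (s n)) \<longlonglongrightarrow> v"
      using tendsto_fst[OF s(2)] tendsto_snd[OF s(2)] l by auto
    have x: "x \<in> R"
      using closed_sequentially[OF compact_imp_closed[OF R] _ lim(1)] s(1) by (auto simp: case_prod_beta)
    have "v \<in> closure (convex hull (F x ` \<Omega>))"
      unfolding closure_approachable
    proof (intro allI impI)
      fix e :: real assume e: "e > 0"
      obtain d where d: "d > 0" "\<And>p q. p \<in> R \<times> \<Omega> \<Longrightarrow> q \<in> R \<times> \<Omega> \<Longrightarrow> dist q p < d \<Longrightarrow>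
          dist ((\<lambda>(x, u). F x u) q) ((\<lambda>(x, u). F x u) p) < e/2"
        using uniformly_continuous_onE[OF uc, of "e/2"] e by (metis half_gt_zero)
      have "\<forall>\<^sub>F n in sequentially. dist (fst (s n)) x < d \<and> dist (snd (s n)) v < e/2"
        using tendstoD[OF lim(1) d(1)] tendstoD[OF lim(2), of "e/2"] e by (auto intro: eventually_conj)
      then obtain n where n: "dist (fst (s n)) x < d" "dist (snd (s n)) v < e/2"
        using eventually_happens' sequentially_bot by blast
      have "fst (s n) \<in> R" "snd (s n) \<in> convex hull (F (fst (s n)) ` \<Omega>)"
        using s(1) by (auto simp: case_prod_beta)
      moreover have "norm (F (fst (s n)) u - F x u) \<le> e/2" if "u \<in> \<Omega>" for u
        using d(2)[of "(x, u)" "(fst (s n), u)"] x n that \<open>fst (s n) \<in> R\<close> by (auto simp: dist_norm dist_Pair_Pair)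
      ultimately obtain w where w: "w \<in> convex hull (F x ` \<Omega>)" "norm (snd (s n) - w) \<le> e/2"
        using convex_hull_image_near[of \<Omega> "F (fst (s n))" "F x" "e/2" "snd (s n)"] by auto
      have "dist w v \<le> dist (snd (s n)) w + dist (snd (s n)) v"
        by (metis dist_commute dist_triangle)
      then have "dist w v < e" using w n by (simp add: dist_norm)
      then show "\<exists>y\<in>convex hull (F x ` \<Omega>). dist y v < e" using w by blast
    qed
    then have "v \<in> convex hull (F x ` \<Omega>)"
      using cF by (metis closure_closed compact_convex_hull compact_imp_closed)
    then show "l \<in> ?P" using x l by auto
  qed
  then show ?thesis using bdd by (simp add: compact_eq_bounded_closed)
qed

lemma compact_reach:
  fixes F :: "nat \<Rightarrow> 'a::euclidean_space \<Rightarrow> 'b::euclidean_space \<Rightarrow> 'a"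
  assumes \<Omega>: "compact \<Omega>" and F: "\<And>i. continuous_on (UNIV \<times> \<Omega>) (\<lambda>(x, u). F i x u)"
  shows "compact (reach h F \<Omega> x0 i)"
proof (induction i)
  case (Suc i)
  let ?P = "{(x, v). x \<in> reach h F \<Omega> x0 i \<and> v \<in> convex hull (F i x ` \<Omega>)}"
  have "reach h F \<Omega> x0 (Suc i) = (\<lambda>(x, v). x + h *\<^sub>R v) ` ?P"
    by force
  moreover have "compact ((\<lambda>(x, v). x + h *\<^sub>R v) ` ?P)"
    using compact_graph_convex_hull[OF Suc \<Omega> F]
    by (intro compact_continuous_image) (auto intro!: continuous_intros simp: case_prod_beta)
  ultimately show ?case by simp
qed simp

lemma reach_nonempty: "\<Omega> \<noteq> {} \<Longrightarrow> reach h F \<Omega> x0 i \<noteq> {}"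
  by (induction i) auto

lemma reach_trajectory:
  assumes "y \<in> reach h F \<Omega> x0 N"
  shows "\<exists>x. x 0 = x0 \<and> x N = y \<and> (\<forall>i\<le>N. x i \<in> reach h F \<Omega> x0 i) \<and>
    (\<forall>i<N. \<exists>v\<in>convex hull (F i (x i) ` \<Omega>). x (Suc i) = x i + h *\<^sub>R v)"
  using assms
proof (induction N arbitrary: y)
  case 0
  then show ?case by (intro exI[of _ "\<lambda>_. x0"]) auto
next
  case (Suc N)
  then obtain z v where z: "z \<in> reach h F \<Omega> x0 N" "v \<in> convex hull (F N z ` \<Omega>)" "y = z + h *\<^sub>R v"
    by auto
  obtain x where x: "x 0 = x0" "x N = z" "\<forall>i\<le>N. x i \<in> reach h F \<Omega> x0 i"
    "\<forall>i<N. \<exists>v\<in>convex hull (F i (x i) ` \<Omega>). x (Suc i) = x i + h *\<^sub>R v"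
    using Suc.IH[OF z(1)] by blast
  show ?case
  proof (intro exI[of _ "x(Suc N := y)"] conjI allI impI)
    fix i assume "i \<le> Suc N"
    then show "(x(Suc N := y)) i \<in> reach h F \<Omega> x0 i"
      using x(3) Suc.prems by (cases "i = Suc N") auto
  next
    fix i assume i: "i < Suc N"
    show "\<exists>v\<in>convex hull (F i ((x(Suc N := y)) i) ` \<Omega>). (x(Suc N := y)) (Suc i) = (x(Suc N := y)) i + h *\<^sub>R v"
    proof (cases "i = N")
      case True
      then show ?thesis using z x(2) by auto
    next
      case False
      then show ?thesis using i x(4) by auto
    qed
  qed (use x in auto)
qed

text \<open>The whole set of minimizers is kept, since the weights of a relaxed velocity may be
  spread over several of them.\<close>

definition minimizers :: "('b \<Rightarrow> 'a) \<Rightarrow> 'b set \<Rightarrow> 'a::real_inner \<Rightarrow> 'b set" where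
  "minimizers G \<Omega> \<nu> = {u\<in>\<Omega>. \<forall>v\<in>\<Omega>. \<nu> \<bullet> G u \<le> \<nu> \<bullet> G v}"

lemma convex_hull_image_explicit:
  assumes "v \<in> convex hull (G ` \<Omega>)"
  obtains k :: nat and c :: "nat \<Rightarrow> real" and u where
    "\<And>j. j < k \<Longrightarrow> 0 \<le> c j \<and> u j \<in> \<Omega>" "(\<Sum>j<k. c j) = 1" "(\<Sum>j<k. c j *\<^sub>R G (u j)) = v"
proof -
  have "v \<in> {\<Sum>i=1..k. c i *\<^sub>R x i |k c x.
      (\<forall>i\<in>{1::nat..k}. 0 \<le> c i \<and> x i \<in> G ` \<Omega>) \<and> sum c {1..k} = (1::real)}"
    using assms unfolding convex_hull_indexed by fastforce
  then obtain k c x where k: "\<forall>i\<in>{1::nat..k}. 0 \<le> c i \<and> x i \<in> G ` \<Omega>" "sum c {1..k} = (1::real)"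
      "v = (\<Sum>i=1..k. c i *\<^sub>R x i)" by auto
  have "\<forall>j\<in>{1..k}. \<exists>u. u \<in> \<Omega> \<and> x j = G u" using k(1) by auto
  then obtain u where u: "\<And>j. j \<in> {1..k} \<Longrightarrow> u j \<in> \<Omega> \<and> x j = G (u j)" by metis
  show ?thesis
  proof (rule that[of k "\<lambda>j. c (Suc j)" "\<lambda>j. u (Suc j)"])
    show "0 \<le> c (Suc j) \<and> u (Suc j) \<in> \<Omega>" if "j < k" for j using k(1) u[of "Suc j"] that by auto
    show "(\<Sum>j<k. c (Suc j)) = 1" using k(2) by (simp add: sum.atLeast1_atMost_eq)
    have "v = (\<Sum>i=1..k. c i *\<^sub>R G (u i))"
      unfolding k(3) by (rule sum.cong) (use u in auto)
    then show "(\<Sum>j<k. c (Suc j) *\<^sub>R G (u (Suc j))) = v" by (simp add: sum.atLeast1_atMost_eq)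
  qed
qed

text \<open>
  One backward step: \<open>\<theta>\<close> plays the role of the cost-to-go along the frozen relaxed controls. Its
  gradient at the optimal state is the adjoint variable, and minimality over the reachable set
  forces every control used with positive weight to minimize \<open>\<langle>\<nu>, F x u\<rangle>\<close>.
\<close>

lemma discrete_adjoint_step:
  fixes F :: "'a::euclidean_space \<Rightarrow> 'b \<Rightarrow> 'a" and F' :: "'a \<Rightarrow> 'b \<Rightarrow> 'a \<Rightarrow> 'a"
  assumes h: "h > 0"
    and F': "\<And>u. u \<in> \<Omega> \<Longrightarrow> ((\<lambda>y. F y u) has_derivative F' x u) (at x)"
    and v: "v \<in> convex hull (F x ` \<Omega>)"
    and x: "x \<in> X" and XY: "\<And>y w. y \<in> X \<Longrightarrow> w \<in> convex hull (F y ` \<Omega>) \<Longrightarrow> y + h *\<^sub>R w \<in> Y"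
    and min: "\<And>y. y \<in> Y \<Longrightarrow> \<theta> (x + h *\<^sub>R v) \<le> \<theta> y"
    and grad: "GDERIV \<theta> (x + h *\<^sub>R v) :> \<nu>'"
  obtains \<nu> \<theta>' where "GDERIV \<theta>' x :> \<nu>" "\<And>y. y \<in> X \<Longrightarrow> \<theta>' x \<le> \<theta>' y"
    "(v, (1/h) *\<^sub>R (\<nu>' - \<nu>)) \<in> convex hull ((\<lambda>u. (F x u, - adjoint (F' x u) \<nu>')) ` minimizers (F x) \<Omega> \<nu>')"
proof -
  obtain k :: nat and c u where k: "\<And>j. j < k \<Longrightarrow> 0 \<le> c j \<and> u j \<in> \<Omega>" "(\<Sum>j<k. c j) = 1" "(\<Sum>j<k. c j *\<^sub>R F x (u j)) = v"
    using convex_hull_image_explicit[OF v] by blast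
  \<comment> \<open>One step of the dynamics with the controls and weights of \<open>v\<close>
    frozen: it maps \<open>X\<close> into \<open>Y\<close>, and only the state varies, so it is
    differentiable at \<open>x\<close>.\<close>
  define \<Phi> where "\<Phi> y = y + h *\<^sub>R (\<Sum>j<k. c j *\<^sub>R F y (u j))" for y
  have \<Phi>x: "\<Phi> x = x + h *\<^sub>R v" using k by (simp add: \<Phi>_def)
  have \<Phi>Y: "\<Phi> y \<in> Y" if "y \<in> X" for y
    unfolding \<Phi>_def using that k(1,2)
    by (intro XY convex_sum) (auto simp: convex_convex_hull intro!: hull_inc)
  \<comment> \<open>By the chain rule this is the gradient of \<open>\<theta> \<circ> \<Phi>\<close>
    at \<open>x\<close>: one backward step of the adjoint equation.\<close>
  define \<nu> where "\<nu> = \<nu>' + h *\<^sub>R (\<Sum>j<k. c j *\<^sub>R adjoint (F' x (u j)) \<nu>')"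
  have lin: "linear (F' x (u j))" if "j < k" for j
    using F' k(1)[OF that] by (meson has_derivative_linear)
  have "GDERIV (\<theta> \<circ> \<Phi>) x :> \<nu>"
  proof -
    have "(\<Phi> has_derivative (\<lambda>y. y + h *\<^sub>R (\<Sum>j<k. c j *\<^sub>R F' x (u j) y))) (at x)"
      unfolding \<Phi>_def by (intro derivative_intros F') (use k(1) in auto)
    moreover have "(\<theta> has_derivative (\<lambda>y. y \<bullet> \<nu>')) (at (\<Phi> x))"
      using grad by (simp add: gderiv_def \<Phi>x)
    ultimately have "(\<theta> \<circ> \<Phi> has_derivative (\<lambda>y. y \<bullet> \<nu>') \<circ> (\<lambda>y. y + h *\<^sub>R (\<Sum>j<k. c j *\<^sub>R F' x (u j) y))) (at x)"
      by (rule diff_chain_at)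
    moreover have "(y + h *\<^sub>R (\<Sum>j<k. c j *\<^sub>R F' x (u j) y)) \<bullet> \<nu>' = y \<bullet> \<nu>" for y
    proof -
      have "(\<Sum>j<k. c j * (F' x (u j) y \<bullet> \<nu>')) = (\<Sum>j<k. c j * (y \<bullet> adjoint (F' x (u j)) \<nu>'))"
        by (rule sum.cong) (auto simp: adjoint_works[OF lin])
      then show ?thesis
        by (simp add: \<nu>_def inner_add_left inner_add_right inner_sum_left inner_sum_right)
    qed
    ultimately show ?thesis unfolding gderiv_def by (simp add: o_def)
  qed
  moreover have "(\<theta> \<circ> \<Phi>) x \<le> (\<theta> \<circ> \<Phi>) y" if "y \<in> X" for y
    using min \<Phi>Y[OF that] \<Phi>x by simp
  moreover have "(v, (1/h) *\<^sub>R (\<nu>' - \<nu>)) \<in> convex hull ((\<lambda>u. (F x u, - adjoint (F' x u) \<nu>')) ` minimizers (F x) \<Omega> \<nu>')"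
  proof -
    \<comment> \<open>The segment from \<open>v\<close> to \<open>w\<close> consists of admissible
      velocities, so \<theta> along the resulting end states has its minimum at parameter 0, and its
      right derivative there cannot be negative.\<close>
    have var: "\<nu>' \<bullet> v \<le> \<nu>' \<bullet> w" if w: "w \<in> convex hull (F x ` \<Omega>)" for w
    proof -
      define \<psi> where "\<psi> s = \<theta> (x + h *\<^sub>R v + s *\<^sub>R (h *\<^sub>R (w - v)))" for s
      have "(\<psi> has_real_derivative (h *\<^sub>R (w - v)) \<bullet> \<nu>') (at 0 within {0..1})"
      proof -
        have "(\<theta> has_derivative (\<lambda>y. y \<bullet> \<nu>')) (at (x + h *\<^sub>R v + 0 *\<^sub>R (h *\<^sub>R (w - v))))"
          using grad by (simp add: gderiv_def)
        moreover have "((\<lambda>s. x + h *\<^sub>R v + s *\<^sub>R (h *\<^sub>R (w - v))) has_derivative (\<lambda>s. s *\<^sub>R (h *\<^sub>R (w - v)))) (at (0::real))"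
          by (auto intro!: derivative_eq_intros)
        ultimately have "(\<psi> has_derivative (\<lambda>s. (s *\<^sub>R (h *\<^sub>R (w - v))) \<bullet> \<nu>')) (at 0)"
          unfolding \<psi>_def using has_derivative_compose by blast
        then have "(\<psi> has_derivative (*) ((h *\<^sub>R (w - v)) \<bullet> \<nu>')) (at 0)"
          by (rule has_derivative_eq_rhs) auto
        then show ?thesis
          unfolding has_field_derivative_def by (rule has_derivative_at_withinI)
      qed
      moreover have "\<psi> 0 \<le> \<psi> s" if s: "s \<in> {0..1}" for s
      proof -
        have "(1 - s) *\<^sub>R v + s *\<^sub>R w \<in> convex hull (F x ` \<Omega>)"
          using convexD_alt[OF convex_convex_hull v w, of s] s by auto
        then have "x + h *\<^sub>R ((1 - s) *\<^sub>R v + s *\<^sub>R w) \<in> Y" using XY x by blast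
        moreover have "x + h *\<^sub>R ((1 - s) *\<^sub>R v + s *\<^sub>R w) = x + h *\<^sub>R v + s *\<^sub>R (h *\<^sub>R (w - v))"
          by (simp add: algebra_simps)
        ultimately show ?thesis using min by (simp add: \<psi>_def)
      qed
      ultimately have "0 \<le> (h *\<^sub>R (w - v)) \<bullet> \<nu>'"
      proof -
        assume d: "(\<psi> has_real_derivative (h *\<^sub>R (w - v)) \<bullet> \<nu>') (at 0 within {0..1})"
          and m: "\<And>s. s \<in> {0..1} \<Longrightarrow> \<psi> 0 \<le> \<psi> s"
        show ?thesis
        proof (rule ccontr)
          assume "\<not> ?thesis"
          then obtain \<delta> where "\<delta> > 0" "\<forall>t>0. 0 + t \<in> {0..1} \<longrightarrow> t < \<delta> \<longrightarrow> \<psi> (0 + t) < \<psi> 0"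
            using has_real_derivative_neg_dec_right[OF d] by auto
          then show False using m[of "min (\<delta>/2) 1"] by (auto dest!: spec[of _ "min (\<delta>/2) 1"])
        qed
      qed
      then show ?thesis using h by (simp add: inner_diff_left inner_commute[of \<nu>'] zero_le_mult_iff)
    qed
    \<comment> \<open>By \<open>var\<close> no term lies below \<open>\<nu>' \<bullet> v\<close>,
      while the weighted average of the terms equals it; hence each term with nonzero weight attains
      the minimum.\<close>
    have "u j \<in> minimizers (F x) \<Omega> \<nu>'" if j: "j < k" "c j \<noteq> 0" for j
    proof -
      have ge: "0 \<le> c i * (\<nu>' \<bullet> F x (u i) - \<nu>' \<bullet> v)" if "i < k" for i
        using k(1)[OF that] var[OF hull_inc] by (intro mult_nonneg_nonneg) auto
      have "(\<Sum>i<k. c i * (\<nu>' \<bullet> F x (u i) - \<nu>' \<bullet> v)) = 0"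
      proof -
        have "(\<Sum>i<k. c i * (\<nu>' \<bullet> F x (u i) - \<nu>' \<bullet> v)) = \<nu>' \<bullet> (\<Sum>i<k. c i *\<^sub>R F x (u i)) - (\<Sum>i<k. c i) * (\<nu>' \<bullet> v)"
          by (simp add: inner_sum_right sum_distrib_right right_diff_distrib sum_subtractf)
        then show ?thesis using k by simp
      qed
      then have "c j * (\<nu>' \<bullet> F x (u j) - \<nu>' \<bullet> v) = 0"
        using ge j sum_nonneg_eq_0_iff[of "{..<k}" "\<lambda>i. c i * (\<nu>' \<bullet> F x (u i) - \<nu>' \<bullet> v)"] by auto
      then have "\<nu>' \<bullet> F x (u j) = \<nu>' \<bullet> v" using j by simp
      then show ?thesis
        using var k(1)[OF j(1)] by (auto simp: minimizers_def intro!: var hull_inc)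
    qed
    \<comment> \<open>Controls of weight 0 need not be minimizers and are dropped before the hull is
      formed.\<close>
    then have "(\<Sum>j\<in>{j. j < k \<and> c j \<noteq> 0}. c j *\<^sub>R (F x (u j), - adjoint (F' x (u j)) \<nu>'))
        \<in> convex hull ((\<lambda>u. (F x u, - adjoint (F' x u) \<nu>')) ` minimizers (F x) \<Omega> \<nu>')"
    proof (intro convex_sum convex_convex_hull)
      have "(\<Sum>j\<in>{j. j < k \<and> c j \<noteq> 0}. c j) = (\<Sum>j<k. c j)"
        by (rule sum.mono_neutral_left) auto
      then show "(\<Sum>j\<in>{j. j < k \<and> c j \<noteq> 0}. c j) = 1" using k by simp
    qed (use k(1) in \<open>auto intro!: hull_inc\<close>)
    moreover have "(\<Sum>j\<in>{j. j < k \<and> c j \<noteq> 0}. c j *\<^sub>R (F x (u j), - adjoint (F' x (u j)) \<nu>'))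
        = (\<Sum>j<k. c j *\<^sub>R (F x (u j), - adjoint (F' x (u j)) \<nu>'))"
      by (rule sum.mono_neutral_left) (auto simp: zero_prod_def)
    moreover have "(\<Sum>j<k. c j *\<^sub>R (F x (u j), - adjoint (F' x (u j)) \<nu>')) = (v, (1/h) *\<^sub>R (\<nu>' - \<nu>))"
      using h k(3) by (simp add: prod_eq_iff fst_sum snd_sum \<nu>_def sum_negf)
    ultimately show ?thesis by simp
  qed
  ultimately show ?thesis by (rule that)
qed

text \<open>Backward induction from the terminal cost \<open>z \<bullet> z / 2\<close>. Each step
  preserves that \<open>x k\<close> minimizes the current cost over the reachable set at
  \<open>k\<close>, which is what \<open>discrete_adjoint_step\<close> consumes. State at
  \<open>i\<close> and adjoint at \<open>Suc i\<close> occur together because an explicit Euler step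
  is being differentiated.\<close>

lemma discrete_maximum_principle:
  fixes F :: "nat \<Rightarrow> 'a::euclidean_space \<Rightarrow> 'b::euclidean_space \<Rightarrow> 'a" and F' :: "nat \<Rightarrow> 'a \<Rightarrow> 'b \<Rightarrow> 'a \<Rightarrow> 'a"
  assumes h: "h > 0" and \<Omega>: "compact \<Omega>" "\<Omega> \<noteq> {}"
    and F: "\<And>i. continuous_on (UNIV \<times> \<Omega>) (\<lambda>(x, u). F i x u)"
    and F': "\<And>i x u. u \<in> \<Omega> \<Longrightarrow> ((\<lambda>y. F i y u) has_derivative F' i x u) (at x)"
  shows "\<exists>x \<nu>. x 0 = x0 \<and> \<nu> N = x N \<and> (\<forall>i\<le>N. x i \<in> reach h F \<Omega> x0 i) \<and>
    (\<forall>y\<in>reach h F \<Omega> x0 N. norm (x N) \<le> norm y) \<and>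
    (\<forall>i<N. ((1/h) *\<^sub>R (x (Suc i) - x i), (1/h) *\<^sub>R (\<nu> (Suc i) - \<nu> i)) \<in>
       convex hull ((\<lambda>u. (F i (x i) u, - adjoint (F' i (x i) u) (\<nu> (Suc i)))) ` minimizers (F i (x i)) \<Omega> (\<nu> (Suc i))))"
proof -
  have "compact (reach h F \<Omega> x0 N)" "reach h F \<Omega> x0 N \<noteq> {}"
    using compact_reach[where F = F, OF \<Omega>(1) F] reach_nonempty[OF \<Omega>(2)] by blast+
  then obtain y where y: "y \<in> reach h F \<Omega> x0 N" "\<And>z. z \<in> reach h F \<Omega> x0 N \<Longrightarrow> norm y \<le> norm z"
    using continuous_attains_inf[of "reach h F \<Omega> x0 N" norm] continuous_on_norm_id by metis
  obtain x where x: "x 0 = x0" "x N = y" "\<forall>i\<le>N. x i \<in> reach h F \<Omega> x0 i"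
    "\<forall>i<N. \<exists>v\<in>convex hull (F i (x i) ` \<Omega>). x (Suc i) = x i + h *\<^sub>R v"
    using reach_trajectory[OF y(1)] by blast
  let ?incl = "\<lambda>\<nu> i. ((1/h) *\<^sub>R (x (Suc i) - x i), (1/h) *\<^sub>R (\<nu> (Suc i) - \<nu> i)) \<in>
       convex hull ((\<lambda>u. (F i (x i) u, - adjoint (F' i (x i) u) (\<nu> (Suc i)))) ` minimizers (F i (x i)) \<Omega> (\<nu> (Suc i)))"
  let ?Q = "\<lambda>k. \<exists>\<nu> \<theta>. \<nu> N = x N \<and> (\<forall>i. k \<le> i \<and> i < N \<longrightarrow> ?incl \<nu> i) \<and> GDERIV \<theta> (x k) :> \<nu> k \<and>
      (\<forall>y\<in>reach h F \<Omega> x0 k. \<theta> (x k) \<le> \<theta> y)"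
  have "?Q 0"
  proof (rule inc_induct[of 0 N ?Q])
    have "GDERIV (\<lambda>z. z \<bullet> z / 2) (x N) :> x N"
      unfolding gderiv_def by (auto intro!: derivative_eq_intros simp: inner_commute)
    moreover have "x N \<bullet> x N / 2 \<le> z \<bullet> z / 2" if "z \<in> reach h F \<Omega> x0 N" for z
      using y(2)[OF that] x(2) by (simp add: norm_le)
    ultimately show "?Q N" by (intro exI[of _ "\<lambda>_. x N"] exI[of _ "\<lambda>z. z \<bullet> z / 2"]) auto
  next
    fix k assume k: "0 \<le> k" "k < N" "?Q (Suc k)"
    then obtain \<nu> \<theta> where \<nu>: "\<nu> N = x N" "\<And>i. Suc k \<le> i \<Longrightarrow> i < N \<Longrightarrow> ?incl \<nu> i" "GDERIV \<theta> (x (Suc k)) :> \<nu> (Suc k)"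
        "\<And>y. y \<in> reach h F \<Omega> x0 (Suc k) \<Longrightarrow> \<theta> (x (Suc k)) \<le> \<theta> y"
      by blast
    obtain v where v: "v \<in> convex hull (F k (x k) ` \<Omega>)" "x (Suc k) = x k + h *\<^sub>R v"
      using x(4) k(2) by blast
    obtain \<nu>k \<theta>' where st: "GDERIV \<theta>' (x k) :> \<nu>k" "\<And>y. y \<in> reach h F \<Omega> x0 k \<Longrightarrow> \<theta>' (x k) \<le> \<theta>' y"
      "(v, (1/h) *\<^sub>R (\<nu> (Suc k) - \<nu>k)) \<in> convex hull ((\<lambda>u. (F k (x k) u, - adjoint (F' k (x k) u) (\<nu> (Suc k)))) ` minimizers (F k (x k)) \<Omega> (\<nu> (Suc k)))"
    proof (rule discrete_adjoint_step[OF h, where F = "F k" and F' = "F' k" and x = "x k" and \<Omega> = \<Omega> and v = v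
          and X = "reach h F \<Omega> x0 k" and Y = "reach h F \<Omega> x0 (Suc k)" and \<theta> = \<theta> and \<nu>' = "\<nu> (Suc k)"])
      show "x k \<in> reach h F \<Omega> x0 k" using x(3) k(2) by auto
    qed (use F' v \<nu> in auto)
    \<comment> \<open>The inclusion at \<open>i\<close> involves \<nu> at \<open>i\<close> and
      \<open>Suc i\<close> only, so overwriting the value at \<open>k\<close> leaves the inclusions
      for larger indices intact.\<close>
    show "?Q k"
    proof (intro exI[of _ "\<nu>(k := \<nu>k)"] exI[of _ \<theta>'] conjI allI impI)
      fix i assume i: "k \<le> i \<and> i < N"
      show "?incl (\<nu>(k := \<nu>k)) i"
      proof (cases "i = k")
        case True
        then show ?thesis using st(3) v(2) h by simp
      next
        case False
        then show ?thesis using \<nu>(2)[of i] i by simp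
      qed
    qed (use \<nu>(1) k st in auto)
  qed simp
  then obtain \<nu> where \<nu>: "\<nu> N = x N" "\<And>i. i < N \<Longrightarrow> ?incl \<nu> i" by auto
  show ?thesis
    using x \<nu> y(2) by (intro exI[of _ x] exI[of _ \<nu>]) auto
qed

section \<open>Linear interpolation and gradients of lower envelopes\<close>

text \<open>The sum of a closed set and a compact ball is closed. Thickenings turn estimates up to
  \<open>e\<close> into membership in closed convex sets, to which mean value and limit arguments
  apply.\<close>

lemma closed_thickening:
  fixes C :: "'e::euclidean_space set"
  assumes "closed C"
  shows "closed {a. \<exists>c\<in>C. norm (a - c) \<le> e}"
proof -
  have "{a. \<exists>c\<in>C. norm (a - c) \<le> e} = (\<Union>x\<in>C. \<Union>y\<in>cball 0 e. {x + y})"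
  proof (intro set_eqI iffI)
    fix a assume "a \<in> {a. \<exists>c\<in>C. norm (a - c) \<le> e}"
    then obtain c where "c \<in> C" "norm (a - c) \<le> e" by blast
    then show "a \<in> (\<Union>x\<in>C. \<Union>y\<in>cball 0 e. {x + y})"
      by (intro UN_I[of c] UN_I[of "a - c"]) auto
  qed force
  then show ?thesis
    using closed_compact_sums[OF assms compact_cball[of 0 e]] by simp
qed

lemma convex_thickening:
  fixes C :: "'e::real_normed_vector set"
  assumes "convex C"
  shows "convex {a. \<exists>c\<in>C. norm (a - c) \<le> e}"
proof (rule convexI)
  fix x y and u v :: real
  assume "x \<in> {a. \<exists>c\<in>C. norm (a - c) \<le> e}" "y \<in> {a. \<exists>c\<in>C. norm (a - c) \<le> e}"
    and uv: "0 \<le> u" "0 \<le> v" "u + v = 1"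
  then obtain c d where cd: "c \<in> C" "norm (x - c) \<le> e" "d \<in> C" "norm (y - d) \<le> e" by blast
  have "norm ((u *\<^sub>R x + v *\<^sub>R y) - (u *\<^sub>R c + v *\<^sub>R d)) = norm (u *\<^sub>R (x - c) + v *\<^sub>R (y - d))"
    by (simp add: algebra_simps)
  also have "\<dots> \<le> u * norm (x - c) + v * norm (y - d)"
    using uv by (metis abs_of_nonneg norm_scaleR norm_triangle_ineq)
  also have "\<dots> \<le> u * e + v * e"
    using cd uv by (intro add_mono mult_left_mono) auto
  also have "\<dots> = e" using uv by (metis distrib_right mult_1)
  finally show "u *\<^sub>R x + v *\<^sub>R y \<in> {a. \<exists>c\<in>C. norm (a - c) \<le> e}"
    using convexD[OF assms cd(1,3) uv] by blast
qed

lemma abs_continuous_on_subset: "abs_continuous_on I y \<Longrightarrow> J \<subseteq> I \<Longrightarrow> abs_continuous_on J y"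
  unfolding abs_continuous_on_def by (meson order_trans)

text \<open>Each clamped factor is the time spent in the corresponding step up to \<open>t\<close>,
  so this is the broken line that starts at \<open>z0\<close> and has velocity \<open>v i\<close> on
  step \<open>i\<close>. The sum avoids locating \<open>t\<close> among the steps.\<close>

definition polygon :: "real \<Rightarrow> real \<Rightarrow> nat \<Rightarrow> 'e::real_vector \<Rightarrow> (nat \<Rightarrow> 'e) \<Rightarrow> real \<Rightarrow> 'e" where
  "polygon t0 h N z0 v t = z0 + (\<Sum>i<N. min h (max 0 (t - (t0 + real i * h))) *\<^sub>R v i)"

lemma polygon_node:
  assumes "h > 0" "i \<le> N"
  shows "polygon t0 h N z0 v (t0 + real i * h) = z0 + h *\<^sub>R (\<Sum>j<i. v j)"
proof -
  have len: "min h (max 0 (t0 + real i * h - (t0 + real j * h))) = (if j < i then h else 0)" for j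
  proof (cases "j < i")
    case True
    then have "real i \<ge> real j + 1" by linarith
    then have "real i * h \<ge> (real j + 1) * h" using assms by (intro mult_right_mono) auto
    then show ?thesis using True assms by (simp add: algebra_simps)
  next
    case False
    then have "real i * h \<le> real j * h" using assms by (intro mult_right_mono) auto
    then show ?thesis using False assms by auto
  qed
  have "(\<Sum>j<N. (if j < i then h else 0) *\<^sub>R v j) = (\<Sum>j<i. h *\<^sub>R v j)"
  proof -
    have "(\<Sum>j<N. (if j < i then h else 0) *\<^sub>R v j) = (\<Sum>j<i. (if j < i then h else 0) *\<^sub>R v j)"
      using assms by (intro sum.mono_neutral_right) auto
    also have "\<dots> = (\<Sum>j<i. h *\<^sub>R v j)" by (rule sum.cong) auto
    finally show ?thesis .
  qed
  then show ?thesis unfolding polygon_def len by (simp add: scaleR_sum_right)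
qed

text \<open>Times spent in the single steps add up to the elapsed time; in
  \<open>polygon_increment_in\<close> this makes the weights sum to 1.\<close>

lemma sum_clamped_lengths:
  assumes "h > (0::real)"
  shows "(\<Sum>i<N. min h (max 0 (t - (t0 + real i * h)))) = min (real N * h) (max 0 (t - t0))"
proof (induction N)
  case (Suc N)
  have step: "min y (max 0 m) + min h (max 0 (m - y)) = min (y + h) (max 0 m)" if "y \<ge> 0" for y m :: real
    using that assms by (auto simp: min_def max_def)
  have "(\<Sum>i<Suc N. min h (max 0 (t - (t0 + real i * h))))
      = min (real N * h) (max 0 (t - t0)) + min h (max 0 ((t - t0) - real N * h))"
    using Suc by (simp add: diff_diff_eq)
  also have "\<dots> = min (real N * h + h) (max 0 (t - t0))"
    by (rule step) (use assms in simp)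
  finally show ?case by (simp add: distrib_right add.commute)
qed auto

text \<open>The difference quotient averages the velocities, each weighted by the fraction of the
  time from \<open>s\<close> to \<open>t\<close> that falls into its step; steps that do not meet
  this interval have weight 0.\<close>

lemma polygon_increment_in:
  fixes v :: "nat \<Rightarrow> 'e::real_vector"
  assumes h: "h > 0" and st: "t0 \<le> s" "s < t" "t \<le> t0 + real N * h" and C: "convex C"
    and v: "\<And>i. i < N \<Longrightarrow> t0 + real i * h < t \<Longrightarrow> s < t0 + real (Suc i) * h \<Longrightarrow> v i \<in> C"
  shows "(1 / (t - s)) *\<^sub>R (polygon t0 h N z0 v t - polygon t0 h N z0 v s) \<in> C"
proof -
  define l where "l r i = min h (max 0 (r - (t0 + real i * h)))" for r and i :: nat
  define c where "c i = (l t i - l s i) / (t - s)" for i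
  define I where "I = {i. i < N \<and> c i \<noteq> 0}"
  have c0: "c i \<ge> 0" for i
    using st unfolding c_def l_def by (intro divide_nonneg_pos) auto
  have I: "v i \<in> C" if "i \<in> I" for i
  proof (rule v)
    have "l t i \<noteq> l s i" using that by (auto simp: I_def c_def)
    then show "t0 + real i * h < t" "s < t0 + real (Suc i) * h"
      using st(2) h by (auto simp: l_def distrib_right min_def max_def split: if_splits)
  qed (use that in \<open>auto simp: I_def\<close>)
  have "sum c I = (\<Sum>i<N. c i)"
    unfolding I_def by (rule sum.mono_neutral_left) auto
  also have "\<dots> = ((\<Sum>i<N. l t i) - (\<Sum>i<N. l s i)) / (t - s)"
    unfolding c_def by (simp add: sum_subtractf flip: sum_divide_distrib)
  also have "\<dots> = 1"
    using st by (simp add: l_def sum_clamped_lengths[OF h])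
  finally have c1: "sum c I = 1" .
  have "(\<Sum>i\<in>I. c i *\<^sub>R v i) \<in> C"
    using c0 c1 I C by (intro convex_sum) (auto simp: I_def)
  moreover have "(\<Sum>i\<in>I. c i *\<^sub>R v i) = (\<Sum>i<N. c i *\<^sub>R v i)"
    unfolding I_def by (rule sum.mono_neutral_left) auto
  moreover have "(\<Sum>i<N. c i *\<^sub>R v i) = (1 / (t - s)) *\<^sub>R (polygon t0 h N z0 v t - polygon t0 h N z0 v s)"
    unfolding polygon_def c_def l_def
    by (simp add: scaleR_sum_right flip: sum_subtractf scaleR_diff_left)
  ultimately show ?thesis by simp
qed

text \<open>Three limits in a fixed order: first \<open>k\<close> for a fixed \<open>s\<close>, so
  the threshold for \<open>k\<close> may depend on \<open>s\<close>; then \<open>s\<close> down to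
  \<open>t\<close>; finally \<open>e\<close> to 0. Closedness of the thickenings serves the first
  two, closedness of \<open>C\<close> the last.\<close>

lemma limit_right_derivative_in:
  fixes g :: "real \<Rightarrow> 'e::euclidean_space"
  assumes C: "closed C"
    and near: "\<And>e. e > 0 \<Longrightarrow> \<exists>\<eta>>0. \<forall>s. t < s \<and> s < t + \<eta> \<longrightarrow>
       (\<forall>\<^sub>F k in sequentially. \<exists>c\<in>C. norm ((1 / (s - t)) *\<^sub>R (Z k s - Z k t) - c) \<le> e)"
    and lim: "b > t" "\<And>s. t \<le> s \<Longrightarrow> s < b \<Longrightarrow> (\<lambda>k. Z k s) \<longlonglongrightarrow> g s"
    and der: "(g has_vector_derivative v) (at t within {t..b})"
  shows "v \<in> C"
proof -
  have "v \<in> {a. \<exists>c\<in>C. norm (a - c) \<le> e}" if e: "e > 0" for e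
  proof -
    obtain \<eta> where \<eta>: "\<eta> > 0" "\<And>s. t < s \<Longrightarrow> s < t + \<eta> \<Longrightarrow>
       \<forall>\<^sub>F k in sequentially. \<exists>c\<in>C. norm ((1 / (s - t)) *\<^sub>R (Z k s - Z k t) - c) \<le> e"
      using near[OF e] by blast
    have q: "(1 / (s - t)) *\<^sub>R (g s - g t) \<in> {a. \<exists>c\<in>C. norm (a - c) \<le> e}" if "t < s" "s < min b (t + \<eta>)" for s
    proof (rule Lim_in_closed_set[OF closed_thickening[OF C]])
      show "\<forall>\<^sub>F k in sequentially. (1 / (s - t)) *\<^sub>R (Z k s - Z k t) \<in> {a. \<exists>c\<in>C. norm (a - c) \<le> e}"
        using \<eta>(2)[of s] that by simp
      show "(\<lambda>k. (1 / (s - t)) *\<^sub>R (Z k s - Z k t)) \<longlonglongrightarrow> (1 / (s - t)) *\<^sub>R (g s - g t)"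
        using that lim(1) by (intro tendsto_intros lim) auto
    qed simp
    have "((\<lambda>s. (1 / (s - t)) *\<^sub>R (g s - g t)) \<longlongrightarrow> v) (at t within {t..b})"
    proof (rule tendstoI)
      fix \<epsilon> :: real assume \<epsilon>: "\<epsilon> > 0"
      obtain d where d: "d > 0" "\<And>s. s \<in> {t..b} \<Longrightarrow> norm (s - t) < d \<Longrightarrow>
          norm (g s - g t - (s - t) *\<^sub>R v) \<le> \<epsilon> / 2 * norm (s - t)"
        using der \<epsilon> unfolding has_vector_derivative_def has_derivative_within_alt by (meson half_gt_zero)
      have "dist ((1 / (s - t)) *\<^sub>R (g s - g t)) v < \<epsilon>" if "s \<in> {t..b}" "s \<noteq> t" "dist s t < d" for s
      proof -
        have s: "s - t > 0" using that by auto
        have "(1 / (s - t)) *\<^sub>R (g s - g t) - v = (1 / (s - t)) *\<^sub>R (g s - g t - (s - t) *\<^sub>R v)"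
          using s by (simp add: scaleR_diff_right)
        then have "dist ((1 / (s - t)) *\<^sub>R (g s - g t)) v = norm (g s - g t - (s - t) *\<^sub>R v) / (s - t)"
          using s by (simp add: dist_norm)
        also have "\<dots> \<le> \<epsilon> / 2"
          using d(2)[of s] that s by (simp add: dist_norm divide_le_eq)
        finally show ?thesis using \<epsilon> by simp
      qed
      then show "\<forall>\<^sub>F s in at t within {t..b}. dist ((1 / (s - t)) *\<^sub>R (g s - g t)) v < \<epsilon>"
        unfolding eventually_at using d(1) by blast
    qed
    moreover have "\<forall>\<^sub>F s in at t within {t..b}. (1 / (s - t)) *\<^sub>R (g s - g t) \<in> {a. \<exists>c\<in>C. norm (a - c) \<le> e}"
      unfolding eventually_at using q lim(1) \<eta>(1)
      by (intro exI[of _ "min (b - t) \<eta>"]) (auto simp: dist_real_def)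
    moreover have "at t within {t..b} \<noteq> bot"
      using lim(1) by (simp add: trivial_limit_within islimpt_Icc)
    ultimately show ?thesis
      by (intro Lim_in_closed_set[OF closed_thickening[OF C]])
  qed
  note * = this
  have "\<exists>c\<in>C. dist c v < e" if e: "e > 0" for e
  proof -
    have "\<exists>c\<in>C. norm (v - c) \<le> e / 2"
      using *[of "e / 2"] e by simp
    then obtain c where "c \<in> C" "norm (v - c) \<le> e / 2" by blast
    then show ?thesis using e by (intro bexI[of _ c]) (auto simp: dist_norm norm_minus_commute)
  qed
  then have "v \<in> closure C" by (simp add: closure_approachable)
  then show ?thesis using C by simp
qed

text \<open>
  Comparing \<open>S\<close> along a short step from \<open>z\<close> in a direction \<open>d\<close> to a generic point \<open>z'\<close>: minimality at
  both ends gives \<open>S z' (w z') - S z (w z') \<le> S z' u - S z u\<close>, so the gradient of the selected branch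
  at \<open>z'\<close> does not exceed \<open>g z u\<close> in direction \<open>d\<close> by more than an error vanishing with the step.
  This excludes a separating hyperplane.
\<close>

lemma envelope_gradient_in_hull:
  fixes S :: "'z::euclidean_space \<Rightarrow> 'b \<Rightarrow> real"
  assumes grad: "\<And>z u. u \<in> \<Omega> \<Longrightarrow> GDERIV (\<lambda>z. S z u) z :> g z u"
    and unif: "\<And>e. e > 0 \<Longrightarrow> \<exists>\<rho>>0. \<forall>z'\<in>ball z \<rho>. \<forall>u\<in>\<Omega>. norm (g z' u - g z u) \<le> e"
    and bound: "\<And>u. u \<in> \<Omega> \<Longrightarrow> norm (g z u) \<le> B"
    and w: "\<And>z'. w z' \<in> \<Omega>" "\<And>z' v. v \<in> \<Omega> \<Longrightarrow> S z' (w z') \<le> S z' v"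
    and u: "u \<in> \<Omega>" "\<And>v. v \<in> \<Omega> \<Longrightarrow> S z u \<le> S z v"
    and N: "negligible N" and r: "r > 0"
  shows "g z u \<in> closure (convex hull ((\<lambda>z'. g z' (w z')) ` (ball z r - N)))"
proof (rule ccontr)
  let ?C = "closure (convex hull ((\<lambda>z'. g z' (w z')) ` (ball z r - N)))"
  \<comment> \<open>Balls are not null sets, so points off \<open>N\<close> exist arbitrarily near
    any prescribed point.\<close>
  have avoid: "\<exists>y\<in>ball a s. y \<notin> N" if "s > 0" for a s
  proof (rule ccontr)
    assume "\<not> ?thesis"
    then have "ball a s \<subseteq> N" by blast
    then show False
      using negligible_subset[OF N] open_not_negligible[OF open_ball, of a s] that by auto
  qed
  assume "g z u \<notin> ?C"
  then obtain d \<beta> where d: "d \<bullet> g z u < \<beta>" "\<And>c. c \<in> ?C \<Longrightarrow> \<beta> < d \<bullet> c"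
    using separating_hyperplane_closed_point[of ?C "g z u"] convex_closure[OF convex_convex_hull] closed_closure
    by blast
  have B: "B \<ge> 0" using bound[OF u(1)] norm_ge_zero order_trans by blast
  \<comment> \<open>All errors are multiples of one parameter: \<open>3 * (norm d + 1)\<close> comes
    from two first-order expansions and one change of gradient, \<open>2 * B + 1\<close> from the
    deviation of the step from the direction \<open>d\<close>.\<close>
  define \<omega> where "\<omega> = min 1 ((\<beta> - d \<bullet> g z u) / (3 * (norm d + 1) + 2 * B + 1))"
  have den: "3 * (norm d + 1) + 2 * B + 1 > 0" using B by (intro add_nonneg_pos add_nonneg_nonneg mult_nonneg_nonneg) auto
  have \<omega>: "\<omega> > 0" "\<omega> \<le> 1" using d(1) den by (auto simp: \<omega>_def)
  have \<omega>_small: "\<omega> * (3 * (norm d + 1) + 2 * B + 1) \<le> \<beta> - d \<bullet> g z u"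
    unfolding pos_le_divide_eq[OF den, symmetric] by (simp add: \<omega>_def)
  obtain \<rho> where \<rho>: "\<rho> > 0" "\<And>z' u. z' \<in> ball z \<rho> \<Longrightarrow> u \<in> \<Omega> \<Longrightarrow> norm (g z' u - g z u) \<le> \<omega>"
    using unif[OF \<omega>(1)] by blast
  have lin: "\<bar>S z' u - S z u - (z' - z) \<bullet> g z u\<bar> \<le> norm (z' - z) * \<omega>" if z': "z' \<in> ball z \<rho>" and u: "u \<in> \<Omega>" for z' u
  proof -
    have "norm (S z' u - S z u - (z' - z) \<bullet> g z u) \<le> norm (z' - z) * \<omega>"
    proof (rule differentiable_bound_linearization[where f' = "\<lambda>x y. y \<bullet> g x u" and S = "ball z \<rho>" and ?x0.0 = z])
      show "z + t *\<^sub>R (z' - z) \<in> ball z \<rho>" if "t \<in> {0..1}" for t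
      proof -
        have "norm (t *\<^sub>R (z' - z)) \<le> 1 * norm (z' - z)"
          using that unfolding norm_scaleR by (intro mult_right_mono) auto
        then show ?thesis using z' by (simp add: dist_norm norm_minus_commute)
      qed
      show "((\<lambda>z. S z u) has_derivative (\<lambda>y. y \<bullet> g x u)) (at x within ball z \<rho>)" for x
        using grad[OF u] unfolding gderiv_def by (rule has_derivative_at_withinI)
      show "onorm ((\<lambda>y. y \<bullet> g x u) - (\<lambda>y. y \<bullet> g z u)) \<le> \<omega>" if "x \<in> ball z \<rho>" for x
        unfolding fun_diff_def
      proof (rule onorm_bound)
        show "norm (y \<bullet> g x u - y \<bullet> g z u) \<le> \<omega> * norm y" for y
        proof -
          have "norm (y \<bullet> g x u - y \<bullet> g z u) \<le> norm y * norm (g x u - g z u)"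
            by (metis Cauchy_Schwarz_ineq2 inner_diff_right real_norm_def)
          also have "\<dots> \<le> norm y * \<omega>" using \<rho>(2)[OF that u] by (intro mult_left_mono) auto
          finally show ?thesis by (simp add: mult.commute)
        qed
      qed (use \<omega> in auto)
    qed (use \<rho> in auto)
    then show ?thesis by simp
  qed
  \<comment> \<open>The step is so short that the generic point \<open>z'\<close> stays within half
    of \<open>min \<rho> r\<close> of \<open>z\<close>; see \<open>k2\<close> and
    \<open>len\<close>.\<close>
  define k where "k = min \<rho> r / (2 * (norm d + 1))"
  have nd: "norm d + 1 > 0" by (simp add: add_nonneg_pos)
  have k: "k > 0" using \<rho> r nd by (simp add: k_def)
  have k2: "k * (norm d + 1) = min \<rho> r / 2"
  proof -
    have "m / (2 * n) * n = m / 2" if "n > 0" for m n :: real using that by simp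
    then show ?thesis unfolding k_def using nd by blast
  qed
  \<comment> \<open>The target \<open>z + k *\<^sub>R d\<close> itself may lie in \<open>N\<close>;
    a point off \<open>N\<close> near it is used at the price of a direction error \<eta> of norm at
    most \<omega>.\<close>
  obtain z' where z': "z' \<in> ball (z + k *\<^sub>R d) (k * \<omega>)" "z' \<notin> N"
    using avoid[of "k * \<omega>" "z + k *\<^sub>R d"] k \<omega> by (auto simp del: mem_ball)
  define \<eta> where "\<eta> = (1/k) *\<^sub>R (z' - z) - d"
  have z'_eq: "z' - z = k *\<^sub>R (d + \<eta>)" using k by (simp add: \<eta>_def algebra_simps)
  have \<eta>: "norm \<eta> \<le> \<omega>"
  proof -
    have "k *\<^sub>R \<eta> = z' - (z + k *\<^sub>R d)" using z'_eq by (simp add: algebra_simps)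
    then have "k * norm \<eta> = dist (z + k *\<^sub>R d) z'"
      using k by (metis abs_of_pos dist_commute dist_norm norm_scaleR)
    then have "k * norm \<eta> < k * \<omega>" using z'(1) by simp
    then show ?thesis using k by (simp add: mult_less_cancel_left_pos)
  qed
  have len: "norm (z' - z) \<le> k * (norm d + 1)"
  proof -
    have "norm (d + \<eta>) \<le> norm d + 1" using \<eta> \<omega> norm_triangle_ineq[of d \<eta>] by linarith
    then show ?thesis using k unfolding z'_eq norm_scaleR by simp
  qed
  have "norm (z' - z) < \<rho>" "norm (z' - z) < r" using len k2 \<rho> r by linarith+
  then have ball: "z' \<in> ball z \<rho>" "z' \<in> ball z r" by (auto simp: dist_norm norm_minus_commute)
  let ?g = "g z' (w z')"
  have "?g \<in> ?C"
    using ball z'(2) by (intro subsetD[OF closure_subset] hull_inc) auto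
  then have gt: "\<beta> < d \<bullet> ?g" by (rule d)
  have close: "norm (?g - g z (w z')) \<le> \<omega>" using \<rho>(2)[OF ball(1) w(1)] .
  have "S z' (w z') - S z (w z') \<le> S z' u - S z u"
    using w(2)[OF u(1), of z'] u(2)[OF w(1)[of z']] by linarith
  then have "(z' - z) \<bullet> g z (w z') \<le> (z' - z) \<bullet> g z u + 2 * (norm (z' - z) * \<omega>)"
    using lin[OF ball(1) u(1)] lin[OF ball(1) w(1)[of z']] by linarith
  moreover have "(z' - z) \<bullet> ?g \<le> (z' - z) \<bullet> g z (w z') + norm (z' - z) * \<omega>"
  proof -
    have "(z' - z) \<bullet> (?g - g z (w z')) \<le> norm (z' - z) * norm (?g - g z (w z'))"
      by (rule norm_cauchy_schwarz)
    also have "\<dots> \<le> norm (z' - z) * \<omega>" using close by (intro mult_left_mono) auto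
    finally show ?thesis by (simp add: inner_diff_right)
  qed
  ultimately have "(z' - z) \<bullet> (?g - g z u) \<le> 3 * (norm (z' - z) * \<omega>)"
    by (simp add: inner_diff_right)
  also have "\<dots> \<le> 3 * ((k * (norm d + 1)) * \<omega>)"
    using len \<omega> by (intro mult_left_mono mult_right_mono) auto
  finally have "k * ((d + \<eta>) \<bullet> (?g - g z u)) \<le> k * (3 * ((norm d + 1) * \<omega>))"
    unfolding z'_eq by (simp add: algebra_simps)
  then have "(d + \<eta>) \<bullet> (?g - g z u) \<le> 3 * ((norm d + 1) * \<omega>)"
    using k by simp
  moreover have "- (\<eta> \<bullet> (?g - g z u)) \<le> \<omega> * (2 * B + 1)"
  proof -
    have "norm (?g - g z u) \<le> norm (?g - g z (w z')) + norm (g z (w z')) + norm (g z u)"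
      using norm_triangle_ineq4[of ?g "g z u"] norm_triangle_ineq[of "?g - g z (w z')" "g z (w z')"] by simp
    also have "\<dots> \<le> 2 * B + 1" using close bound[OF u(1)] bound[OF w(1)[of z']] \<omega> by linarith
    finally have "norm \<eta> * norm (?g - g z u) \<le> \<omega> * (2 * B + 1)"
      using \<eta> \<omega> by (intro mult_mono) auto
    then show ?thesis using Cauchy_Schwarz_ineq2[of \<eta> "?g - g z u"] by linarith
  qed
  ultimately have "d \<bullet> (?g - g z u) \<le> \<omega> * (3 * (norm d + 1) + 2 * B + 1)"
    by (simp add: inner_add_left algebra_simps)
  with \<omega>_small gt show False by (simp add: inner_diff_right)
qed

section \<open>Relaxed extremals of a control system\<close>

lemma continuous_uniform_in_parameter:
  fixes h :: "'p::euclidean_space \<Rightarrow> 'b::euclidean_space \<Rightarrow> 'c::real_normed_vector"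
  assumes h: "continuous_on UNIV (\<lambda>(p, u). h p u)" and \<Omega>: "compact \<Omega>" and e: "e > 0"
  shows "\<exists>\<rho>>0. \<forall>q\<in>ball p \<rho>. \<forall>u\<in>\<Omega>. norm (h q u - h p u) \<le> e"
proof -
  have "uniformly_continuous_on (cball p 1 \<times> \<Omega>) (\<lambda>(p, u). h p u)"
    using h \<Omega> by (intro compact_uniformly_continuous compact_Times) (auto intro: continuous_on_subset)
  then obtain d where d: "d > 0" "\<And>x y. x \<in> cball p 1 \<times> \<Omega> \<Longrightarrow> y \<in> cball p 1 \<times> \<Omega> \<Longrightarrow> dist y x < d \<Longrightarrow>
      dist ((\<lambda>(p, u). h p u) y) ((\<lambda>(p, u). h p u) x) < e"
    using e unfolding uniformly_continuous_on_def by metis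
  have "norm (h q u - h p u) \<le> e" if "q \<in> ball p (min d 1)" "u \<in> \<Omega>" for q u
    using d(2)[of "(p, u)" "(q, u)"] that by (auto simp: dist_norm dist_Pair_Pair norm_minus_commute)
  then show ?thesis using d(1) by (intro exI[of _ "min d 1"]) auto
qed

lemma norm_convex_hull_image_le:
  assumes "v \<in> convex hull (G ` \<Omega>)" "\<And>u. u \<in> \<Omega> \<Longrightarrow> norm (G u) \<le> B"
  shows "norm v \<le> B"
proof -
  have "convex hull (G ` \<Omega>) \<subseteq> cball 0 B"
    by (rule hull_minimal) (use assms(2) in auto)
  then show ?thesis using assms(1) by auto
qed

text \<open>The discrete Gronwall factor: the bound depends on the elapsed time and not on the
  number of steps.\<close>

lemma power_le_exp_bound:
  fixes c h \<tau> :: real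
  assumes "0 \<le> c" "0 \<le> h" "real i * h \<le> \<tau>"
  shows "(1 + c * h) ^ i \<le> exp (c * \<tau>)"
proof -
  have "(1 + c * h) ^ i \<le> exp (c * h) ^ i"
    using assms by (intro power_mono) auto
  also have "\<dots> = exp (c * (real i * h))"
    by (simp add: exp_of_nat_mult[symmetric] mult.left_commute)
  also have "\<dots> \<le> exp (c * \<tau>)" using assms by (simp add: mult_left_mono)
  finally show ?thesis .
qed

lemma linear_blinfun_apply: "linear (blinfun_apply L)"
  by (rule bounded_linear.linear[OF blinfun.bounded_linear_right])

text \<open>In coordinates, joint continuity of the adjoint in operator and argument can be read
  off; this is how \<open>field\<close> is seen to be continuous.\<close>

lemma adjoint_blinfun_eq_sum:
  fixes L :: "'a::euclidean_space \<Rightarrow>\<^sub>L 'a"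
  shows "adjoint (blinfun_apply L) y = (\<Sum>b\<in>Basis. (L b \<bullet> y) *\<^sub>R b)"
proof -
  have "b \<bullet> adjoint (blinfun_apply L) y = L b \<bullet> y" for b
    by (rule adjoint_works) (rule linear_blinfun_apply)
  then show ?thesis
    using euclidean_representation[of "adjoint (blinfun_apply L) y"] by (simp add: inner_commute)
qed

lemma norm_adjoint_blinfun_le:
  fixes L :: "'a::euclidean_space \<Rightarrow>\<^sub>L 'a"
  shows "norm (adjoint (blinfun_apply L) y) \<le> norm L * norm y"
proof -
  let ?a = "adjoint (blinfun_apply L) y"
  have "norm ?a * norm ?a = ?a \<bullet> ?a" by (simp add: dot_square_norm power2_eq_square)
  also have "\<dots> = L ?a \<bullet> y"
    by (rule adjoint_works) (rule linear_blinfun_apply)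
  also have "\<dots> \<le> norm (L ?a) * norm y" by (rule norm_cauchy_schwarz)
  also have "\<dots> \<le> (norm L * norm ?a) * norm y"
    by (intro mult_right_mono norm_blinfun) auto
  finally have "norm ?a * norm ?a \<le> (norm L * norm y) * norm ?a" by (simp add: mult_ac)
  then show ?thesis
    by (cases "norm ?a = 0") (auto simp: mult_le_cancel_right)
qed

lemma gradient_eq:
  assumes "GDERIV \<phi> y :> D"
  shows "gradient \<phi> y = D"
  unfolding gradient_def
proof (rule the_equality)
  show "GDERIV \<phi> y :> D" by (rule assms)
  fix E assume "GDERIV \<phi> y :> E"
  then have "(\<lambda>h. h \<bullet> E) = (\<lambda>h. h \<bullet> D)"
    using assms unfolding gderiv_def by (rule has_derivative_unique)
  then have "(E - D) \<bullet> E = (E - D) \<bullet> D" by meson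
  then have "(E - D) \<bullet> (E - D) = 0" by (simp add: inner_diff_right)
  then show "E = D" by simp
qed

text \<open>\<open>growth\<close> is the radial derivative bound integrated along the ray from 0 to
  \<open>x\<close>, and \<open>nonempty_\<Omega>\<close> will be supplied by the values of the
  feedback.\<close>

locale control_system =
  fixes f :: "real \<Rightarrow> 'a::euclidean_space \<Rightarrow> 'b::euclidean_space \<Rightarrow> 'a"
    and Fx :: "real \<Rightarrow> 'a \<Rightarrow> 'b \<Rightarrow> 'a \<Rightarrow>\<^sub>L 'a" and \<Omega> :: "'b set" and Q :: real
  assumes cont_f: "continuous_on UNIV (\<lambda>(t, x, u). f t x u)"
    and deriv_f: "((\<lambda>y. f t y u) has_derivative blinfun_apply (Fx t x u)) (at x)"
    and cont_Fx: "continuous_on UNIV (\<lambda>(t, x, u). Fx t x u)"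
    and compact_\<Omega>: "compact \<Omega>" and nonempty_\<Omega>: "\<Omega> \<noteq> {}" and Q_pos: "Q > 0"
    and growth: "u \<in> \<Omega> \<Longrightarrow> norm (f t x u) \<le> norm (f t 0 u) + Q * norm x"
begin

definition field :: "real \<Rightarrow> 'a \<times> 'a \<Rightarrow> 'b \<Rightarrow> 'a \<times> 'a" where
  "field t z u = (f t (fst z) u, - adjoint (blinfun_apply (Fx t (fst z) u)) (snd z))"

abbreviation optimal :: "real \<Rightarrow> 'a \<times> 'a \<Rightarrow> 'b set" where
  "optimal t z \<equiv> minimizers (f t (fst z)) \<Omega> (snd z)"

lemma continuous_on_f:
  "continuous_on S a \<Longrightarrow> continuous_on S b \<Longrightarrow> continuous_on S c \<Longrightarrow> continuous_on S (\<lambda>s. f (a s) (b s) (c s))"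
  using continuous_on_compose2[OF cont_f, of S "\<lambda>s. (a s, b s, c s)"] by (simp add: continuous_on_Pair)

lemma continuous_on_Fx:
  "continuous_on S a \<Longrightarrow> continuous_on S b \<Longrightarrow> continuous_on S c \<Longrightarrow> continuous_on S (\<lambda>s. Fx (a s) (b s) (c s))"
  using continuous_on_compose2[OF cont_Fx, of S "\<lambda>s. (a s, b s, c s)"] by (simp add: continuous_on_Pair)

lemma continuous_on_field:
  "continuous_on S a \<Longrightarrow> continuous_on S b \<Longrightarrow> continuous_on S c \<Longrightarrow> continuous_on S (\<lambda>s. field (a s) (b s) (c s))"
  unfolding field_def adjoint_blinfun_eq_sum
  by (intro continuous_intros continuous_on_f continuous_on_Fx)

lemma hamiltonian_field_eq: "hamiltonian_field f w t z = field t z (w t (fst z) (snd z))"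
proof -
  obtain x \<nu> where z: "z = (x, \<nu>)" by (cases z)
  let ?u = "w t x \<nu>"
  have "GDERIV (\<lambda>\<eta>. S_fun f \<eta> t x ?u) \<nu> :> f t x ?u"
    unfolding gderiv_def S_fun_def by (auto intro!: derivative_eq_intros)
  moreover have "GDERIV (\<lambda>y. S_fun f \<nu> t y ?u) x :> adjoint (blinfun_apply (Fx t x ?u)) \<nu>"
  proof -
    have "((\<lambda>y. \<nu> \<bullet> f t y ?u) has_derivative (\<lambda>h. \<nu> \<bullet> Fx t x ?u h)) (at x)"
      by (rule has_derivative_inner_right[OF deriv_f])
    moreover have "\<nu> \<bullet> Fx t x ?u h = h \<bullet> adjoint (blinfun_apply (Fx t x ?u)) \<nu>" for h
      by (subst adjoint_works) (auto simp: linear_blinfun_apply inner_commute)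
    ultimately show ?thesis by (simp add: gderiv_def S_fun_def)
  qed
  ultimately show ?thesis
    by (simp add: hamiltonian_field_def z field_def gradient_eq)
qed

lemma minimizing_control_optimal:
  assumes "minimizing_control f \<Omega> w"
  shows "w t x \<nu> \<in> \<Omega>" "v \<in> \<Omega> \<Longrightarrow> \<nu> \<bullet> f t x (w t x \<nu>) \<le> \<nu> \<bullet> f t x v"
  using assms unfolding minimizing_control_def is_arg_min_def S_fun_def by (auto simp: not_less)

text \<open>With \<open>t\<close> frozen, \<open>field\<close> is the symplectic rotation
  \<open>J\<close> of the gradient of \<open>S\<close> in the pair of state and adjoint. As
  \<open>J\<close> is linear, it carries the conclusion of \<open>envelope_gradient_in_hull\<close>
  over to the Hamiltonian field.\<close>

lemma field_in_filippov_set: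
  assumes w: "minimizing_control f \<Omega> w" and u: "u \<in> optimal t z"
  shows "field t z u \<in> filippov_set (hamiltonian_field f w) t z"
proof -
  define S where "S z u = snd z \<bullet> f t (fst z) u" for z :: "'a \<times> 'a" and u
  define g where "g z u = (adjoint (blinfun_apply (Fx t (fst z) u)) (snd z), f t (fst z) u)" for z :: "'a \<times> 'a" and u
  define J where "J z = (snd z, - fst z)" for z :: "'a \<times> 'a"
  have J: "bounded_linear J"
    unfolding J_def by (intro bounded_linear_Pair bounded_linear_minus bounded_linear_fst bounded_linear_snd)
  have Jg: "J (g z u) = field t z u" for z u
    by (simp add: J_def g_def field_def)
  have cont_g: "continuous_on UNIV (\<lambda>(z, u). g z u)"
    unfolding g_def case_prod_beta adjoint_blinfun_eq_sum
    by (intro continuous_intros continuous_on_f continuous_on_Fx)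
  have grad: "GDERIV (\<lambda>z. S z u) z :> g z u" for z u
  proof -
    have "((\<lambda>y. f t (fst y) u) has_derivative (\<lambda>h. Fx t (fst z) u (fst h))) (at z)"
      by (rule has_derivative_compose[OF has_derivative_fst[OF has_derivative_ident] deriv_f])
    then have "((\<lambda>y. snd y \<bullet> f t (fst y) u) has_derivative
        (\<lambda>h. snd z \<bullet> Fx t (fst z) u (fst h) + snd h \<bullet> f t (fst z) u)) (at z)"
      by (intro has_derivative_inner has_derivative_snd has_derivative_ident)
    moreover have "snd z \<bullet> Fx t (fst z) u (fst h) + snd h \<bullet> f t (fst z) u = h \<bullet> g z u" for h
    proof -
      have "fst h \<bullet> adjoint (blinfun_apply (Fx t (fst z) u)) (snd z) = Fx t (fst z) u (fst h) \<bullet> snd z"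
        by (rule adjoint_works) (rule linear_blinfun_apply)
      then show ?thesis by (simp add: g_def inner_prod_def inner_commute)
    qed
    ultimately show ?thesis by (simp add: gderiv_def S_def)
  qed
  have "continuous_on \<Omega> (g z)"
    using continuous_on_compose2[OF cont_g, of \<Omega> "\<lambda>u. (z, u)"] by (simp add: continuous_intros)
  then have "compact (g z ` \<Omega>)"
    using compact_\<Omega> by (rule compact_continuous_image)
  then obtain B where B: "\<And>u. u \<in> \<Omega> \<Longrightarrow> norm (g z u) \<le> B"
    using compact_imp_bounded by (metis bounded_iff imageI)
  have "field t z u \<in> closure (convex hull (hamiltonian_field f w t ` (ball z r - N)))"
    if "r > 0" "negligible N" for r N
  proof -
    let ?X = "(\<lambda>z'. g z' (w t (fst z') (snd z'))) ` (ball z r - N)"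
    have "g z u \<in> closure (convex hull ?X)"
      by (rule envelope_gradient_in_hull[where S = S and \<Omega> = \<Omega> and B = B])
        (use that u w B grad continuous_uniform_in_parameter[OF cont_g compact_\<Omega>] minimizing_control_optimal[OF w]
          in \<open>auto simp: S_def minimizers_def\<close>)
    then have "J (g z u) \<in> closure (J ` (convex hull ?X))"
      using closure_bounded_linear_image_subset[OF J] by blast
    also have "J ` (convex hull ?X) = convex hull (J ` ?X)"
      by (rule convex_hull_linear_image) (simp add: J bounded_linear.linear)
    also have "J ` ?X = hamiltonian_field f w t ` (ball z r - N)"
      by (simp add: image_image Jg hamiltonian_field_eq)
    finally show ?thesis by (simp add: Jg)
  qed
  then show ?thesis by (auto simp: filippov_set_def)
qed

text \<open>The empty set is one of the null sets in the regularization, and near \<open>x\<close>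
  the velocities of the closed loop differ little, uniformly in the control, from elements of
  \<open>f t x\<close> with the same control. So \<open>v\<close> is arbitrarily close to the hull
  at \<open>x\<close>, which is compact.\<close>

lemma filippov_set_feedback:
  assumes u: "\<And>t x. u t x \<in> \<Omega>" and v: "v \<in> filippov_set (\<lambda>t x. f t x (u t x)) t x"
  shows "v \<in> convex hull (f t x ` \<Omega>)"
proof -
  let ?K = "convex hull (f t x ` \<Omega>)"
  have "compact (f t x ` \<Omega>)"
    by (intro compact_continuous_image continuous_on_f compact_\<Omega> continuous_intros)
  then have K: "closed ?K" using compact_convex_hull compact_imp_closed by blast
  have "\<exists>y\<in>?K. dist y v < e" if e: "e > 0" for e
  proof -
    have "continuous_on UNIV (\<lambda>(y, u). f t y u)"
      unfolding case_prod_beta by (intro continuous_on_f continuous_intros)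
    then obtain \<rho> where \<rho>: "\<rho> > 0" "\<And>y u. y \<in> ball x \<rho> \<Longrightarrow> u \<in> \<Omega> \<Longrightarrow> norm (f t y u - f t x u) \<le> e / 2"
      using continuous_uniform_in_parameter[OF _ compact_\<Omega>, of "f t" "e / 2" x] e by auto
    let ?W = "{a. \<exists>c\<in>?K. norm (a - c) \<le> e / 2}"
    have "(\<lambda>x. f t x (u t x)) ` (ball x \<rho> - {}) \<subseteq> ?W"
      using \<rho>(2) u by (force intro!: hull_inc)
    then have "convex hull ((\<lambda>x. f t x (u t x)) ` (ball x \<rho> - {})) \<subseteq> ?W"
      by (rule hull_minimal) (rule convex_thickening[OF convex_convex_hull])
    then have "closure (convex hull ((\<lambda>x. f t x (u t x)) ` (ball x \<rho> - {}))) \<subseteq> ?W"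
      by (rule closure_minimal) (rule closed_thickening[OF K])
    moreover have "v \<in> closure (convex hull ((\<lambda>x. f t x (u t x)) ` (ball x \<rho> - {})))"
      using v \<rho>(1) unfolding filippov_set_def by blast
    ultimately obtain c where "c \<in> ?K" "norm (v - c) \<le> e / 2" by blast
    then show ?thesis using e by (intro bexI[of _ c]) (auto simp: dist_norm norm_minus_commute)
  qed
  then have "v \<in> closure ?K" by (simp add: closure_approachable)
  then show ?thesis using K by simp
qed

text \<open>Minimizers may jump, but by compactness of \<Omega> controls that are optimal at
  converging arguments have a convergent subsequence, and the minimality inequalities pass to the
  limit. A sequence of counterexamples is refuted this way.\<close>

lemma optimal_upper_semicontinuous:
  assumes e: "e > 0"
  shows "\<exists>\<eta>>0. \<forall>s q u. dist s t < \<eta> \<and> dist (fst q) (fst z) < \<eta> \<and> dist (snd q) (snd z) < \<eta> \<and> u \<in> optimal s q \<longrightarrow>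
    (\<exists>u0\<in>optimal t z. norm (field s q u - field t z u0) < e)"
proof (rule ccontr)
  assume neg: "\<not> ?thesis"
  have "\<exists>s q u. dist s t < inverse (Suc n) \<and> dist (fst q) (fst z) < inverse (Suc n) \<and>
      dist (snd q) (snd z) < inverse (Suc n) \<and> u \<in> optimal s q \<and>
      (\<forall>u0\<in>optimal t z. e \<le> norm (field s q u - field t z u0))" for n :: nat
  proof -
    have "inverse (real (Suc n)) > 0" by simp
    then show ?thesis using neg unfolding not_ex not_all not_le by (metis (no_types, lifting) not_less)
  qed
  then obtain s q u where squ: "\<And>n. dist (s n) t < inverse (Suc n)" "\<And>n. dist (fst (q n)) (fst z) < inverse (Suc n)"
      "\<And>n. dist (snd (q n)) (snd z) < inverse (Suc n)" "\<And>n. u n \<in> optimal (s n) (q n)"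
      "\<And>n u0. u0 \<in> optimal t z \<Longrightarrow> e \<le> norm (field (s n) (q n) (u n) - field t z u0)"
    by metis
  have u\<Omega>: "u n \<in> \<Omega>" and u_min: "\<And>v. v \<in> \<Omega> \<Longrightarrow> snd (q n) \<bullet> f (s n) (fst (q n)) (u n) \<le> snd (q n) \<bullet> f (s n) (fst (q n)) v" for n
    using squ(4)[of n] by (auto simp: minimizers_def)
  have lim0: "a \<longlonglongrightarrow> l" if "\<And>n. dist (a n) l < inverse (Suc n)" for a :: "nat \<Rightarrow> 'd::metric_space" and l
  proof (rule metric_tendsto_imp_tendsto[OF LIMSEQ_inverse_real_of_nat])
    show "\<forall>\<^sub>F n in sequentially. dist (a n) l \<le> dist (inverse (real (Suc n))) 0"
      using that by (intro always_eventually) (simp add: less_imp_le)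
  qed
  obtain u0 \<sigma> where \<sigma>: "u0 \<in> \<Omega>" "strict_mono (\<sigma> :: nat \<Rightarrow> nat)" "(u \<circ> \<sigma>) \<longlonglongrightarrow> u0"
    using compact_\<Omega> u\<Omega> unfolding compact_def by metis
  have s: "(\<lambda>n. s (\<sigma> n)) \<longlonglongrightarrow> t" 
    using LIMSEQ_subseq_LIMSEQ[OF lim0[of s] \<sigma>(2)] squ(1) by (simp add: o_def)
  have q1: "(\<lambda>n. fst (q (\<sigma> n))) \<longlonglongrightarrow> fst z" 
    using LIMSEQ_subseq_LIMSEQ[OF lim0[of "\<lambda>n. fst (q n)"] \<sigma>(2)] squ(2) by (simp add: o_def)
  have q2: "(\<lambda>n. snd (q (\<sigma> n))) \<longlonglongrightarrow> snd z" 
    using LIMSEQ_subseq_LIMSEQ[OF lim0[of "\<lambda>n. snd (q n)"] \<sigma>(2)] squ(3) by (simp add: o_def)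
  have q: "(\<lambda>n. q (\<sigma> n)) \<longlonglongrightarrow> z"
    using tendsto_Pair[OF q1 q2] by simp
  have uu: "(\<lambda>n. u (\<sigma> n)) \<longlonglongrightarrow> u0" using \<sigma>(3) by (simp add: o_def)
  have lim_f: "(\<lambda>n. f (s (\<sigma> n)) (fst (q (\<sigma> n))) (c n)) \<longlonglongrightarrow> f t (fst z) l" if "c \<longlonglongrightarrow> l" for c l
    using continuous_on_tendsto_compose[OF cont_f tendsto_Pair[OF s tendsto_Pair[OF q1 that]]] by simp
  have "u0 \<in> optimal t z"
    unfolding minimizers_def
  proof (intro CollectI conjI ballI)
    fix v assume "v \<in> \<Omega>"
    show "snd z \<bullet> f t (fst z) u0 \<le> snd z \<bullet> f t (fst z) v"
    proof (rule LIMSEQ_le)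
      show "(\<lambda>n. snd (q (\<sigma> n)) \<bullet> f (s (\<sigma> n)) (fst (q (\<sigma> n))) (u (\<sigma> n))) \<longlonglongrightarrow> snd z \<bullet> f t (fst z) u0"
        by (intro tendsto_inner q2 lim_f uu)
      show "(\<lambda>n. snd (q (\<sigma> n)) \<bullet> f (s (\<sigma> n)) (fst (q (\<sigma> n))) v) \<longlonglongrightarrow> snd z \<bullet> f t (fst z) v"
        by (intro tendsto_inner q2 lim_f tendsto_const)
      show "\<exists>N. \<forall>n\<ge>N. snd (q (\<sigma> n)) \<bullet> f (s (\<sigma> n)) (fst (q (\<sigma> n))) (u (\<sigma> n)) \<le> snd (q (\<sigma> n)) \<bullet> f (s (\<sigma> n)) (fst (q (\<sigma> n))) v"
        using u_min \<open>v \<in> \<Omega>\<close> by blast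
    qed
  qed (rule \<sigma>(1))
  have "continuous_on UNIV (\<lambda>(t, z, u). field t z u)"
    unfolding case_prod_beta by (intro continuous_on_field continuous_intros)
  then have "(\<lambda>n. field (s (\<sigma> n)) (q (\<sigma> n)) (u (\<sigma> n))) \<longlonglongrightarrow> field t z u0"
    using continuous_on_tendsto_compose[OF _ tendsto_Pair[OF s tendsto_Pair[OF q uu]], of UNIV "\<lambda>(t, z, u). field t z u"] by simp
  then have "\<forall>\<^sub>F n in sequentially. norm (field (s (\<sigma> n)) (q (\<sigma> n)) (u (\<sigma> n)) - field t z u0) < e"
    using e by (simp add: tendsto_iff dist_norm)
  then obtain n where "norm (field (s (\<sigma> n)) (q (\<sigma> n)) (u (\<sigma> n)) - field t z u0) < e"
    using eventually_happens' sequentially_bot by blast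
  then show False using squ(5)[OF \<open>u0 \<in> optimal t z\<close>, of "\<sigma> n"] by simp
qed

lemma reach_bounded:
  assumes T: "t0 < T"
  obtains R where "\<And>N i x. N > 0 \<Longrightarrow> i \<le> N \<Longrightarrow>
    x \<in> reach ((T - t0) / real N) (\<lambda>i. f (t0 + real i * ((T - t0) / real N))) \<Omega> x0 i \<Longrightarrow> norm x \<le> R"
proof -
  have "compact ((\<lambda>(t, u). f t 0 u) ` ({t0..T} \<times> \<Omega>))"
    unfolding case_prod_beta
    by (intro compact_continuous_image continuous_on_f compact_Times compact_\<Omega> continuous_intros compact_Icc)
  then obtain M where "\<forall>v\<in>(\<lambda>(t, u). f t 0 u) ` ({t0..T} \<times> \<Omega>). norm v \<le> M"
    using compact_imp_bounded bounded_iff by blast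
  then have M: "norm (f t 0 u) \<le> M" if "t \<in> {t0..T}" "u \<in> \<Omega>" for t u
    using that by force
  \<comment> \<open>Adding \<open>M / Q\<close> turns the affine recursion
    \<open>norm x \<le> (1 + Q * h) * norm y + h * M\<close> into a geometric one.\<close>
  define a where "a = norm x0 + M / Q"
  obtain u0 where "u0 \<in> \<Omega>" using nonempty_\<Omega> by blast
  then have M0: "0 \<le> M" using order_trans[OF norm_ge_zero M[of t0 u0]] T by simp
  have a0: "a \<ge> 0" using M0 Q_pos by (simp add: a_def)
  have "norm x \<le> exp (Q * (T - t0)) * a"
    if N: "N > 0" and i: "i \<le> N"
      and x: "x \<in> reach ((T - t0) / real N) (\<lambda>i. f (t0 + real i * ((T - t0) / real N))) \<Omega> x0 i" for N i x
  proof -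
    define h where "h = (T - t0) / real N"
    have h: "h > 0" "real N * h = T - t0" using N T by (auto simp: h_def)
    have ih: "real j * h \<le> T - t0" if "j \<le> N" for j
      using that h mult_right_mono[of "real j" "real N" h] by simp
    have "norm x + M / Q \<le> (1 + Q * h) ^ i * a"
      using i x unfolding h_def[symmetric]
    proof (induction i arbitrary: x)
      case 0
      then show ?case by (simp add: a_def)
    next
      case (Suc i)
      then obtain y v where y: "y \<in> reach h (\<lambda>i. f (t0 + real i * h)) \<Omega> x0 i"
        "v \<in> convex hull (f (t0 + real i * h) y ` \<Omega>)" "x = y + h *\<^sub>R v" by auto
      have t: "t0 + real i * h \<in> {t0..T}" using ih[of i] Suc.prems h(1) by auto
      have "norm v \<le> M + Q * norm y"
      proof (rule norm_convex_hull_image_le[OF y(2)])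
        fix u assume "u \<in> \<Omega>"
        then show "norm (f (t0 + real i * h) y u) \<le> M + Q * norm y"
          using growth[of u "t0 + real i * h" y] M[OF t, of u] by linarith
      qed
      then have "h * norm v \<le> h * (M + Q * norm y)" using h by simp
      moreover have "norm x \<le> norm y + h * norm v"
        using norm_triangle_ineq[of y "h *\<^sub>R v"] h y(3) by simp
      ultimately have "norm x + M / Q \<le> norm y + h * (M + Q * norm y) + M / Q" by linarith
      also have "\<dots> = (1 + Q * h) * (norm y + M / Q)"
        using Q_pos by (simp add: field_simps)
      also have "\<dots> \<le> (1 + Q * h) * ((1 + Q * h) ^ i * a)"
        using Suc.IH[OF _ y(1)] Suc.prems Q_pos h by (intro mult_left_mono) auto
      finally show ?case by simp
    qed
    also have "\<dots> \<le> exp (Q * (T - t0)) * a"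
      using a0 Q_pos h ih[OF i] by (intro mult_right_mono power_le_exp_bound) auto
    finally show ?thesis using M0 Q_pos by (simp add: add_increasing2 order_trans[rotated])
  qed
  then show ?thesis by (rule that)
qed

lemma compact_bounds:
  obtains L where "L > 0" "\<And>t x u. t \<in> {t0..T} \<Longrightarrow> norm x \<le> R \<Longrightarrow> u \<in> \<Omega> \<Longrightarrow> norm (Fx t x u) \<le> L"
    "\<And>t x u. t \<in> {t0..T} \<Longrightarrow> norm x \<le> R \<Longrightarrow> u \<in> \<Omega> \<Longrightarrow> norm (f t x u) \<le> L"
    "\<And>t x y u. t \<in> {t0..T} \<Longrightarrow> norm x \<le> R \<Longrightarrow> norm y \<le> R \<Longrightarrow> u \<in> \<Omega> \<Longrightarrow> norm (f t x u - f t y u) \<le> L * norm (x - y)"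
proof -
  let ?K = "{t0..T} \<times> cball (0::'a) R \<times> \<Omega>"
  have "compact ((\<lambda>(t, x, u). Fx t x u) ` ?K)" "compact ((\<lambda>(t, x, u). f t x u) ` ?K)"
    unfolding case_prod_beta
    by (intro compact_continuous_image continuous_on_f continuous_on_Fx compact_Times compact_\<Omega> continuous_intros compact_Icc compact_cball)+
  then obtain L1 L2 where L1: "\<forall>v\<in>(\<lambda>(t, x, u). Fx t x u) ` ?K. norm v \<le> L1"
    and L2: "\<forall>v\<in>(\<lambda>(t, x, u). f t x u) ` ?K. norm v \<le> L2"
    using compact_imp_bounded bounded_iff by meson
  define L where "L = max 1 (max L1 L2)"
  have A: "norm (Fx t x u) \<le> L" and B: "norm (f t x u) \<le> L" if "t \<in> {t0..T}" "norm x \<le> R" "u \<in> \<Omega>" for t x u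
  proof -
    have k: "(t, x, u) \<in> ?K" using that by auto
    show "norm (Fx t x u) \<le> L" "norm (f t x u) \<le> L"
      using bspec[OF L1 imageI[OF k]] bspec[OF L2 imageI[OF k]] by (auto simp: L_def)
  qed
  show ?thesis
  proof (rule that[of L])
    show "norm (f t x u - f t y u) \<le> L * norm (x - y)"
      if "t \<in> {t0..T}" "norm x \<le> R" "norm y \<le> R" "u \<in> \<Omega>" for t x y u
    proof (rule differentiable_bound[where S = "cball 0 R" and f' = "\<lambda>x. blinfun_apply (Fx t x u)"])
      show "onorm (blinfun_apply (Fx t x u)) \<le> L" if "x \<in> cball 0 R" for x
        using A[of t x u] that \<open>t \<in> {t0..T}\<close> \<open>u \<in> \<Omega>\<close> by (simp add: norm_blinfun.rep_eq)
      show "((\<lambda>y. f t y u) has_derivative blinfun_apply (Fx t x u)) (at x within cball 0 R)" for x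
        by (rule has_derivative_at_withinI[OF deriv_f])
    qed (use that in auto)
  qed (use A B in \<open>auto simp: L_def\<close>)
qed

text \<open>The mean velocity of \<open>y\<close> over a step is within \<omega> of the relaxed
  velocities at the start of the step, and the Lipschitz bound transfers it from \<open>y\<close> to
  the Euler state. The error is multiplied by at most \<open>1 + L * h\<close> and increased by
  \<open>h * \<omega>\<close> in each step; the closed form in the induction solves this
  recursion.\<close>

lemma reach_tracks_relaxed_solution:
  assumes T: "t0 < T" and ac: "abs_continuous_on {t0..T} y" and y0: "y t0 = x0" and N: "negligible \<N>"
    and der: "\<And>t. t \<in> {t0..T} - \<N> \<Longrightarrow>
      \<exists>v\<in>convex hull (f t (y t) ` \<Omega>). (y has_vector_derivative v) (at t within {t0..T})"
    and \<epsilon>: "\<epsilon> > 0"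
  shows "\<exists>N0. \<forall>N\<ge>N0. N > 0 \<longrightarrow>
    (\<exists>x\<in>reach ((T - t0) / real N) (\<lambda>i. f (t0 + real i * ((T - t0) / real N))) \<Omega> x0 N. norm (x - y T) \<le> \<epsilon>)"
proof -
  have cy: "continuous_on {t0..T} y" using ac by (rule abs_continuous_on_imp_continuous_on)
  then have "bounded (y ` {t0..T})"
    by (intro compact_imp_bounded compact_continuous_image compact_Icc)
  then obtain R1 where R1: "\<And>t. t \<in> {t0..T} \<Longrightarrow> norm (y t) \<le> R1"
    by (metis bounded_iff imageI)
  obtain R2 where R2: "\<And>N i x. N > 0 \<Longrightarrow> i \<le> N \<Longrightarrow>
    x \<in> reach ((T - t0) / real N) (\<lambda>i. f (t0 + real i * ((T - t0) / real N))) \<Omega> x0 i \<Longrightarrow> norm x \<le> R2"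
    using reach_bounded[OF T] by blast
  define R where "R = max R1 R2"
  obtain L where L: "L > 0" "\<And>t x y u. t \<in> {t0..T} \<Longrightarrow> norm x \<le> R \<Longrightarrow> norm y \<le> R \<Longrightarrow> u \<in> \<Omega> \<Longrightarrow>
      norm (f t x u - f t y u) \<le> L * norm (x - y)"
    using compact_bounds[of t0 T R] by metis
  \<comment> \<open>Chosen so that the final bound
    \<open>exp (L * (T - t0)) * (\<omega> / L)\<close> equals \<epsilon>.\<close>
  define \<omega> where "\<omega> = \<epsilon> * L / exp (L * (T - t0))"
  have \<omega>: "\<omega> > 0" using \<epsilon> L by (simp add: \<omega>_def)
  have "continuous_on ({t0..T} \<times> \<Omega>) (\<lambda>p. f (fst p) (y (fst p)) (snd p))"
    by (intro continuous_on_f continuous_intros continuous_on_compose2[OF cy]) auto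
  then have "uniformly_continuous_on ({t0..T} \<times> \<Omega>) (\<lambda>p. f (fst p) (y (fst p)) (snd p))"
    by (intro compact_uniformly_continuous compact_Times compact_\<Omega> compact_Icc)
  then obtain d where d: "d > 0" "\<And>p q. p \<in> {t0..T} \<times> \<Omega> \<Longrightarrow> q \<in> {t0..T} \<times> \<Omega> \<Longrightarrow> dist q p < d \<Longrightarrow>
      dist (f (fst q) (y (fst q)) (snd q)) (f (fst p) (y (fst p)) (snd p)) < \<omega>"
    using \<omega> unfolding uniformly_continuous_on_def by metis
  have osc: "norm (f s (y s) u - f t (y t) u) \<le> \<omega>"
    if "s \<in> {t0..T}" "t \<in> {t0..T}" "\<bar>s - t\<bar> < d" "u \<in> \<Omega>" for s t u
    using d(2)[of "(t, u)" "(s, u)"] that by (auto simp: dist_norm dist_Pair_Pair dist_real_def)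
  \<comment> \<open>From \<open>N0\<close> steps on, the step length is below the modulus
    \<open>d\<close>.\<close>
  obtain N0 :: nat where N0: "(T - t0) / d < real N0" using reals_Archimedean2 by blast
  have "\<exists>x\<in>reach ((T - t0) / real N) (\<lambda>i. f (t0 + real i * ((T - t0) / real N))) \<Omega> x0 N. norm (x - y T) \<le> \<epsilon>"
    if N: "N \<ge> N0" "N > 0" for N
  proof -
    define h where "h = (T - t0) / real N"
    have h: "h > 0" "real N * h = T - t0" using N T by (auto simp: h_def)
    have "(T - t0) / d < real N" using N0 N(1) by linarith
    then have hd: "h < d" using d(1) N(2) by (simp add: h_def field_simps)
    have ih: "t0 + real j * h \<in> {t0..T}" if "j \<le> N" for j
      using that h mult_right_mono[of "real j" "real N" h] by simp
    have reach_R: "norm x \<le> R" if "i \<le> N" "x \<in> reach h (\<lambda>i. f (t0 + real i * h)) \<Omega> x0 i" for i x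
      using R2[OF N(2) that(1)] that(2) unfolding h_def R_def by fastforce
    have "\<exists>x\<in>reach h (\<lambda>i. f (t0 + real i * h)) \<Omega> x0 i. norm (x - y (t0 + real i * h)) \<le> ((1 + L * h) ^ i - 1) * (\<omega> / L)"
      if "i \<le> N" for i
      using that
    proof (induction i)
      case 0
      then show ?case using y0 by simp
    next
      case (Suc i)
      define s where "s = t0 + real i * h"
      have s': "t0 + real (Suc i) * h = s + h" by (simp add: s_def algebra_simps)
      have s: "s \<in> {t0..T}" "s + h \<in> {t0..T}"
        using ih[of i] ih[of "Suc i"] Suc.prems unfolding s'[symmetric] by (auto simp: s_def)
      obtain x where x: "x \<in> reach h (\<lambda>i. f (t0 + real i * h)) \<Omega> x0 i"
        "norm (x - y s) \<le> ((1 + L * h) ^ i - 1) * (\<omega> / L)"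
        using Suc unfolding s_def by auto
      let ?K = "convex hull (f s (y s) ` \<Omega>)"
      let ?W = "{a. \<exists>c\<in>?K. norm (a - c) \<le> \<omega>}"
      have "compact (f s (y s) ` \<Omega>)"
        by (intro compact_continuous_image continuous_on_f compact_\<Omega> continuous_intros)
      then have "closed ?K" using compact_convex_hull compact_imp_closed by blast
      define a where "a = (1 / h) *\<^sub>R (y (s + h) - y s)"
      \<comment> \<open>Velocities at other times of the step lie only near the hull at
        \<open>s\<close>; its thickening by \<omega> is the closed convex set that contains them
        all.\<close>
      have "(1 / ((s + h) - s)) *\<^sub>R (y (s + h) - y s) \<in> ?W"
      proof (rule abs_continuous_mean_value_in[OF _ _ closed_thickening[OF \<open>closed ?K\<close>] convex_thickening[OF convex_convex_hull] \<open>negligible \<N>\<close>])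
        have sub: "{s..s + h} \<subseteq> {t0..T}" using s by auto
        show "abs_continuous_on {s..s + h} y" using ac sub by (rule abs_continuous_on_subset)
        fix t assume t: "t \<in> {s..s + h} - \<N>"
        then obtain v where v: "v \<in> convex hull (f t (y t) ` \<Omega>)" "(y has_vector_derivative v) (at t within {t0..T})"
          using der[of t] sub by blast
        have "\<exists>c\<in>?K. norm (v - c) \<le> \<omega>"
          using v(1) by (rule convex_hull_image_near[rotated]) (use osc s t hd sub in auto)
        then show "\<exists>v\<in>?W. (y has_vector_derivative v) (at t within {s..s + h})"
          using has_vector_derivative_within_subset[OF v(2) sub] by blast
      qed (use h in auto)
      then obtain c where c: "c \<in> ?K" "norm (a - c) \<le> \<omega>" by (auto simp: a_def)
      have "norm (y s) \<le> R" "norm x \<le> R"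
        using R1[OF s(1)] reach_R[of i x] x(1) Suc.prems by (auto simp: R_def)
      then obtain w where w: "w \<in> convex hull (f s x ` \<Omega>)" "norm (c - w) \<le> L * norm (y s - x)"
        using convex_hull_image_near[OF _ c(1), of "f s x" "L * norm (y s - x)"] L(2)[OF s(1)] by blast
      have "x + h *\<^sub>R w \<in> reach h (\<lambda>i. f (t0 + real i * h)) \<Omega> x0 (Suc i)"
        using x(1) w(1) by (auto simp: s_def)
      moreover have "norm (x + h *\<^sub>R w - y (s + h)) \<le> ((1 + L * h) ^ Suc i - 1) * (\<omega> / L)"
      proof -
        have "y (s + h) = y s + h *\<^sub>R a" using h by (simp add: a_def)
        then have "x + h *\<^sub>R w - y (s + h) = (x - y s) - h *\<^sub>R ((a - c) + (c - w))"
          by (simp add: algebra_simps)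
        then have "norm (x + h *\<^sub>R w - y (s + h)) \<le> norm (x - y s) + h * norm ((a - c) + (c - w))"
          using norm_triangle_ineq4[of "x - y s" "h *\<^sub>R ((a - c) + (c - w))"] h
          by (simp only: norm_scaleR abs_of_pos)
        also have "\<dots> \<le> norm (x - y s) + h * (\<omega> + L * norm (x - y s))"
          using norm_triangle_ineq[of "a - c" "c - w"] c(2) w(2) h
          by (intro add_left_mono mult_left_mono) (auto simp: norm_minus_commute)
        also have "\<dots> = (1 + L * h) * norm (x - y s) + h * \<omega>"
          by (simp add: algebra_simps)
        also have "\<dots> \<le> (1 + L * h) * (((1 + L * h) ^ i - 1) * (\<omega> / L)) + h * \<omega>"
          using x(2) h L by (intro add_right_mono mult_left_mono) auto
        also have "\<dots> = ((1 + L * h) ^ Suc i - 1) * (\<omega> / L)"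
          using L(1) by (simp add: field_simps)
        finally show ?thesis .
      qed
      ultimately show ?case unfolding s' by blast
    qed
    from this[of N] obtain x where x: "x \<in> reach h (\<lambda>i. f (t0 + real i * h)) \<Omega> x0 N"
      "norm (x - y (t0 + real N * h)) \<le> ((1 + L * h) ^ N - 1) * (\<omega> / L)" by auto
    note x(2)
    also have "((1 + L * h) ^ N - 1) * (\<omega> / L) \<le> exp (L * (T - t0)) * (\<omega> / L)"
      using power_le_exp_bound[of L h N "T - t0"] L h \<omega> by (intro mult_right_mono) auto
    also have "\<dots> = \<epsilon>" using L by (simp add: \<omega>_def)
    finally show ?thesis using x(1) h(2) unfolding h_def by (intro bexI[of _ x]) auto
  qed
  then show ?thesis by blast
qed

lemma discrete_adjoint_bound:
  assumes h: "h \<ge> 0" and L: "L \<ge> 0" and i: "i \<le> N"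
    and step: "\<And>i. i < N \<Longrightarrow> norm (V i) \<le> (1 + L * h) * norm (V (Suc i))"
  shows "norm (V i :: 'a) \<le> (1 + L * h) ^ (N - i) * norm (V N)"
  using i
proof (induction i rule: inc_induct)
  case (step i)
  have "norm (V i) \<le> (1 + L * h) * norm (V (Suc i))" using assms(4) step by simp
  also have "\<dots> \<le> (1 + L * h) * ((1 + L * h) ^ (N - Suc i) * norm (V N))"
    using step h L by (intro mult_left_mono) auto
  also have "\<dots> = (1 + L * h) ^ (N - i) * norm (V N)"
    using step by (simp add: Suc_diff_Suc flip: power_Suc mult.assoc)
  finally show ?case .
qed simp

text \<open>The last clause expresses membership in the closed convex hull of the optimal fields in
  the form in which it is used: \<open>C\<close> becomes the Filippov set of the Hamiltonian field
  of an arbitrary selection, none of which occurs here.\<close>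

lemma relaxed_extremal_exists:
  assumes T: "t0 < T" and ac: "abs_continuous_on {t0..T} y" and y0: "y t0 = x0" and \<N>: "negligible \<N>"
    and der: "\<And>t. t \<in> {t0..T} - \<N> \<Longrightarrow>
      \<exists>v\<in>convex hull (f t (y t) ` \<Omega>). (y has_vector_derivative v) (at t within {t0..T})"
    and \<delta>: "norm (y T) < \<delta>"
  shows "\<exists>z B N. B-lipschitz_on {t0..T} z \<and> fst (z t0) = x0 \<and> snd (z T) = fst (z T) \<and>
    norm (fst (z T)) \<le> \<delta> \<and> negligible N \<and>
    (\<forall>t\<in>{t0..T} - N. \<exists>v. (z has_vector_derivative v) (at t within {t0..T}) \<and>
      (\<forall>C. closed C \<longrightarrow> convex C \<longrightarrow> field t (z t) ` optimal t (z t) \<subseteq> C \<longrightarrow> v \<in> C))"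
proof -

  \<comment> \<open>Discrete extremals on uniform grids\<close>
  define h where "h n = (T - t0) / real (Suc n)" for n
  have h: "h n > 0" "real (Suc n) * h n = T - t0" for n using T by (auto simp: h_def)
  define tt where "tt n i = t0 + real i * h n" for n i
  have tt: "tt n i \<in> {t0..T}" if "i \<le> Suc n" for n i
  proof -
    have "real i * h n \<le> real (Suc n) * h n" using that h(1)[of n] by (intro mult_right_mono) auto
    also have "\<dots> = T - t0" by (rule h(2))
    finally show ?thesis using h(1)[of n] by (simp add: tt_def)
  qed
  have tt_end: "tt n 0 = t0" "tt n (Suc n) = T" for n using h(2)[of n] by (simp_all add: tt_def)
  let ?reach = "\<lambda>n. reach (h n) (\<lambda>i. f (tt n i)) \<Omega> x0"
  define extremal where "extremal n x \<nu> \<longleftrightarrow> x 0 = x0 \<and> \<nu> (Suc n) = x (Suc n) \<and> (\<forall>i\<le>Suc n. x i \<in> ?reach n i) \<and>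
    (\<forall>y\<in>?reach n (Suc n). norm (x (Suc n)) \<le> norm y) \<and>
    (\<forall>i<Suc n. ((1 / h n) *\<^sub>R (x (Suc i) - x i), (1 / h n) *\<^sub>R (\<nu> (Suc i) - \<nu> i)) \<in>
       convex hull ((\<lambda>u. (f (tt n i) (x i) u, - adjoint (blinfun_apply (Fx (tt n i) (x i) u)) (\<nu> (Suc i)))) `
         minimizers (f (tt n i) (x i)) \<Omega> (\<nu> (Suc i))))" for n x \<nu>
  have "\<exists>x \<nu>. extremal n x \<nu>" for n
    unfolding extremal_def
  proof (rule discrete_maximum_principle[OF h(1) compact_\<Omega> nonempty_\<Omega>, where F = "\<lambda>i. f (tt n i)"
        and F' = "\<lambda>i x u. blinfun_apply (Fx (tt n i) x u)"])
    show "continuous_on (UNIV \<times> \<Omega>) (\<lambda>(x, u). f (tt n i) x u)" for i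
      unfolding case_prod_beta by (intro continuous_on_f continuous_intros)
  qed (rule deriv_f)
  then obtain X V where "\<And>n. extremal n (X n) (V n)"
    by metis
  then have X0: "\<And>n. X n 0 = x0" and VN: "\<And>n. V n (Suc n) = X n (Suc n)"
    and Xreach: "\<And>n i. i \<le> Suc n \<Longrightarrow> X n i \<in> ?reach n i"
    and Xmin: "\<And>n y. y \<in> ?reach n (Suc n) \<Longrightarrow> norm (X n (Suc n)) \<le> norm y"
    and XV: "\<And>n i. i < Suc n \<Longrightarrow> ((1 / h n) *\<^sub>R (X n (Suc i) - X n i), (1 / h n) *\<^sub>R (V n (Suc i) - V n i)) \<in>
       convex hull ((\<lambda>u. (f (tt n i) (X n i) u, - adjoint (blinfun_apply (Fx (tt n i) (X n i) u)) (V n (Suc i)))) `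
         minimizers (f (tt n i) (X n i)) \<Omega> (V n (Suc i)))"
    unfolding extremal_def by blast+
  \<comment> \<open>The inclusion combines the state at \<open>i\<close> with the adjoint at
    \<open>Suc i\<close>. The mismatch disappears in the limit, because neighbouring nodes of the
    interpolation merge as the steps shrink.\<close>
  define vel where "vel n i = (1 / h n) *\<^sub>R ((X n (Suc i), V n (Suc i)) - (X n i, V n i))" for n i
  have vel: "vel n i \<in> convex hull (field (tt n i) (X n i, V n (Suc i)) ` optimal (tt n i) (X n i, V n (Suc i)))"
    if "i < Suc n" for n i
    using XV[OF that] by (simp add: vel_def field_def)

  \<comment> \<open>Bounds independent of the number of steps\<close>
  obtain R where R: "\<And>N i x. N > 0 \<Longrightarrow> i \<le> N \<Longrightarrow>
    x \<in> reach ((T - t0) / real N) (\<lambda>i. f (t0 + real i * ((T - t0) / real N))) \<Omega> x0 i \<Longrightarrow> norm x \<le> R"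
    using reach_bounded[OF T] by blast
  have XR: "norm (X n i) \<le> R" if "i \<le> Suc n" for n i
    using R[of "Suc n" i "X n i"] Xreach[OF that] that unfolding h_def tt_def by simp
  obtain L where L: "L > 0" "\<And>t x u. t \<in> {t0..T} \<Longrightarrow> norm x \<le> R \<Longrightarrow> u \<in> \<Omega> \<Longrightarrow> norm (Fx t x u) \<le> L"
    "\<And>t x u. t \<in> {t0..T} \<Longrightarrow> norm x \<le> R \<Longrightarrow> u \<in> \<Omega> \<Longrightarrow> norm (f t x u) \<le> L"
    using compact_bounds[of t0 T R] by metis
  have R0: "R \<ge> 0" using order_trans[OF norm_ge_zero XR[of 0 0]] by simp
  have adj: "norm (adjoint (blinfun_apply (Fx (tt n i) (X n i) u)) (V n (Suc i))) \<le> L * norm (V n (Suc i))"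
    if "i < Suc n" "u \<in> \<Omega>" for n i u
  proof -
    have "norm (Fx (tt n i) (X n i) u) \<le> L" using L(2) tt XR that by simp
    then show ?thesis
      using norm_adjoint_blinfun_le[of "Fx (tt n i) (X n i) u" "V n (Suc i)"]
      by (meson mult_right_mono norm_ge_zero order_trans)
  qed
  define RV where "RV = exp (L * (T - t0)) * R"
  have VR: "norm (V n i) \<le> RV" if "i \<le> Suc n" for n i
  proof -
    have "norm (V n i) \<le> (1 + L * h n) * norm (V n (Suc i))" if i: "i < Suc n" for i
    proof -
      have "norm (snd (vel n i)) \<le> L * norm (V n (Suc i))"
      proof -
        have "snd (vel n i) \<in> snd ` (convex hull (field (tt n i) (X n i, V n (Suc i)) ` optimal (tt n i) (X n i, V n (Suc i))))"
          using vel[OF i] by (rule imageI)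
        also have "\<dots> = convex hull ((\<lambda>u. snd (field (tt n i) (X n i, V n (Suc i)) u)) ` optimal (tt n i) (X n i, V n (Suc i)))"
          by (simp add: convex_hull_linear_image linear_snd image_image)
        finally show ?thesis
          by (rule norm_convex_hull_image_le) (use adj i in \<open>auto simp: field_def minimizers_def\<close>)
      qed
      moreover have "V n i = V n (Suc i) - h n *\<^sub>R snd (vel n i)"
        using h(1)[of n] by (simp add: vel_def)
      then have "norm (V n i) \<le> norm (V n (Suc i)) + h n * norm (snd (vel n i))"
        using norm_triangle_ineq4[of "V n (Suc i)" "h n *\<^sub>R snd (vel n i)"] h(1)[of n] by simp
      ultimately have "norm (V n i) \<le> norm (V n (Suc i)) + h n * (L * norm (V n (Suc i)))"
        using h(1)[of n] mult_left_mono[of "norm (snd (vel n i))" "L * norm (V n (Suc i))" "h n"] by linarith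
      then show ?thesis by (simp add: algebra_simps)
    qed
    then have "norm (V n i) \<le> (1 + L * h n) ^ (Suc n - i) * norm (V n (Suc n))"
      using discrete_adjoint_bound[of "h n" L i "Suc n" "V n"] h(1)[of n] L(1) \<open>i \<le> Suc n\<close> by simp
    also have "\<dots> \<le> exp (L * (T - t0)) * R"
    proof (intro mult_mono power_le_exp_bound)
      have "real (Suc n - i) * h n \<le> real (Suc n) * h n"
        using h(1)[of n] by (intro mult_right_mono) auto
      then show "real (Suc n - i) * h n \<le> T - t0" using h(2) by simp
    qed (use L(1) h(1)[of n] R0 VN XR in auto)
    finally show ?thesis by (simp add: RV_def)
  qed
  have RV0: "RV \<ge> 0" using order_trans[OF norm_ge_zero VR[of 0 0]] by simp
  define B where "B = L + L * RV"
  have B0: "B \<ge> 0" using L RV0 by (simp add: B_def)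
  have velB: "norm (vel n i) \<le> B" if i: "i < Suc n" for n i
  proof (rule norm_convex_hull_image_le[OF vel[OF i]])
    fix u assume "u \<in> optimal (tt n i) (X n i, V n (Suc i))"
    then have u: "u \<in> \<Omega>" by (simp add: minimizers_def)
    have "norm (f (tt n i) (X n i) u) \<le> L" using L(3) tt XR u i by simp
    moreover have "norm (adjoint (blinfun_apply (Fx (tt n i) (X n i) u)) (V n (Suc i))) \<le> L * RV"
      using adj[OF i u] VR[of "Suc i" n] i L(1) by (meson Suc_leI less_imp_le mult_left_mono order_trans)
    ultimately show "norm (field (tt n i) (X n i, V n (Suc i)) u) \<le> B"
      using norm_Pair_le[of "f (tt n i) (X n i) u" "- adjoint (blinfun_apply (Fx (tt n i) (X n i) u)) (V n (Suc i))"]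
      by (simp add: field_def B_def)
  qed

  \<comment> \<open>Interpolation and uniform limit\<close>
  define Z where "Z n = polygon t0 (h n) (Suc n) (X n 0, V n 0) (vel n)" for n
  have node: "Z n (tt n i) = (X n i, V n i)" if "i \<le> Suc n" for n i
  proof -
    have "(\<Sum>j<i. vel n j) = (1 / h n) *\<^sub>R (\<Sum>j<i. (X n (Suc j), V n (Suc j)) - (X n j, V n j))"
      by (simp only: vel_def scaleR_sum_right)
    also have "\<dots> = (1 / h n) *\<^sub>R ((X n i, V n i) - (X n 0, V n 0))"
      using sum_lessThan_telescope[of "\<lambda>j. (X n j, V n j)" i] by simp
    finally show ?thesis
      unfolding Z_def tt_def polygon_node[OF h(1) that] using h(1)[of n] by simp
  qed
  have incr: "(1 / (t - s)) *\<^sub>R (Z n t - Z n s) \<in> C"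
    if "t0 \<le> s" "s < t" "t \<le> T" "convex C"
      "\<And>i. i < Suc n \<Longrightarrow> tt n i < t \<Longrightarrow> s < tt n (Suc i) \<Longrightarrow> vel n i \<in> C" for s t n C
    unfolding Z_def by (rule polygon_increment_in) (use that h(1)[of n] h(2)[of n] in \<open>auto simp: tt_def\<close>)
  have Zlip: "norm (Z n t - Z n s) \<le> B * \<bar>t - s\<bar>" if st: "s \<in> {t0..T}" "t \<in> {t0..T}" for n s t
  proof -
    have *: "norm (Z n t - Z n s) \<le> B * (t - s)" if "t0 \<le> s" "s < t" "t \<le> T" for s t
    proof -
      have "(1 / (t - s)) *\<^sub>R (Z n t - Z n s) \<in> cball 0 B"
        by (rule incr[OF that convex_cball]) (simp add: velB)
      then show ?thesis using that by (simp add: divide_le_eq)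
    qed
    show ?thesis
      using *[of s t] *[of t s] st by (cases s t rule: linorder_cases) (auto simp: norm_minus_commute)
  qed
  have ZM: "norm (Z n t) \<le> norm x0 + RV + B * (T - t0)" if t: "t \<in> {t0..T}" for n t
  proof -
    have "norm (Z n t0) \<le> norm x0 + RV"
      using node[of 0 n] norm_Pair_le[of x0 "V n 0"] VR[of 0 n] by (simp add: tt_end X0)
    moreover have "norm (Z n t - Z n t0) \<le> B * (T - t0)"
      using Zlip[of t0 t n] t T B0 by (smt (verit) atLeastAtMost_iff mult_left_mono)
    ultimately show ?thesis using norm_triangle_ineq[of "Z n t - Z n t0" "Z n t0"] by simp
  qed
  have equicont: "\<exists>d>0. \<forall>n y. y \<in> {t0..T} \<and> norm (x - y) < d \<longrightarrow> norm (Z n x - Z n y) < e"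
    if x: "x \<in> {t0..T}" and e: "0 < e" for x e
  proof (intro exI[of _ "e / (B + 1)"] conjI allI impI)
    fix n y assume y: "y \<in> {t0..T} \<and> norm (x - y) < e / (B + 1)"
    have "norm (Z n x - Z n y) \<le> B * \<bar>x - y\<bar>" using Zlip x y by blast
    also have "\<dots> \<le> (B + 1) * \<bar>x - y\<bar>" by (intro mult_right_mono) auto
    also have "\<dots> < (B + 1) * (e / (B + 1))" using y B0 by (intro mult_strict_left_mono) auto
    also have "\<dots> = e" using B0 by simp
    finally show "norm (Z n x - Z n y) < e" .
  qed (use e B0 in auto)
  have "\<exists>g k. strict_mono (k :: nat \<Rightarrow> nat) \<and>
      (\<forall>e>0. \<exists>N. \<forall>n x. n \<ge> N \<and> x \<in> {t0..T} \<longrightarrow> norm (Z (k n) x - g x) < e)"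
    by (rule Arzela_Ascoli[of "{t0..T}" Z, OF compact_Icc ZM equicont]) blast+
  then obtain g k where k: "strict_mono (k :: nat \<Rightarrow> nat)"
    and conv: "\<And>e. 0 < e \<Longrightarrow> \<exists>N. \<forall>n x. n \<ge> N \<and> x \<in> {t0..T} \<longrightarrow> norm (Z (k n) x - g x) < e"
    by blast
  have lim: "(\<lambda>j. Z (k j) t) \<longlonglongrightarrow> g t" if "t \<in> {t0..T}" for t
    unfolding LIMSEQ_iff using conv that by blast
  have glip: "norm (g t - g s) \<le> B * \<bar>t - s\<bar>" if "s \<in> {t0..T}" "t \<in> {t0..T}" for s t
    by (rule LIMSEQ_le_const2[OF tendsto_norm[OF tendsto_diff[OF lim lim]]]) (use Zlip that in auto)
  have "(\<lambda>j. fst (Z (k j) t0)) \<longlonglongrightarrow> fst (g t0)"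
    by (intro tendsto_fst lim) (use T in auto)
  moreover have "fst (Z (k j) t0) = x0" for j
    using node[of 0 "k j"] by (simp add: tt_end X0)
  ultimately have g_start: "fst (g t0) = x0"
    by (simp add: LIMSEQ_const_iff)
  have Z_end: "Z n T = (X n (Suc n), X n (Suc n))" for n
    using node[of "Suc n" n] by (simp add: tt_end VN)
  have limT: "(\<lambda>j. Z (k j) T) \<longlonglongrightarrow> g T" by (rule lim) (use T in auto)
  have g_diag: "snd (g T) = fst (g T)"
    by (rule LIMSEQ_unique[OF tendsto_snd[OF limT]]) (use tendsto_fst[OF limT] in \<open>simp add: Z_end\<close>)
  \<comment> \<open>Each discrete minimizer is compared with an Euler end state that tracks
    \<open>y T\<close>. The margin \<open>\<delta> - norm (y T)\<close> is the accuracy demanded of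
    the tracking.\<close>
  have g_end: "norm (fst (g T)) \<le> \<delta>"
  proof -
    obtain N0 where N0: "\<And>N. N \<ge> N0 \<Longrightarrow> N > 0 \<Longrightarrow>
      \<exists>x\<in>reach ((T - t0) / real N) (\<lambda>i. f (t0 + real i * ((T - t0) / real N))) \<Omega> x0 N. norm (x - y T) \<le> \<delta> - norm (y T)"
      using reach_tracks_relaxed_solution[OF T ac y0 \<N> der, of "\<delta> - norm (y T)"] \<delta> by auto
    have "norm (fst (Z (k j) T)) \<le> \<delta>" if "j \<ge> N0" for j
    proof -
      have "N0 \<le> Suc (k j)" using seq_suble[OF k, of j] that by linarith
      then obtain x where x: "x \<in> ?reach (k j) (Suc (k j))" "norm (x - y T) \<le> \<delta> - norm (y T)"
        using N0[of "Suc (k j)"] unfolding h_def tt_def by auto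
      then have "norm x \<le> \<delta>" using norm_triangle_ineq[of "x - y T" "y T"] by simp
      then show ?thesis using Xmin[OF x(1)] by (simp add: Z_end)
    qed
    then show ?thesis
      using LIMSEQ_le_const2[OF tendsto_norm[OF tendsto_fst[OF limT]]] by blast
  qed

  \<comment> \<open>Velocity of the limit curve\<close>
  define g' where "g' s = g (max t0 (min T s))" for s
  have g'_eq: "g' s = g s" if "s \<in> {t0..T}" for s
  proof -
    have "max t0 (min T s) = s" using that by auto
    then show ?thesis by (simp add: g'_def)
  qed
  \<comment> \<open>Clamping the time argument preserves the constant and yields a curve on the
    whole line, as \<open>lipschitz_differentiable_ae\<close> asks.\<close>
  have "B-lipschitz_on UNIV g'"
  proof (rule lipschitz_onI)
    fix s t :: real
    have "norm (g' s - g' t) \<le> B * \<bar>max t0 (min T s) - max t0 (min T t)\<bar>"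
      unfolding g'_def by (rule glip) (use T in auto)
    also have "\<dots> \<le> B * \<bar>s - t\<bar>" using B0 by (intro mult_left_mono) auto
    finally show "dist (g' s) (g' t) \<le> B * dist s t" by (simp add: dist_norm)
  qed (rule B0)
  then obtain N1 where N1: "negligible N1" "\<And>t. t \<notin> N1 \<Longrightarrow> g' differentiable (at t)"
    using lipschitz_differentiable_ae by blast
  have "negligible (N1 \<union> {t0, T})"
    using N1(1) by (intro negligible_Un) auto
  moreover have "\<exists>v. (g has_vector_derivative v) (at t within {t0..T}) \<and>
      (\<forall>C. closed C \<longrightarrow> convex C \<longrightarrow> field t (g t) ` optimal t (g t) \<subseteq> C \<longrightarrow> v \<in> C)"
    if t: "t \<in> {t0..T} - (N1 \<union> {t0, T})" for t
  proof -
    have tT: "t0 < t" "t < T" using t by auto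
    obtain v where v: "(g' has_vector_derivative v) (at t)"
      using N1(2)[of t] t by (auto simp: vector_derivative_works)
    have gv: "(g has_vector_derivative v) (at t within {t0..T})"
      by (rule has_vector_derivative_transform[OF _ _ has_vector_derivative_at_within[OF v]]) (use t g'_eq in auto)
    have "v \<in> C" if C: "closed C" "convex C" "field t (g t) ` optimal t (g t) \<subseteq> C" for C
    proof (rule limit_right_derivative_in[OF C(1), where Z = "\<lambda>j. Z (k j)" and g = g and t = t and b = T])
      show "(g has_vector_derivative v) (at t within {t..T})"
        by (rule has_vector_derivative_within_subset[OF gv]) (use tT in auto)
      show "(\<lambda>j. Z (k j) s) \<longlonglongrightarrow> g s" if "t \<le> s" "s < T" for s
        by (rule lim) (use that tT in auto)
      fix e :: real assume e: "e > 0"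
      obtain \<eta>0 where \<eta>0: "\<eta>0 > 0" "\<And>s q u. dist s t < \<eta>0 \<Longrightarrow> dist (fst q) (fst (g t)) < \<eta>0 \<Longrightarrow>
          dist (snd q) (snd (g t)) < \<eta>0 \<Longrightarrow> u \<in> optimal s q \<Longrightarrow>
          \<exists>u0\<in>optimal t (g t). norm (field s q u - field t (g t) u0) < e"
        using optimal_upper_semicontinuous[OF e, of t "g t"] by metis
      \<comment> \<open>Once the steps are shorter than \<eta>, those meeting the interval from
        \<open>t\<close> to \<open>t + \<eta>\<close> have both nodes within
        \<open>2 * \<eta>\<close> of \<open>t\<close>. Over that distance the broken lines move by
        at most \<open>\<eta>0 / 2\<close>, which leaves \<open>\<eta>0 / 2\<close> for their
        distance from \<open>g\<close> at \<open>t\<close>.\<close>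
      define \<eta> where "\<eta> = min (T - t) (\<eta>0 / (4 * (B + 1)))"
      have \<eta>: "\<eta> > 0" "\<eta> \<le> T - t" using \<eta>0(1) tT B0 by (auto simp: \<eta>_def)
      have \<eta>B: "(B + 1) * (4 * \<eta>) \<le> \<eta>0"
      proof -
        have "\<eta> \<le> \<eta>0 / (4 * (B + 1))" by (simp add: \<eta>_def)
        then have "\<eta> * (4 * (B + 1)) \<le> \<eta>0"
          using B0 by (subst (asm) pos_le_divide_eq) auto
        then show ?thesis by (simp add: mult_ac)
      qed
      have B\<eta>: "0 \<le> B * \<eta>" using B0 \<eta> by simp
      have \<eta>small: "2 * \<eta> < \<eta>0" "B * (2 * \<eta>) \<le> \<eta>0 / 2"
        using \<eta>B B\<eta> \<eta>(1) by (simp_all add: algebra_simps)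
      have "\<forall>\<^sub>F j in sequentially. h (k j) < \<eta>"
      proof -
        have "h \<longlonglongrightarrow> 0"
          unfolding h_def using LIMSEQ_Suc[OF lim_const_over_n[of "T - t0"]] by simp
        then have "(\<lambda>j. h (k j)) \<longlonglongrightarrow> 0"
          using LIMSEQ_subseq_LIMSEQ[OF _ k] by (simp add: o_def)
        then show ?thesis using \<eta>(1) by (rule order_tendstoD)
      qed
      moreover have "\<forall>\<^sub>F j in sequentially. norm (Z (k j) t - g t) < \<eta>0 / 2"
        using tendstoD[OF lim[of t], of "\<eta>0 / 2"] tT \<eta>0(1) by (simp add: dist_norm)
      ultimately have ev: "\<forall>\<^sub>F j in sequentially. h (k j) < \<eta> \<and> norm (Z (k j) t - g t) < \<eta>0 / 2"
        by (rule eventually_conj)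
      have "\<exists>c\<in>C. norm ((1 / (s - t)) *\<^sub>R (Z n s - Z n t) - c) \<le> e"
        if s: "t < s" "s < t + \<eta>" and n: "h n < \<eta>" "norm (Z n t - g t) < \<eta>0 / 2" for s n
      proof -
        let ?W = "{a. \<exists>c\<in>C. norm (a - c) \<le> e}"
        have W: "convex ?W" by (rule convex_thickening[OF C(2)])
        have "(1 / (s - t)) *\<^sub>R (Z n s - Z n t) \<in> ?W"
        proof (rule incr)
          fix i assume i: "i < Suc n" "tt n i < s" "t < tt n (Suc i)"
          have step: "tt n (Suc i) = tt n i + h n" by (simp add: tt_def algebra_simps)
          have near: "dist (Z n r) (g t) < \<eta>0" if r: "r \<in> {t0..T}" "\<bar>r - t\<bar> < 2 * \<eta>" for r
          proof -
            have "norm (Z n r - Z n t) \<le> B * \<bar>r - t\<bar>" using Zlip r tT by simp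
            also have "\<dots> \<le> B * (2 * \<eta>)" using B0 r by (intro mult_left_mono) auto
            finally have "norm (Z n r - Z n t) \<le> \<eta>0 / 2" using \<eta>small by linarith
            then show ?thesis
              using n(2) norm_triangle_ineq[of "Z n r - Z n t" "Z n t - g t"] by (simp add: dist_norm)
          qed
          have "\<bar>tt n i - t\<bar> < 2 * \<eta>" "\<bar>tt n (Suc i) - t\<bar> < 2 * \<eta>"
            using i step s n(1) h(1)[of n] by linarith+
          then have "dist (Z n (tt n i)) (g t) < \<eta>0" "dist (Z n (tt n (Suc i))) (g t) < \<eta>0" "dist (tt n i) t < \<eta>0"
            using near[of "tt n i"] near[of "tt n (Suc i)"] tt i(1) \<eta>small by (simp_all add: dist_real_def)
          then have close: "dist (X n i) (fst (g t)) < \<eta>0" "dist (V n (Suc i)) (snd (g t)) < \<eta>0" "dist (tt n i) t < \<eta>0"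
            using node[of i n] node[of "Suc i" n] i(1)
              dist_fst_le[of "Z n (tt n i)" "g t"] dist_snd_le[of "Z n (tt n (Suc i))" "g t"] by auto
          have "convex hull (field (tt n i) (X n i, V n (Suc i)) ` optimal (tt n i) (X n i, V n (Suc i))) \<subseteq> ?W"
          proof (rule hull_minimal[OF image_subsetI])
            fix u assume "u \<in> optimal (tt n i) (X n i, V n (Suc i))"
            then obtain u0 where "u0 \<in> optimal t (g t)"
              "norm (field (tt n i) (X n i, V n (Suc i)) u - field t (g t) u0) < e"
              using \<eta>0(2)[of "tt n i" "(X n i, V n (Suc i))" u] close by auto
            then show "field (tt n i) (X n i, V n (Suc i)) u \<in> ?W"
              using C(3) by (intro CollectI bexI[of _ "field t (g t) u0"]) auto
          qed (rule W)
          then show "vel n i \<in> ?W"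
            using vel[OF i(1)] by blast
        qed (use s tT \<eta> W in auto)
        then show ?thesis by simp
      qed
      then show "\<exists>\<eta>>0. \<forall>s. t < s \<and> s < t + \<eta> \<longrightarrow>
          (\<forall>\<^sub>F j in sequentially. \<exists>c\<in>C. norm ((1 / (s - t)) *\<^sub>R (Z (k j) s - Z (k j) t) - c) \<le> e)"
        using \<eta>(1) ev by (intro exI[of _ \<eta>]) (auto elim: eventually_mono)
    qed (rule tT)
    then show ?thesis using gv by blast
  qed
  moreover have "B-lipschitz_on {t0..T} g"
    by (rule lipschitz_onI) (use glip B0 in \<open>auto simp: dist_norm\<close>)
  ultimately show ?thesis
    using g_start g_diag g_end by blast
qed

end

text \<open>Along the ray, the derivative at \<open>s\<close> is
  \<open>F' (s *\<^sub>R x) x\<close>. The hypothesis concerns the direction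
  \<open>s *\<^sub>R x\<close>, and by linearity the factor \<open>s\<close> cancels for positive
  \<open>s\<close>; the mean value inequality on the unit interval does the rest.\<close>

lemma growth_from_radial_derivative:
  fixes F :: "'a::real_normed_vector \<Rightarrow> 'b::real_normed_vector"
  assumes F: "\<And>x. (F has_derivative F' x) (at x)" and Q: "\<And>x. norm (F' x x) \<le> Q * norm x"
  shows "norm (F x) \<le> norm (F 0) + Q * norm x"
proof -
  have D: "((\<lambda>s. F (s *\<^sub>R x)) has_vector_derivative F' (s *\<^sub>R x) x) (at s)" for s :: real
  proof -
    have "((\<lambda>s. s *\<^sub>R x) has_derivative (\<lambda>r. r *\<^sub>R x)) (at s)"
      by (auto intro!: derivative_eq_intros)
    then have "((\<lambda>s. F (s *\<^sub>R x)) has_derivative (\<lambda>r. F' (s *\<^sub>R x) (r *\<^sub>R x))) (at s)"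
      using F by (rule has_derivative_compose)
    then show ?thesis
      using has_derivative_linear[OF F] by (simp add: has_vector_derivative_def linear_scale)
  qed
  have "norm (F (1 *\<^sub>R x) - F (0 *\<^sub>R x)) \<le> 1 * (Q * norm x) - 0 * (Q * norm x)"
  proof (rule differentiable_bound_general[where f' = "\<lambda>s. F' (s *\<^sub>R x) x" and \<phi>' = "\<lambda>_. Q * norm x"])
    show "continuous_on {0..1} (\<lambda>s::real. F (s *\<^sub>R x))"
      using D by (intro continuous_at_imp_continuous_on ballI) (blast intro: has_vector_derivative_continuous)
    fix s :: real assume s: "0 < s" "s < 1"
    show "((\<lambda>s. s * (Q * norm x)) has_vector_derivative Q * norm x) (at s)"
      by (auto intro!: derivative_eq_intros simp: has_real_derivative_iff_has_vector_derivative[symmetric])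
    have "F' (s *\<^sub>R x) (s *\<^sub>R x) = s *\<^sub>R F' (s *\<^sub>R x) x"
      using has_derivative_linear[OF F] by (rule linear_scale)
    then have "s * norm (F' (s *\<^sub>R x) x) \<le> s * (Q * norm x)"
      using Q[of "s *\<^sub>R x"] s by (simp add: mult_ac)
    then show "norm (F' (s *\<^sub>R x) x) \<le> Q * norm x" using s by simp
  qed (auto intro!: continuous_intros D)
  then show ?thesis using norm_triangle_ineq[of "F x - F 0" "F 0"] by simp
qed

text \<open>Composing the total derivative with the embedding \<open>E\<close> of the state
  directions gives the partial one, which thereby inherits continuity in all variables.\<close>

lemma continuously_differentiable_partial:
  fixes f :: "real \<Rightarrow> 'a::euclidean_space \<Rightarrow> 'b::euclidean_space \<Rightarrow> 'a"
  assumes "continuously_differentiable (\<lambda>(t, x, v). f t x v)"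
  obtains Fx where "continuous_on UNIV (\<lambda>(t, x, u). f t x u)"
    "\<And>t x u. ((\<lambda>y. f t y u) has_derivative blinfun_apply (Fx t x u)) (at x)"
    "continuous_on UNIV (\<lambda>(t, x, u). Fx t x u)"
proof -
  obtain F' :: "real \<times> 'a \<times> 'b \<Rightarrow> (real \<times> 'a \<times> 'b) \<Rightarrow>\<^sub>L 'a" where
    F': "\<And>p. ((\<lambda>(t, x, v). f t x v) has_derivative blinfun_apply (F' p)) (at p)" "continuous_on UNIV F'"
    using assms unfolding continuously_differentiable_def by blast
  define E :: "'a \<Rightarrow>\<^sub>L (real \<times> 'a \<times> 'b)" where "E = Blinfun (\<lambda>y. (0, y, 0))"
  have E: "blinfun_apply E = (\<lambda>y. (0, y, 0))"
    unfolding E_def by (rule bounded_linear_Blinfun_apply)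
      (intro bounded_linear_Pair bounded_linear_zero bounded_linear_ident)
  show ?thesis
  proof (rule that[of "\<lambda>t x u. F' (t, x, u) o\<^sub>L E"])
    show "continuous_on UNIV (\<lambda>(t, x, u). f t x u)"
      using F'(1) by (intro continuous_at_imp_continuous_on ballI has_derivative_continuous)
    show "((\<lambda>y. f t y u) has_derivative blinfun_apply (F' (t, x, u) o\<^sub>L E)) (at x)" for t x u
    proof -
      have "((\<lambda>y. (t, y, u)) has_derivative (\<lambda>y. (0, y, 0))) (at x)"
        by (intro has_derivative_Pair has_derivative_const has_derivative_ident)
      from has_derivative_compose[OF this F'(1)] show ?thesis
        by (simp add: E blinfun_compose.rep_eq o_def)
    qed
    show "continuous_on UNIV (\<lambda>(t, x, u). F' (t, x, u) o\<^sub>L E)"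
      using F'(2) by (auto intro!: continuous_intros simp: case_prod_beta)
  qed
qed

theorem theorem3p1:
  fixes f :: "real \<Rightarrow> 'a::euclidean_space \<Rightarrow> 'b::euclidean_space \<Rightarrow> 'a"
    and \<Omega> :: "'b set" and K :: "'a set" and Q :: real
    and u :: "real \<Rightarrow> 'a \<Rightarrow> 'b"
  assumes "continuously_differentiable (\<lambda>(t, x, v). f t x v)"
    and "compact \<Omega>" and "compact K"
    and "Q > 0"
    and "\<And>t x v. v \<in> \<Omega> \<Longrightarrow> norm (frechet_derivative (\<lambda>y. f t y v) (at x) x) \<le> Q * norm x"
    and "\<And>t v. v \<in> \<Omega> \<Longrightarrow> norm (frechet_derivative (\<lambda>w. f t 0 w) (at v) v) \<le> Q * norm v"
    and "\<And>t x. u t x \<in> \<Omega>"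
    and "stabilizable_by f K u"
  shows "\<forall>\<delta>>0. \<forall>t0. \<forall>x0\<in>K. \<exists>\<nu>0 T. T > 0 \<and> T > t0 \<and>
    (\<forall>w. minimizing_control f \<Omega> w \<longrightarrow>
      (\<exists>x \<nu>. filippov_solution_on {t0..T} (hamiltonian_field f w) (\<lambda>t. (x t, \<nu> t)) \<and>
        x t0 = x0 \<and> \<nu> t0 = \<nu>0 \<and> norm (x T) \<le> \<delta> \<and> \<nu> T = x T))"
proof (intro allI impI ballI)
  fix \<delta> t0 :: real and x0 assume \<delta>: "\<delta> > 0" and x0: "x0 \<in> K"
  obtain Fx where Fx: "continuous_on UNIV (\<lambda>(t, x, u). f t x u)"
    "\<And>t x u. ((\<lambda>y. f t y u) has_derivative blinfun_apply (Fx t x u)) (at x)"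
    "continuous_on UNIV (\<lambda>(t, x, u). Fx t x u)"
    using continuously_differentiable_partial[OF assms(1)] by blast
  interpret control_system f Fx \<Omega> Q
  proof
    fix v t x assume "v \<in> \<Omega>"
    then have "norm (Fx t y v y) \<le> Q * norm y" for y
      using assms(5)[of v t y] unfolding frechet_derivative_at[OF Fx(2), symmetric] by simp
    then show "norm (f t x v) \<le> norm (f t 0 v) + Q * norm x"
      by (rule growth_from_radial_derivative[OF Fx(2)])
  qed (use Fx assms in auto)
  let ?g = "\<lambda>t x. f t x (u t x)"
  obtain y where y: "filippov_solution_on {t0..} ?g y" "y t0 = x0" "(y \<longlongrightarrow> 0) at_top"
    using assms(8) x0 unfolding stabilizable_by_def Let_def by blast
  have "\<forall>\<^sub>F t in at_top. norm (y t) < \<delta> \<and> t > max 0 t0"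
    using tendstoD[OF y(3) \<delta>] eventually_gt_at_top[of "max 0 t0"] by (auto intro: eventually_conj)
  \<comment> \<open>The strict inequality provides the margin that absorbs the tracking error of the
    Euler schemes.\<close>
  then obtain T where T: "norm (y T) < \<delta>" "T > 0" "T > t0"
    unfolding eventually_at_top_linorder by auto
  have "AE t in lebesgue. t \<in> {t0..} \<longrightarrow> (\<exists>v\<in>filippov_set ?g t (y t). (y has_vector_derivative v) (at t within {t0..}))"
    using y(1) by (simp add: filippov_solution_on_def)
  then obtain N where N: "N \<in> null_sets lebesgue" "{t \<in> space lebesgue. \<not> (t \<in> {t0..} \<longrightarrow>
      (\<exists>v\<in>filippov_set ?g t (y t). (y has_vector_derivative v) (at t within {t0..})))} \<subseteq> N"
    unfolding eventually_ae_filter by blast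
  then have "negligible N" by (simp add: negligible_iff_null_sets)
  have "\<exists>z B N. B-lipschitz_on {t0..T} z \<and> fst (z t0) = x0 \<and> snd (z T) = fst (z T) \<and>
    norm (fst (z T)) \<le> \<delta> \<and> negligible N \<and>
    (\<forall>t\<in>{t0..T} - N. \<exists>v. (z has_vector_derivative v) (at t within {t0..T}) \<and>
      (\<forall>C. closed C \<longrightarrow> convex C \<longrightarrow> field t (z t) ` optimal t (z t) \<subseteq> C \<longrightarrow> v \<in> C))"
  proof (rule relaxed_extremal_exists[OF T(3) _ y(2) \<open>negligible N\<close> _ T(1)])
    show "abs_continuous_on {t0..T} y"
      using y(1)[unfolded filippov_solution_on_def, THEN conjunct1, rule_format, of t0 T] by auto
    fix t assume t: "t \<in> {t0..T} - N"
    then have "\<exists>v\<in>filippov_set ?g t (y t). (y has_vector_derivative v) (at t within {t0..})"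
      using N(2) by (simp add: subset_iff) (metis DiffE atLeastAtMost_iff)
    then obtain v where v: "v \<in> filippov_set ?g t (y t)" "(y has_vector_derivative v) (at t within {t0..})"
      by blast
    have "v \<in> convex hull (f t (y t) ` \<Omega>)"
      using filippov_set_feedback[OF assms(7) v(1)] .
    moreover have "(y has_vector_derivative v) (at t within {t0..T})"
      by (rule has_vector_derivative_within_subset[OF v(2)]) auto
    ultimately show "\<exists>v\<in>convex hull (f t (y t) ` \<Omega>). (y has_vector_derivative v) (at t within {t0..T})" by blast
  qed
  then obtain z B M where z: "B-lipschitz_on {t0..T} z" "fst (z t0) = x0" "snd (z T) = fst (z T)"
    "norm (fst (z T)) \<le> \<delta>" "negligible M"
    and zM: "\<forall>t\<in>{t0..T} - M. \<exists>v. (z has_vector_derivative v) (at t within {t0..T}) \<and>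
      (\<forall>C. closed C \<longrightarrow> convex C \<longrightarrow> field t (z t) ` optimal t (z t) \<subseteq> C \<longrightarrow> v \<in> C)"
    by (elim exE conjE)
  have "filippov_solution_on {t0..T} (hamiltonian_field f w) z" if w: "minimizing_control f \<Omega> w" for w
    unfolding filippov_solution_on_def
  proof (intro conjI allI impI)
    show "abs_continuous_on {a..b} z" if "{a..b} \<subseteq> {t0..T}" for a b
      using lipschitz_imp_abs_continuous_on[OF z(1)] that by (rule abs_continuous_on_subset)
    have "\<exists>v\<in>filippov_set (hamiltonian_field f w) t (z t). (z has_vector_derivative v) (at t within {t0..T})"
      if t: "t \<in> {t0..T} - M" for t
    proof -
      \<comment> \<open>As an intersection of closed convex sets, the Filippov set is itself a
        legitimate \<open>C\<close> for \<open>zM\<close>.\<close>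
      let ?C = "filippov_set (hamiltonian_field f w) t (z t)"
      have "closed ?C" "convex ?C"
        unfolding filippov_set_def
        by (intro closed_INT convex_INT ballI closed_closure convex_closure convex_convex_hull)+
      moreover have "field t (z t) ` optimal t (z t) \<subseteq> ?C"
        using field_in_filippov_set[OF w] by blast
      ultimately show ?thesis using bspec[OF zM t] by blast
    qed
    then have "{t \<in> space lebesgue. \<not> (t \<in> {t0..T} \<longrightarrow>
        (\<exists>v\<in>filippov_set (hamiltonian_field f w) t (z t). (z has_vector_derivative v) (at t within {t0..T})))} \<subseteq> M"
      by (intro subsetI) (simp, metis DiffI atLeastAtMost_iff)
    then show "AE t in lebesgue. t \<in> {t0..T} \<longrightarrow>
        (\<exists>v\<in>filippov_set (hamiltonian_field f w) t (z t). (z has_vector_derivative v) (at t within {t0..T}))"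
      using z(5) unfolding eventually_ae_filter negligible_iff_null_sets by blast
  qed
  then have sol: "filippov_solution_on {t0..T} (hamiltonian_field f w) (\<lambda>t. (fst (z t), snd (z t)))"
    if "minimizing_control f \<Omega> w" for w
    using that by simp
  show "\<exists>\<nu>0 T. T > 0 \<and> T > t0 \<and>
    (\<forall>w. minimizing_control f \<Omega> w \<longrightarrow>
      (\<exists>x \<nu>. filippov_solution_on {t0..T} (hamiltonian_field f w) (\<lambda>t. (x t, \<nu> t)) \<and>
        x t0 = x0 \<and> \<nu> t0 = \<nu>0 \<and> norm (x T) \<le> \<delta> \<and> \<nu> T = x T))"
    by (rule exI[of _ "snd (z t0)"], rule exI[of _ T], intro conjI allI impI,
        rule T, rule T, rule exI[of _ "\<lambda>t. fst (z t)"], rule exI[of _ "\<lambda>t. snd (z t)"])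
      (use sol z in simp)
qed

end
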